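(* In the setting described in the context (Stubble model with smoothness $\beta\in\mathbb N$, estimator $\hat f$ based on local polynomial estimators of degree $\ell=\beta-1$ with kernel $K$ and optimal bandwidth), assume $\Delta t\preccurlyeq1$ and assume the conditions Cover, Eigenvalue and Kernel given in the context. Then, for all $x_0\in[0,1]^d$, $$\mathbf{E}\big[\|\hat f(x_0)-f^\star(x_0)\|_2^2\big]\preccurlyeq (\Delta t^2\,n)^{-\frac{2\beta}{2\beta+d}}+\Delta t^{2\beta}.$$
   Context: Asymptotic notation (as $n\to\infty$): $a_n\preccurlyeq b_n$ means $\limsup_{n\to\infty} a_n/b_n<\infty$; $a_n\asymp b_n$ means $a_n\preccurlyeq b_n$ and $b_n\preccurlyeq a_n$. The quantities $d,\beta,L_0,\dots,L_\beta,\sigma,K$ and the constants $C_{\mathsf{egv}},C_{\mathsf{cvr}},C_{\mathsf{ker}}$ below are fixed; all other quantities (in particular $\Delta t$) may vary with $n$. Flow: for a Lipschitz $f\colon\mathbb R^d\to\mathbb R^d$, $U(f,x,\cdot)$ is the unique solution $u$ of $\dot u(t)=f(u(t))$, $u(0)=x$. Smoothness class: $\mathcal F_{d,\beta}$ is the set of $\beta$-times continuously differentiable $f\colon\mathbb R^d\to\mathbb R^d$ with $\sup_{x}\|D^kf(x)\|_{\mathsf{op}}\le L_k$ for $k=0,\dots,\beta$, where $L_0,\dots,L_\beta>0$, $\|D^kf(x)\|_{\mathsf{op}}=\sup\|D^kf(x)[v_1,\dots,v_k]\|_2$ over unit vectors $v_i$, and $D^0f=f$. Model: $d,\beta\in\mathbb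 N$, $f^\star\in\mathcal F_{d,\beta}$, $m\in\mathbb N$, $x_1,\dots,x_m\in[0,1]^d$, $\Delta t>0$, $t_i=i\Delta t$ for $i=0,\dots,\beta$, total number of observations $n=\beta m$. Let $\sigma\ge0$ and let $\varepsilon_{j,i}$ ($1\le j\le m$, $1\le i\le\beta$) be independent $\mathbb R^d$-valued with $\mathbf E[\varepsilon_{j,i}]=0$, $\mathbf E[\|\varepsilon_{j,i}\|_2^2]\le\sigma^2$. Observe $Y_{j,i}=U(f^\star,x_j,i\Delta t)+\varepsilon_{j,i}$. Local polynomial estimator: let $\ell=\beta-1$, $N=\binom{\ell+d}{d}$, $\psi(z)=(z^\alpha/\alpha!)_{\alpha\in\mathbb N_0^d,|\alpha|\le\ell}\in\mathbb R^N$, $K\colon[0,\infty)\to\mathbb R$, bandwidth $h>0$. From scalar data $(x_j,Z_j)_{j=1}^m$ let $\hat\theta(x)\in\arg\min_{\theta\in\mathbb R^N}\sum_{j=1}^m(Z_j-\theta^\top\psi((x_j-x)/h))^2K(\|x_j-x\|_2/h)$; the local polynomial estimate at $x$ is $\psi(0)^\top\hat\theta(x)$. For $\mathbb R^d$-valued data it is applied to each component. The bandwidth is of the optimal order $h\asymp(\Delta t^2n)^{-1/(2\beta+d)}$ (optimal for $\beta$-smooth functions on $[0,1]^d$ with Hölder constant of order $\Delta t$). Estimator of $f^\star$: for $i=1,\dots,\beta$ let $\hat\iota_i$ be the local polynomial estimator computed from $(x_j,Y_{j,i}-x_j)_{j=1}^m$, and $\hat\iota_0:=0$. Let $\hat p(x_0,\cdot)\colon\mathbb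 R\to\mathbb R^d$ be the componentwise polynomial of degree at most $\beta$ interpolating $(t_i,\hat\iota_i(x_0))$, $i=0,\dots,\beta$. Define $\hat f(x_0):=\dot{\hat p}(x_0,0)$ (derivative in $t$ at $0$). Conditions (constants do not depend on $n$). Eigenvalue: with $B(x):=\frac1{mh^d}\sum_{j=1}^m\psi(\frac{x_j-x}h)\psi(\frac{x_j-x}h)^\top K(\frac{\|x_j-x\|_2}h)$, the smallest eigenvalue satisfies $\lambda_{\min}(B(x))>0$ and $\lambda_{\min}(B(x))^{-1}\le C_{\mathsf{egv}}$ for all $x\in[0,1]^d$. Cover: $\frac1m\#\{j:\|x_j-x\|_2\le r\}\le\max(\frac1m,C_{\mathsf{cvr}}r^d)$ for all $x\in[0,1]^d$, $r>0$. Kernel: $\operatorname{supp}(K)\subseteq[0,1]$ and $|K(z)|\le C_{\mathsf{ker}}$ for all $z\ge0$. *)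

theory Defs
  imports "HOL-Probability.Probability" "HOL-Computational_Algebra.Polynomial"
begin

section \<open>Asymptotic order\<close>

definition asymp_le :: "(nat \<Rightarrow> real) \<Rightarrow> (nat \<Rightarrow> real) \<Rightarrow> bool" where
  "asymp_le a b \<longleftrightarrow> limsup (\<lambda>n. ereal (a n / b n)) < \<infinity>"

definition asymp_same :: "(nat \<Rightarrow> real) \<Rightarrow> (nat \<Rightarrow> real) \<Rightarrow> bool" where
  "asymp_same a b \<longleftrightarrow> asymp_le a b \<and> asymp_le b a"


section \<open>Flow and smoothness class\<close>

text \<open>The solution is required on the whole real line, where it exists and is unique
  for Lipschitz right-hand sides.\<close>

definition flow :: "('a::real_normed_vector \<Rightarrow> 'a) \<Rightarrow> 'a \<Rightarrow> real \<Rightarrow> 'a" where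
  "flow f x = (THE u. u 0 = x \<and> (\<forall>t. (u has_vector_derivative f (u t)) (at t)))"

text \<open>\<open>deriv_at f [v\<^sub>1, \<dots>, v\<^sub>k] x\<close> is \<open>D\<^sup>k f(x)[v\<^sub>1, \<dots>, v\<^sub>k]\<close>, the iterated Frechet
  derivative evaluated at its directions; the order \<open>k\<close> is the length of the list.\<close>

fun deriv_at :: "('a::real_normed_vector \<Rightarrow> 'b::real_normed_vector) \<Rightarrow> 'a list \<Rightarrow> 'a \<Rightarrow> 'b" where
  "deriv_at f [] x = f x"
| "deriv_at f (v # vs) x = frechet_derivative (deriv_at f vs) (at x) v"

text \<open>The domain is finite-dimensional, so (continuous) differentiability of the
  multilinear-map-valued \<open>D\<^sup>k f\<close> is (continuous) differentiability of its evaluations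
  at all fixed tuples of directions.\<close>

definition times_cont_diff ::
    "nat \<Rightarrow> ('a::euclidean_space \<Rightarrow> 'b::real_normed_vector) \<Rightarrow> bool" where
  "times_cont_diff \<beta> f \<longleftrightarrow>
     (\<forall>vs x. length vs < \<beta> \<longrightarrow> deriv_at f vs differentiable (at x)) \<and>
     (\<forall>vs. length vs \<le> \<beta> \<longrightarrow> continuous_on UNIV (deriv_at f vs))"

definition op_norm_deriv ::
    "nat \<Rightarrow> ('a::euclidean_space \<Rightarrow> 'b::real_normed_vector) \<Rightarrow> 'a \<Rightarrow> ereal" where
  "op_norm_deriv k f x =
     (SUP vs \<in> {vs. length vs = k \<and> (\<forall>v\<in>set vs. norm v = 1)}. ereal (norm (deriv_at f vs x)))"

definition smooth_class ::
    "nat \<Rightarrow> (nat \<Rightarrow> real) \<Rightarrow> ('a::euclidean_space \<Rightarrow> 'a) set" where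
  "smooth_class \<beta> L =
     {f. times_cont_diff \<beta> f \<and> (\<forall>k\<le>\<beta>. (SUP x. op_norm_deriv k f x) \<le> ereal (L k))}"


section \<open>Stubble model\<close>

text \<open>Indices: \<open>j \<in> {1..m}\<close> is the initial condition, \<open>i \<in> {1..\<beta>}\<close> the time step.
  Integrability of the squared norm is stated explicitly, because the Bochner integral of a
  non-integrable function is 0; it also makes the noise itself integrable.\<close>

definition noise_model ::
    "nat \<Rightarrow> nat \<Rightarrow> real \<Rightarrow> 'w measure \<Rightarrow> (nat \<Rightarrow> nat \<Rightarrow> 'w \<Rightarrow> real ^ 'd) \<Rightarrow> bool" where
  "noise_model \<beta> m \<sigma> M \<epsilon> \<longleftrightarrow>
     prob_space M \<and>
     prob_space.indep_vars M (\<lambda>_. borel) (\<lambda>(j, i). \<epsilon> j i) ({1..m} \<times> {1..\<beta>}) \<and>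
     (\<forall>j\<in>{1..m}. \<forall>i\<in>{1..\<beta>}.
        integral\<^sup>L M (\<epsilon> j i) = 0 \<and>
        integrable M (\<lambda>\<omega>. (norm (\<epsilon> j i \<omega>))\<^sup>2) \<and>
        integral\<^sup>L M (\<lambda>\<omega>. (norm (\<epsilon> j i \<omega>))\<^sup>2) \<le> \<sigma>\<^sup>2)"

text \<open>In \<open>real ^ 'd\<close>, \<open>1\<close> is the all-ones vector, so \<open>cbox 0 1\<close> is the unit cube.\<close>

definition stubble_model ::
    "nat \<Rightarrow> (nat \<Rightarrow> real) \<Rightarrow> real \<Rightarrow> nat \<Rightarrow> 'w measure \<Rightarrow> (real ^ 'd \<Rightarrow> real ^ 'd) \<Rightarrow>
     (nat \<Rightarrow> real ^ 'd) \<Rightarrow> real \<Rightarrow> (nat \<Rightarrow> nat \<Rightarrow> 'w \<Rightarrow> real ^ 'd) \<Rightarrow>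
     (nat \<Rightarrow> nat \<Rightarrow> 'w \<Rightarrow> real ^ 'd) \<Rightarrow> bool" where
  "stubble_model \<beta> L \<sigma> m M f x \<Delta> \<epsilon> Y \<longleftrightarrow>
     f \<in> smooth_class \<beta> L \<and>
     (\<forall>j\<in>{1..m}. x j \<in> cbox 0 1) \<and>
     \<Delta> > 0 \<and>
     noise_model \<beta> m \<sigma> M \<epsilon> \<and>
     (\<forall>j\<in>{1..m}. \<forall>i\<in>{1..\<beta>}. \<forall>\<omega>\<in>space M.
        Y j i \<omega> = flow f (x j) (real i * \<Delta>) + \<epsilon> j i \<omega>)"


section \<open>Local polynomial estimator\<close>

definition multi_indices :: "nat \<Rightarrow> ('d::finite \<Rightarrow> nat) set" where
  "multi_indices l = {\<alpha>. (\<Sum>i\<in>UNIV. \<alpha> i) \<le> l}"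

definition monomial_basis :: "real ^ 'd \<Rightarrow> ('d \<Rightarrow> nat) \<Rightarrow> real" where
  "monomial_basis z \<alpha> = (\<Prod>i\<in>UNIV. (z $ i) ^ \<alpha> i) / (\<Prod>i\<in>UNIV. fact (\<alpha> i))"

text \<open>Elements of \<open>\<real>\<^sup>N\<close> are families indexed by \<open>multi_indices l\<close>, and likewise for
  \<open>N \<times> N\<close> matrices; this avoids choosing an enumeration of the multi-indices.\<close>

definition lp_objective ::
    "nat \<Rightarrow> (real \<Rightarrow> real) \<Rightarrow> real \<Rightarrow> nat \<Rightarrow> (nat \<Rightarrow> real ^ 'd) \<Rightarrow> (nat \<Rightarrow> real) \<Rightarrow>
     real ^ 'd \<Rightarrow> (('d \<Rightarrow> nat) \<Rightarrow> real) \<Rightarrow> real" where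
  "lp_objective l K h m x Z y \<theta> =
     (\<Sum>j=1..m.
        (Z j - (\<Sum>\<alpha>\<in>multi_indices l. \<theta> \<alpha> * monomial_basis ((x j - y) /\<^sub>R h) \<alpha>))\<^sup>2 *
        K (norm (x j - y) / h))"

text \<open>When the matrix \<open>lp_matrix\<close> below is positive definite the minimiser is unique, so that
  the choice made by \<open>arg_min\<close> is immaterial.\<close>

definition lp_coeffs ::
    "nat \<Rightarrow> (real \<Rightarrow> real) \<Rightarrow> real \<Rightarrow> nat \<Rightarrow> (nat \<Rightarrow> real ^ 'd) \<Rightarrow> (nat \<Rightarrow> real) \<Rightarrow>
     real ^ 'd \<Rightarrow> ('d \<Rightarrow> nat) \<Rightarrow> real" where
  "lp_coeffs l K h m x Z y =
     arg_min (lp_objective l K h m x Z y) (\<lambda>\<theta>. \<theta> \<in> multi_indices l \<rightarrow>\<^sub>E UNIV)"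

definition lp_estimate ::
    "nat \<Rightarrow> (real \<Rightarrow> real) \<Rightarrow> real \<Rightarrow> nat \<Rightarrow> (nat \<Rightarrow> real ^ 'd) \<Rightarrow> (nat \<Rightarrow> real) \<Rightarrow>
     real ^ 'd \<Rightarrow> real" where
  "lp_estimate l K h m x Z y =
     (\<Sum>\<alpha>\<in>multi_indices l. monomial_basis 0 \<alpha> * lp_coeffs l K h m x Z y \<alpha>)"

definition lp_estimate_vec ::
    "nat \<Rightarrow> (real \<Rightarrow> real) \<Rightarrow> real \<Rightarrow> nat \<Rightarrow> (nat \<Rightarrow> real ^ 'd) \<Rightarrow> (nat \<Rightarrow> real ^ 'e) \<Rightarrow>
     real ^ 'd \<Rightarrow> real ^ 'e" where
  "lp_estimate_vec l K h m x Z y = (\<chi> c. lp_estimate l K h m x (\<lambda>j. Z j $ c) y)"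


section \<open>Estimator of the vector field\<close>

definition increment_estimate ::
    "nat \<Rightarrow> (real \<Rightarrow> real) \<Rightarrow> real \<Rightarrow> nat \<Rightarrow> (nat \<Rightarrow> real ^ 'd) \<Rightarrow>
     (nat \<Rightarrow> nat \<Rightarrow> real ^ 'd) \<Rightarrow> nat \<Rightarrow> real ^ 'd \<Rightarrow> real ^ 'd" where
  "increment_estimate \<beta> K h m x Y i y =
     (if i = 0 then 0 else lp_estimate_vec (\<beta> - 1) K h m x (\<lambda>j. Y j i - x j) y)"

definition interpolation_poly :: "nat \<Rightarrow> (nat \<Rightarrow> real) \<Rightarrow> (nat \<Rightarrow> real) \<Rightarrow> real poly" where
  "interpolation_poly n t v = (THE p. degree p \<le> n \<and> (\<forall>i\<le>n. poly p (t i) = v i))"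

definition field_estimate ::
    "nat \<Rightarrow> (real \<Rightarrow> real) \<Rightarrow> real \<Rightarrow> nat \<Rightarrow> (nat \<Rightarrow> real ^ 'd) \<Rightarrow> real \<Rightarrow>
     (nat \<Rightarrow> nat \<Rightarrow> real ^ 'd) \<Rightarrow> real ^ 'd \<Rightarrow> real ^ 'd" where
  "field_estimate \<beta> K h m x \<Delta> Y y =
     (\<chi> c. poly (pderiv (interpolation_poly \<beta> (\<lambda>i. real i * \<Delta>)
                    (\<lambda>i. increment_estimate \<beta> K h m x Y i y $ c))) 0)"


definition squared_error ::
    "nat \<Rightarrow> (real \<Rightarrow> real) \<Rightarrow> real \<Rightarrow> nat \<Rightarrow> (nat \<Rightarrow> real ^ 'd) \<Rightarrow> real \<Rightarrow>
     (nat \<Rightarrow> nat \<Rightarrow> 'w \<Rightarrow> real ^ 'd) \<Rightarrow> (real ^ 'd \<Rightarrow> real ^ 'd) \<Rightarrow> real ^ 'd \<Rightarrow> 'w \<Rightarrow> real" where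
  "squared_error \<beta> K h m x \<Delta> Y f y \<omega> =
     (norm (field_estimate \<beta> K h m x \<Delta> (\<lambda>j i. Y j i \<omega>) y - f y))\<^sup>2"


section \<open>Conditions on design and kernel\<close>

definition lp_matrix ::
    "(real \<Rightarrow> real) \<Rightarrow> real \<Rightarrow> nat \<Rightarrow> (nat \<Rightarrow> real ^ 'd) \<Rightarrow> real ^ 'd \<Rightarrow>
     ('d \<Rightarrow> nat) \<Rightarrow> ('d \<Rightarrow> nat) \<Rightarrow> real" where
  "lp_matrix K h m x y \<alpha> \<gamma> =
     1 / (real m * h ^ CARD('d)) *
     (\<Sum>j=1..m. monomial_basis ((x j - y) /\<^sub>R h) \<alpha> * monomial_basis ((x j - y) /\<^sub>R h) \<gamma> *
        K (norm (x j - y) / h))"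

definition eigenvalue_on :: "'i set \<Rightarrow> ('i \<Rightarrow> 'i \<Rightarrow> real) \<Rightarrow> real \<Rightarrow> bool" where
  "eigenvalue_on I A \<mu> \<longleftrightarrow>
     (\<exists>v. (\<exists>i\<in>I. v i \<noteq> 0) \<and> (\<forall>i\<in>I. (\<Sum>j\<in>I. A i j * v j) = \<mu> * v i))"

text \<open>A smallest eigenvalue exists for symmetric matrices over a finite nonempty index set.\<close>

definition min_eigenvalue :: "'i set \<Rightarrow> ('i \<Rightarrow> 'i \<Rightarrow> real) \<Rightarrow> real" where
  "min_eigenvalue I A = (LEAST \<mu>. eigenvalue_on I A \<mu>)"

definition eigenvalue_condition ::
    "nat \<Rightarrow> (real \<Rightarrow> real) \<Rightarrow> real \<Rightarrow> real \<Rightarrow> nat \<Rightarrow> (nat \<Rightarrow> real ^ 'd) \<Rightarrow> bool" where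
  "eigenvalue_condition l K C h m x \<longleftrightarrow>
     (\<forall>y\<in>cbox 0 1.
        min_eigenvalue (multi_indices l) (lp_matrix K h m x y) > 0 \<and>
        inverse (min_eigenvalue (multi_indices l) (lp_matrix K h m x y)) \<le> C)"

definition cover_condition :: "real \<Rightarrow> nat \<Rightarrow> (nat \<Rightarrow> real ^ 'd) \<Rightarrow> bool" where
  "cover_condition C m x \<longleftrightarrow>
     (\<forall>y\<in>cbox 0 1. \<forall>r>0.
        real (card {j\<in>{1..m}. norm (x j - y) \<le> r}) / real m
          \<le> max (1 / real m) (C * r ^ CARD('d)))"

text \<open>The kernel is a function on the half-line \<open>[0, \<infinity>)\<close>; its values at negative arguments
  are irrelevant.\<close>

definition kernel_condition :: "real \<Rightarrow> (real \<Rightarrow> real) \<Rightarrow> bool" where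
  "kernel_condition C K \<longleftrightarrow>
     closure {z. z \<ge> 0 \<and> K z \<noteq> 0} \<subseteq> {0..1} \<and> (\<forall>z\<ge>0. \<bar>K z\<bar> \<le> C)"

end

theory Submission
  imports Defs
begin

text \<open>
  Under the eigenvalue condition the local polynomial estimate is a linear functional of the data whose
  weights \<open>W j\<close> reproduce polynomials of degree below \<open>\<beta>\<close>, live on the ball of radius \<open>h\<close> and are of
  size \<open>1 / (m h^d)\<close>. Composed with the derivative at 0 of the interpolation polynomial, the
  estimator is linear with weights \<open>deriv_weight \<beta> i / \<Delta> * W j\<close>; it annihilates \<open>t * q(z, t)\<close> for
  \<open>q\<close> homogeneous of degree \<open>1, \<dots>, \<beta> - 1\<close> and sends \<open>t\<close> to 1.

  For the bias it therefore suffices that, jointly in \<open>z\<close> and \<open>t\<close> of size \<open>\<rho>\<close>, the increment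
  \<open>flow f (y + z) t - (y + z)\<close> is \<open>t\<close> times a polynomial of degree below \<open>\<beta>\<close> with constant term close
  to \<open>f y\<close>, up to \<open>t * O(\<rho>^\<beta>)\<close>. This joint expansion replaces both the smoothness of the flow in
  the initial value and the analysis of the interpolation error, and with \<open>\<rho>\<close> of order \<open>h + \<Delta>\<close> it
  yields a squared bias of order \<open>h^(2\<beta>) + \<Delta>^(2\<beta>)\<close>. The variance is of order \<open>1 / (\<Delta>^2 m h^d)\<close>, which
  the bandwidth balances against \<open>h^(2\<beta>)\<close>.
\<close>

subsection \<open>Global solutions of the flow equation\<close>

text \<open>Differentiating the interpolant divides by \<open>\<Delta>\<close>, so a bare
  approximation error of order \<open>\<rho>^\<beta>\<close> would be ruinous when
  \<open>\<Delta>\<close> is much smaller than \<open>h\<close>. This is why the expansion carries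
  an explicit factor \<open>t\<close> in its remainder as well as in its polynomial part: at
  \<open>t = i * \<Delta>\<close> it cancels the division exactly.

  The bandwidth may be unbounded, because \<open>\<Delta>^2 * n\<close> may tend to 0, whereas the
  constants of the expansion are uniform only for \<open>\<rho> \<le> R\<close>. As the design lies
  in the unit cube, \<open>h\<close> can be capped by the diameter \<open>sqrt d\<close> when the
  weights are localised.

  The cover condition never promises less than the mass \<open>1/m\<close> of one design point, so
  \<open>1 / (m * h^d)\<close> has to stay bounded; this follows from the lower bound on the
  bandwidth together with bounded \<open>\<Delta>\<close>. Field and design may change with the
  sample size, so all constants are chosen uniformly over the smoothness class.\<close>

lemma norm_increment_le:
  fixes F :: "real \<Rightarrow> 'a::real_inner"
  assumes "a \<le> b"
    and F: "\<And>s. a \<le> s \<Longrightarrow> s \<le> b \<Longrightarrow> (F has_vector_derivative F' s) (at s)"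
    and \<phi>: "\<And>s. a \<le> s \<Longrightarrow> s \<le> b \<Longrightarrow> (\<phi> has_real_derivative \<phi>' s) (at s)"
    and le: "\<And>s. a \<le> s \<Longrightarrow> s \<le> b \<Longrightarrow> norm (F' s) \<le> \<phi>' s"
  shows "norm (F b - F a) \<le> \<phi> b - \<phi> a"
proof (cases "F b = F a")
  case True
  have "\<phi> a \<le> \<phi> b"
    using \<open>a \<le> b\<close>
    by (rule DERIV_nonneg_imp_nondecreasing) (metis \<phi> le norm_ge_zero order_trans)
  with True show ?thesis by simp
next
  case False
  \<comment> \<open>Projecting onto the total increment makes the problem scalar: by Cauchy-Schwarz,
    \<open>\<phi> * norm e\<close> minus the component of \<open>F\<close> along \<open>e\<close> is
    nondecreasing.\<close>
  define e where "e = F b - F a"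
  have "\<phi> a * norm e - (F a - F a) \<bullet> e \<le> \<phi> b * norm e - (F b - F a) \<bullet> e"
  proof (rule DERIV_nonneg_imp_nondecreasing[OF \<open>a \<le> b\<close>])
    fix s assume s: "a \<le> s" "s \<le> b"
    have "((\<lambda>s. \<phi> s * norm e - (F s - F a) \<bullet> e) has_real_derivative \<phi>' s * norm e - F' s \<bullet> e) (at s)"
      using has_vector_derivative_diff[OF
          bounded_linear.has_vector_derivative[OF bounded_linear_mult_left
            \<phi>[OF s, unfolded has_real_derivative_iff_has_vector_derivative]]
          bounded_linear.has_vector_derivative[OF bounded_linear_inner_left
            has_vector_derivative_diff[OF F[OF s] has_vector_derivative_const]]]
      by (simp add: has_real_derivative_iff_has_vector_derivative)
    moreover have "F' s \<bullet> e \<le> \<phi>' s * norm e"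
      by (meson le[OF s] norm_cauchy_schwarz mult_right_mono norm_ge_zero order_trans)
    ultimately show "\<exists>y. ((\<lambda>s. \<phi> s * norm e - (F s - F a) \<bullet> e) has_real_derivative y) (at s) \<and> 0 \<le> y"
      by auto
  qed
  then have "norm e * norm e \<le> (\<phi> b - \<phi> a) * norm e"
    by (simp add: e_def[symmetric] power2_norm_eq_inner[symmetric] power2_eq_square left_diff_distrib)
  with False show ?thesis by (simp add: e_def)
qed

lemma antiderivative_on_line:
  fixes g :: "real \<Rightarrow> 'a::euclidean_space"
  assumes "continuous_on UNIV g"
  obtains G where "G 0 = 0" "\<And>t. (G has_vector_derivative g t) (at t)"
proof
  show "(LBINT s=0..(0::real). g s) = 0"
    unfolding zero_ereal_def by (rule interval_integral_endpoints_same)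
  fix t :: real
  \<comment> \<open>The fundamental theorem is applied on a compact interval with \<open>t\<close>
    in its interior, so that the derivative within the interval is the full derivative.\<close>
  define b where "b = \<bar>t\<bar> + 1"
  have "((\<lambda>u. LBINT s=(0::real)..u. g s) has_vector_derivative g t) (at t within {-b..b})"
    by (rule interval_integral_FTC2) (auto simp: b_def intro: continuous_on_subset[OF assms])
  then show "((\<lambda>u. LBINT s=0..u. g s) has_vector_derivative g t) (at t)"
    by (subst (asm) at_within_interior) (auto simp: b_def zero_ereal_def)
qed

text \<open>A primitive of a bounded field grows at most linearly; this bound keeps it bounded after
  multiplication by the weight of the Picard space.\<close>

lemma abs_mult_exp_le:
  fixes L t :: real
  assumes "L > 0"
  shows "exp (- 2 * L * \<bar>t\<bar>) * \<bar>t\<bar> \<le> 1 / L"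
proof -
  have "L * \<bar>t\<bar> \<le> exp (2 * L * \<bar>t\<bar>)"
    using exp_ge_add_one_self[of "2 * L * \<bar>t\<bar>"] mult_nonneg_nonneg[of L "\<bar>t\<bar>"] assms
    by linarith
  then have "exp (- (2 * L * \<bar>t\<bar>)) * (L * \<bar>t\<bar>) \<le> exp (- (2 * L * \<bar>t\<bar>)) * exp (2 * L * \<bar>t\<bar>)"
    by (rule mult_left_mono) simp
  also have "\<dots> = 1"
    by (simp add: exp_minus)
  finally show ?thesis
    using assms by (simp add: pos_le_divide_eq mult_ac)
qed

text \<open>The majorant sees only \<open>\<bar>s\<bar>\<close>, so both time directions are treated
  at once; negative times reduce to positive ones by reflection.\<close>

lemma norm_antiderivative_le:
  fixes G :: "real \<Rightarrow> 'a::real_inner"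
  assumes "G 0 = 0" and G: "\<And>t. (G has_vector_derivative g t) (at t)"
    and \<phi>: "\<And>s. (\<phi> has_real_derivative \<phi>' s) (at s)"
    and le: "\<And>s. norm (g s) \<le> \<phi>' \<bar>s\<bar>"
  shows "norm (G t) \<le> \<phi> \<bar>t\<bar> - \<phi> 0"
proof (cases "t \<ge> 0")
  case True
  then have "norm (G t - G 0) \<le> \<phi> t - \<phi> 0"
  proof (rule norm_increment_le)
    show "norm (g s) \<le> \<phi>' s" if "0 \<le> s" for s
      using le[of s] that by simp
  qed (auto intro: G \<phi>)
  with True \<open>G 0 = 0\<close> show ?thesis by simp
next
  case False
  then have "norm (G (- (- t)) - G (- 0)) \<le> \<phi> (- t) - \<phi> 0"
  proof (intro norm_increment_le[where F = "\<lambda>s. G (- s)"])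
    show "((\<lambda>s. G (- s)) has_vector_derivative - g (- s)) (at s)" for s
      using vector_diff_chain_at[of "\<lambda>s. - s" "- 1" s G "g (- s)"] G[of "- s"]
      by (simp add: o_def has_vector_derivative_minus has_vector_derivative_id)
    show "norm (- g (- s)) \<le> \<phi>' s" if "0 \<le> s" for s
      using le[of "- s"] that by simp
  qed (auto intro: \<phi>)
  with False \<open>G 0 = 0\<close> show ?thesis by simp
qed

text \<open>The Picard operator contracts in the norm weighted by \<open>exp (- 2 L \<bar>t\<bar>)\<close>, so no gluing of
  local solutions is needed.\<close>

lemma global_solution_exists:
  fixes f :: "'a::euclidean_space \<Rightarrow> 'a"
  assumes lip: "\<And>x y. norm (f x - f y) \<le> L * norm (x - y)" and "L > 0"
    and bd: "\<And>x. norm (f x) \<le> B"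
  obtains u where "u 0 = x" "\<And>t. (u has_vector_derivative f (u t)) (at t)"
proof -
  have "B \<ge> 0" using bd[of undefined] by (meson norm_ge_zero order_trans)
  define w :: "real \<Rightarrow> real" where "w t = exp (- 2 * L * \<bar>t\<bar>)" for t
  have w_pos: "w t > 0" for t by (simp add: w_def)
  have f_cont: "continuous_on UNIV f"
    by (rule lipschitz_on_continuous_on[where L = L])
      (use lip \<open>L > 0\<close> in \<open>auto simp: lipschitz_on_def dist_norm\<close>)
  \<comment> \<open>Trajectories can be unbounded, so a bounded \<open>v\<close> encodes the
    trajectory \<open>u\<close> by \<open>v t = w t * (u t - x)\<close>. The uniform distance
    between such \<open>v\<close> is the weighted distance between the trajectories.\<close>
  define cur :: "(real \<Rightarrow>\<^sub>C 'a) \<Rightarrow> real \<Rightarrow> 'a" where "cur v t = x + v t /\<^sub>R w t" for v t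
  have cur_cont: "continuous_on UNIV (cur v)" for v
    unfolding cur_def w_def by (intro continuous_intros continuous_on_apply_bcontfun) auto
  have "\<exists>G. G 0 = 0 \<and> (\<forall>t. (G has_vector_derivative f (cur v t)) (at t))" for v
  proof -
    have "continuous_on UNIV (\<lambda>t. f (cur v t))"
      by (rule continuous_on_compose2[OF f_cont cur_cont]) auto
    from antiderivative_on_line[OF this] show ?thesis by metis
  qed
  then obtain G where G0: "\<And>v. G v 0 = 0"
    and G: "\<And>v t. (G v has_vector_derivative f (cur v t)) (at t)"
    by metis
  have G_bd: "norm (G v t) \<le> B * \<bar>t\<bar>" for v t
    using norm_antiderivative_le[OF G0[of v] G[of v], of "\<lambda>s. B * s" "\<lambda>_. B" t] bd
    by (auto intro!: derivative_eq_intros)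
  have G_cont: "continuous_on UNIV (G v)" for v
    by (meson G continuous_at_imp_continuous_on has_vector_derivative_continuous)
  have "\<exists>P. \<forall>v. apply_bcontfun (P v) = (\<lambda>t. w t *\<^sub>R G v t)"
  proof (intro choice allI)
    fix v
    have "(\<lambda>t. w t *\<^sub>R G v t) \<in> bcontfun"
    proof (rule bcontfun_normI[where b = "B / L"])
      show "continuous_on UNIV (\<lambda>t. w t *\<^sub>R G v t)"
        unfolding w_def by (intro continuous_intros G_cont)
      fix t
      have "norm (w t *\<^sub>R G v t) \<le> w t * (B * \<bar>t\<bar>)"
        using G_bd w_pos by (simp add: less_imp_le)
      also have "\<dots> \<le> B / L"
        using mult_left_mono[OF abs_mult_exp_le[OF \<open>L > 0\<close>, of t] \<open>B \<ge> 0\<close>]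
        by (simp add: w_def mult_ac)
      finally show "norm (w t *\<^sub>R G v t) \<le> B / L" .
    qed
    then show "\<exists>p. apply_bcontfun p = (\<lambda>t. w t *\<^sub>R G v t)"
      by (metis bcontfunE)
  qed
  then obtain P :: "(real \<Rightarrow>\<^sub>C 'a) \<Rightarrow> (real \<Rightarrow>\<^sub>C 'a)"
    where P: "\<And>v t. apply_bcontfun (P v) t = w t *\<^sub>R G v t"
    by metis
  have "\<exists>!v. P v = v"
  proof (rule banach_fix_type[where c = "1/2"]; (intro allI)?)
    fix v v' :: "real \<Rightarrow>\<^sub>C 'a"
    show "dist (P v) (P v') \<le> 1/2 * dist v v'"
    proof (rule dist_bound)
      fix t
      \<comment> \<open>A primitive of the Lipschitz majorant
        \<open>L * dist v v' * exp (2 * L * s)\<close>. Integration divides by \<open>2 * L\<close>,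
        which leaves the contraction factor 1/2 once the weight is multiplied back.\<close>
      define \<phi> where "\<phi> s = dist v v' / 2 * exp (2 * L * s)" for s :: real
      have "norm (G v t - G v' t) \<le> \<phi> \<bar>t\<bar> - \<phi> 0"
      proof (rule norm_antiderivative_le)
        show "((\<lambda>t. G v t - G v' t) has_vector_derivative f (cur v t) - f (cur v' t)) (at t)" for t
          by (intro has_vector_derivative_diff G)
        show "(\<phi> has_real_derivative L * dist v v' * exp (2 * L * s)) (at s)" for s
          unfolding \<phi>_def by (auto intro!: derivative_eq_intros)
        show "norm (f (cur v s) - f (cur v' s)) \<le> L * dist v v' * exp (2 * L * \<bar>s\<bar>)" for s
        proof -
          have "norm (f (cur v s) - f (cur v' s)) \<le> L * norm (cur v s - cur v' s)"
            by (rule lip)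
          also have "norm (cur v s - cur v' s) = exp (2 * L * \<bar>s\<bar>) * dist (v s) (v' s)"
            by (simp add: cur_def w_def dist_norm exp_minus scaleR_diff_right[symmetric])
          also have "\<dots> \<le> exp (2 * L * \<bar>s\<bar>) * dist v v'"
            by (intro mult_left_mono dist_bounded) simp
          finally show ?thesis using \<open>L > 0\<close> by (simp add: mult_ac)
        qed
      qed (simp add: G0)
      also have "\<dots> \<le> \<phi> \<bar>t\<bar>" by (simp add: \<phi>_def)
      finally have "norm (G v t - G v' t) \<le> \<phi> \<bar>t\<bar>" .
      then have "w t * norm (G v t - G v' t) \<le> w t * \<phi> \<bar>t\<bar>"
        using w_pos by (simp add: less_imp_le)
      also have "w t * \<phi> \<bar>t\<bar> = 1/2 * dist v v'"
        by (simp add: w_def \<phi>_def exp_minus)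
      finally show "dist (P v t) (P v' t) \<le> 1/2 * dist v v'"
        using w_pos[of t] by (simp add: P dist_norm scaleR_diff_right[symmetric])
    qed
  qed auto
  then obtain v where "P v = v" by auto
  \<comment> \<open>Dividing the fixed point equation by the positive weight gives the integral
    equation.\<close>
  then have "cur v t = x + G v t" for t
    using P[of v t] w_pos[of t] by (simp add: cur_def)
  then have cur: "cur v = (\<lambda>t. x + G v t)" ..
  show ?thesis
  proof (rule that[of "cur v"])
    show "cur v 0 = x" by (simp add: cur G0)
    have "((\<lambda>t. x + G v t) has_vector_derivative f (cur v t)) (at t)" for t
      using has_vector_derivative_add[OF has_vector_derivative_const G[of v t]] by simp
    then show "(cur v has_vector_derivative f (cur v t)) (at t)" for t
      by (simp only: cur)
  qed
qed

text \<open>Gronwall's argument for the squared distance \<open>D\<close>, which unlike the norm is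
  differentiable where the solutions meet. From \<open>\<bar>D' s\<bar> \<le> 2 * L * D s\<close>,
  the product of \<open>D\<close> with an exponential is monotone, with opposite rates forward and
  backward in time.\<close>

lemma global_solution_unique:
  fixes f :: "'a::real_inner \<Rightarrow> 'a"
  assumes lip: "\<And>x y. norm (f x - f y) \<le> L * norm (x - y)"
    and u: "\<And>t. (u has_vector_derivative f (u t)) (at t)"
    and v: "\<And>t. (v has_vector_derivative f (v t)) (at t)"
    and eq: "u 0 = v 0"
  shows "u = v"
proof
  fix t
  define D where "D s = (u s - v s) \<bullet> (u s - v s)" for s
  define D' where "D' s = 2 * ((u s - v s) \<bullet> (f (u s) - f (v s)))" for s
  have D: "(D has_real_derivative D' s) (at s)" for s
    unfolding D_def D'_def using bounded_bilinear.has_vector_derivative[OF bounded_bilinear_inner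
        has_vector_derivative_diff[OF u[of s] v[of s]] has_vector_derivative_diff[OF u[of s] v[of s]]]
    by (simp add: has_real_derivative_iff_has_vector_derivative inner_commute)
  have D'_le: "\<bar>D' s\<bar> \<le> 2 * L * D s" for s
  proof -
    have "\<bar>(u s - v s) \<bullet> (f (u s) - f (v s))\<bar> \<le> norm (u s - v s) * norm (f (u s) - f (v s))"
      by (rule Cauchy_Schwarz_ineq2)
    also have "\<dots> \<le> norm (u s - v s) * (L * norm (u s - v s))"
      by (intro mult_left_mono lip) simp
    finally show ?thesis
      by (simp add: D'_def D_def power2_norm_eq_inner[symmetric] power2_eq_square mult_ac)
  qed
  have "D t \<le> 0"
  proof (cases "t \<ge> 0")
    case True
    have "D t * exp (- (2 * L * t)) \<le> D 0 * exp (- (2 * L * 0))"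
    proof (rule DERIV_nonpos_imp_nonincreasing[OF True, where f = "\<lambda>s. D s * exp (- (2 * L * s))"])
      fix s
      have "((\<lambda>s. D s * exp (- (2 * L * s))) has_real_derivative
              (D' s - 2 * L * D s) * exp (- (2 * L * s))) (at s)"
        by (auto intro!: derivative_eq_intros D simp: algebra_simps)
      moreover have "(D' s - 2 * L * D s) * exp (- (2 * L * s)) \<le> 0"
        using D'_le[of s] by (intro mult_nonpos_nonneg) auto
      ultimately show "\<exists>y. ((\<lambda>s. D s * exp (- (2 * L * s))) has_real_derivative y) (at s) \<and> y \<le> 0"
        by blast
    qed
    then show ?thesis by (simp add: D_def eq mult_le_0_iff)
  next
    case False
    have "D t * exp (2 * L * t) \<le> D 0 * exp (2 * L * 0)"
    proof (rule DERIV_nonneg_imp_nondecreasing[where f = "\<lambda>s. D s * exp (2 * L * s)"])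
      fix s
      have "((\<lambda>s. D s * exp (2 * L * s)) has_real_derivative
              (D' s + 2 * L * D s) * exp (2 * L * s)) (at s)"
        by (auto intro!: derivative_eq_intros D simp: algebra_simps)
      moreover have "(D' s + 2 * L * D s) * exp (2 * L * s) \<ge> 0"
        using D'_le[of s] by (intro mult_nonneg_nonneg) auto
      ultimately show "\<exists>y. ((\<lambda>s. D s * exp (2 * L * s)) has_real_derivative y) (at s) \<and> 0 \<le> y"
        by blast
    qed (use False in simp)
    then show ?thesis by (simp add: D_def eq mult_le_0_iff)
  qed
  then have "D t = 0"
    unfolding D_def by (metis inner_ge_zero order_antisym)
  then show "u t = v t"
    by (simp add: D_def)
qed

text \<open>Existence and uniqueness together make the definite description in \<open>flow\<close>
  denote a solution.\<close>

lemma flow_solution: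
  fixes f :: "'a::euclidean_space \<Rightarrow> 'a"
  assumes "\<And>x y. norm (f x - f y) \<le> L * norm (x - y)" and "L > 0"
    and "\<And>x. norm (f x) \<le> B"
  shows "flow f x 0 = x" "(flow f x has_vector_derivative f (flow f x t)) (at t)"
proof -
  obtain u where u: "u 0 = x" "\<And>t. (u has_vector_derivative f (u t)) (at t)"
    by (rule global_solution_exists[OF assms, where x = x]) blast
  have "\<exists>!u. u 0 = x \<and> (\<forall>t. (u has_vector_derivative f (u t)) (at t))"
  proof (rule ex1I)
    show "v = u" if v: "v 0 = x \<and> (\<forall>t. (v has_vector_derivative f (v t)) (at t))" for v
      by (rule global_solution_unique[OF assms(1)]) (use u v in simp_all)
  qed (simp add: u)
  then have "flow f x 0 = x \<and> (\<forall>t. (flow f x has_vector_derivative f (flow f x t)) (at t))"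
    unfolding flow_def by (rule theI')
  then show "flow f x 0 = x" "(flow f x has_vector_derivative f (flow f x t)) (at t)"
    by auto
qed

subsection \<open>Taylor expansion with iterated directional derivatives\<close>

lemma smooth_class_differentiable:
  assumes "f \<in> smooth_class \<beta> L" "length vs < \<beta>"
  shows "deriv_at f vs differentiable (at x)"
  using assms by (auto simp: smooth_class_def times_cont_diff_def)

lemma smooth_class_norm_le:
  assumes "f \<in> smooth_class \<beta> L" "length vs \<le> \<beta>" "\<forall>v\<in>set vs. norm v = 1"
  shows "norm (deriv_at f vs x) \<le> L (length vs)"
proof -
  have "ereal (norm (deriv_at f vs x)) \<le> op_norm_deriv (length vs) f x"
    unfolding op_norm_deriv_def by (rule SUP_upper) (use assms in auto)
  also have "\<dots> \<le> (SUP x. op_norm_deriv (length vs) f x)"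
    by (rule SUP_upper) simp
  also have "\<dots> \<le> ereal (L (length vs))"
    using assms by (auto simp: smooth_class_def)
  finally show ?thesis by simp
qed

lemma smooth_class_bounded:
  assumes "f \<in> smooth_class \<beta> L"
  shows "norm (f x) \<le> L 0"
  using smooth_class_norm_le[OF assms, of "[]" x] by simp

lemma smooth_class_lipschitz:
  fixes f :: "'a::euclidean_space \<Rightarrow> 'a"
  assumes f: "f \<in> smooth_class \<beta> L" and "\<beta> \<ge> 1"
  shows "norm (f x - f y) \<le> L 1 * norm (x - y)"
proof (rule differentiable_bound[where S = UNIV and f' = "\<lambda>x. frechet_derivative f (at x)"])
  fix z :: 'a
  have eq: "deriv_at f [] = f" by (simp add: fun_eq_iff)
  have "f differentiable (at z)"
    using smooth_class_differentiable[OF f, of "[]" z] \<open>\<beta> \<ge> 1\<close> by (simp add: eq)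
  then show d: "(f has_derivative frechet_derivative f (at z)) (at z within UNIV)"
    by (simp add: frechet_derivative_works)
  interpret D: bounded_linear "frechet_derivative f (at z)"
    using d by (rule has_derivative_bounded_linear)
  show "onorm (frechet_derivative f (at z)) \<le> L 1"
  proof (rule onorm_le)
    fix v
    show "norm (frechet_derivative f (at z) v) \<le> L 1 * norm v"
    proof (cases "v = 0")
      case False
      have "norm (deriv_at f [v /\<^sub>R norm v] z) \<le> L 1"
        using smooth_class_norm_le[OF f, of "[v /\<^sub>R norm v]" z] \<open>\<beta> \<ge> 1\<close> False by simp
      then show ?thesis
        using False by (simp add: eq D.scaleR field_simps)
    qed (simp add: D.zero)
  qed
qed auto

text \<open>The \<open>k\<close>-th derivative of \<open>deriv_at f vs\<close> in direction \<open>v\<close>, expanded in coordinates. As new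
  directions are only added in front, neither symmetry nor linearity of the inner derivatives is
  needed.\<close>

primrec dir_deriv ::
    "(real ^ 'd \<Rightarrow> real ^ 'd) \<Rightarrow> real ^ 'd \<Rightarrow> nat \<Rightarrow> (real ^ 'd) list \<Rightarrow> real ^ 'd \<Rightarrow> real ^ 'd" where
  "dir_deriv f v 0 vs = deriv_at f vs"
| "dir_deriv f v (Suc k) vs = (\<lambda>w. \<Sum>i\<in>UNIV. v $ i *\<^sub>R dir_deriv f v k (axis i 1 # vs) w)"

text \<open>Only \<open>k = 0\<close> uses differentiability: the chain rule along the line, with
  \<open>v\<close> expanded in coordinates. In the step the coefficients \<open>v $ i\<close> are
  constants, so the claim for all longer lists passes through the finite sum.\<close>

lemma dir_deriv_has_derivative:
  assumes f: "f \<in> smooth_class \<beta> L" and "length vs + k < \<beta>"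
  shows "((\<lambda>s. dir_deriv f v k vs (y + s *\<^sub>R v)) has_vector_derivative
           dir_deriv f v (Suc k) vs (y + s *\<^sub>R v)) (at s)"
  using assms(2)
proof (induction k arbitrary: vs)
  case 0
  let ?D = "frechet_derivative (deriv_at f vs) (at (y + s *\<^sub>R v))"
  have "deriv_at f vs differentiable (at (y + s *\<^sub>R v))"
    using smooth_class_differentiable[OF f] 0 by simp
  then have D: "(deriv_at f vs has_derivative ?D) (at (y + s *\<^sub>R v))"
    by (simp add: frechet_derivative_works)
  interpret D: bounded_linear ?D
    using D by (rule has_derivative_bounded_linear)
  have v: "v = (\<Sum>i\<in>UNIV. v $ i *\<^sub>R axis i 1)"
    by (simp add: vec_eq_iff axis_def if_distrib[of "\<lambda>x. _ * x"] cong: if_cong)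
  have "((\<lambda>s. y + s *\<^sub>R v) has_vector_derivative v) (at s)"
    by (auto intro!: derivative_eq_intros simp: has_vector_derivative_def)
  from has_derivative_compose[OF this[unfolded has_vector_derivative_def] D]
  have "((\<lambda>s. deriv_at f vs (y + s *\<^sub>R v)) has_vector_derivative ?D v) (at s)"
    by (simp add: has_vector_derivative_def D.scaleR)
  moreover have "?D v = (\<Sum>i\<in>UNIV. v $ i *\<^sub>R ?D (axis i 1))"
    by (subst v) (simp add: D.sum D.scaleR)
  ultimately show ?case by simp
next
  case (Suc k)
  have "((\<lambda>s. \<Sum>i\<in>UNIV. v $ i *\<^sub>R dir_deriv f v k (axis i 1 # vs) (y + s *\<^sub>R v)) has_vector_derivative
          (\<Sum>i\<in>UNIV. v $ i *\<^sub>R dir_deriv f v (Suc k) (axis i 1 # vs) (y + s *\<^sub>R v))) (at s)"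
    by (intro has_vector_derivative_sum bounded_linear.has_vector_derivative[OF bounded_linear_scaleR_right]
        Suc.IH) (use Suc.prems in simp)
  then show ?case by simp
qed

text \<open>The 1-norm of \<open>v\<close> appears because each of the \<open>k\<close> slots is
  expanded along coordinate axes, which are unit vectors and hence covered by the operator norm
  bound.\<close>

lemma norm_dir_deriv_le:
  assumes f: "f \<in> smooth_class \<beta> L" and "length vs + k \<le> \<beta>" "\<forall>u\<in>set vs. norm u = 1"
  shows "norm (dir_deriv f v k vs y) \<le> (\<Sum>i\<in>UNIV. \<bar>v $ i\<bar>) ^ k * L (length vs + k)"
  using assms(2,3)
proof (induction k arbitrary: vs)
  case 0
  then show ?case using smooth_class_norm_le[OF f] by simp
next
  case (Suc k)
  have "norm (dir_deriv f v (Suc k) vs y) \<le>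
      (\<Sum>i\<in>UNIV. \<bar>v $ i\<bar> * ((\<Sum>i\<in>UNIV. \<bar>v $ i\<bar>) ^ k * L (length vs + Suc k)))"
    unfolding dir_deriv.simps
  proof (intro sum_norm_le)
    fix i
    have "norm (dir_deriv f v k (axis i 1 # vs) y)
        \<le> (\<Sum>i\<in>UNIV. \<bar>v $ i\<bar>) ^ k * L (length (axis i (1::real) # vs) + k)"
      using Suc.prems by (intro Suc.IH) auto
    then show "norm (v $ i *\<^sub>R dir_deriv f v k (axis i 1 # vs) y)
        \<le> \<bar>v $ i\<bar> * ((\<Sum>i\<in>UNIV. \<bar>v $ i\<bar>) ^ k * L (length vs + Suc k))"
      by (simp add: mult_left_mono)
  qed
  then show ?case
    by (simp add: sum_distrib_right mult.assoc)
qed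

text \<open>Stated per component, since the Lagrange form of the remainder holds for real-valued
  functions only. The factorial in the remainder is given away.\<close>

lemma taylor_dir_deriv:
  assumes f: "f \<in> smooth_class \<beta> L" and n: "0 < n" "n \<le> \<beta>"
  shows "\<bar>f (y + v) $ c - (\<Sum>k<n. dir_deriv f v k [] y $ c / fact k)\<bar>
           \<le> (\<Sum>i\<in>UNIV. \<bar>v $ i\<bar>) ^ n * L n"
proof -
  define diff where "diff k s = dir_deriv f v k [] (y + s *\<^sub>R v) $ c" for k s
  have "\<exists>t>0. t < 1 \<and> diff 0 1 = (\<Sum>k<n. diff k 0 / fact k * 1 ^ k) + diff n t / fact n * 1 ^ n"
  proof (rule Maclaurin)
    show "\<forall>k t. k < n \<and> 0 \<le> t \<and> t \<le> 1 \<longrightarrow> (diff k has_real_derivative diff (Suc k) t) (at t)"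
    proof (intro allI impI)
      fix k t assume "k < n \<and> 0 \<le> t \<and> t \<le> (1::real)"
      then have "length [] + k < \<beta>" using n by simp
      from bounded_linear.has_vector_derivative[OF bounded_linear_vec_nth[of c]
          dir_deriv_has_derivative[OF f this]]
      show "(diff k has_real_derivative diff (Suc k) t) (at t)"
        unfolding diff_def by (simp add: has_real_derivative_iff_has_vector_derivative)
    qed
  qed (use n in auto)
  then obtain t where "f (y + v) $ c - (\<Sum>k<n. dir_deriv f v k [] y $ c / fact k) = diff n t / fact n"
    by (auto simp: diff_def)
  moreover have "\<bar>diff n t / fact n\<bar> \<le> \<bar>diff n t\<bar>"
    using fact_ge_1[of n, where 'a = real]
    by (simp add: divide_le_eq mult_le_cancel_left1)
  moreover have "\<bar>diff n t\<bar> \<le> (\<Sum>i\<in>UNIV. \<bar>v $ i\<bar>) ^ n * L n"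
    unfolding diff_def using norm_dir_deriv_le[OF f, of "[]" n v "y + t *\<^sub>R v"] n
    by (intro order_trans[OF component_le_norm_cart]) simp
  ultimately show ?thesis by simp
qed

subsection \<open>Approximation by homogeneous polynomials in space and time\<close>

text \<open>Space and time have equal weight in the degree, as both will be of size
  \<open>\<rho>\<close>. Generating the polynomials from monomials by addition reduces every linear
  identity to a check on monomials.\<close>

inductive homogeneous :: "nat \<Rightarrow> (real ^ 'd \<Rightarrow> real \<Rightarrow> real) \<Rightarrow> bool" where
  monomial: "sum \<alpha> UNIV + j = k \<Longrightarrow> homogeneous k (\<lambda>z t. c * (\<Prod>i\<in>UNIV. z $ i ^ \<alpha> i) * t ^ j)"
| add: "homogeneous k p \<Longrightarrow> homogeneous k q \<Longrightarrow> homogeneous k (\<lambda>z t. p z t + q z t)"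

lemma homogeneous_zero: "homogeneous k (\<lambda>z t. 0)"
  using homogeneous.monomial[of "\<lambda>_. 0" k k 0] by simp

lemma homogeneous_const: "homogeneous 0 (\<lambda>z t. c)"
  using homogeneous.monomial[of "\<lambda>_. 0" 0 0 c] by simp

lemma homogeneous_coord: "homogeneous 1 (\<lambda>z t. z $ i)"
  using homogeneous.monomial[of "\<lambda>j. if j = i then 1 else 0" 0 1 1]
  by (simp add: if_distrib[of "\<lambda>n. _ ^ n"] cong: if_cong)

lemma homogeneous_time: "homogeneous 1 (\<lambda>z t. t)"
  using homogeneous.monomial[of "\<lambda>_. 0" 1 1 1] by simp

lemma homogeneous_mult:
  assumes "homogeneous a p" "homogeneous b q"
  shows "homogeneous (a + b) (\<lambda>z t. p z t * q z t)"
  using assms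
proof (induction rule: homogeneous.induct)
  case (monomial \<alpha> j k c)
  from \<open>homogeneous b q\<close> show ?case
  proof (induction rule: homogeneous.induct)
    case (monomial \<alpha>' j' k' c')
    have "homogeneous (k + k')
      (\<lambda>z t. (c * c') * (\<Prod>i\<in>UNIV. z $ i ^ (\<alpha> i + \<alpha>' i)) * t ^ (j + j'))"
      by (rule homogeneous.monomial)
        (use \<open>sum \<alpha> UNIV + j = k\<close> monomial in \<open>simp add: sum.distrib\<close>)
    then show ?case
      by (simp add: power_add prod.distrib mult_ac)
  next
    case (add k' p q)
    then show ?case
      using homogeneous.add by (fastforce simp: distrib_left)
  qed
next
  case (add k p p')
  then show ?case
    using homogeneous.add by (fastforce simp: distrib_right)
qed

lemma homogeneous_scale: "homogeneous k p \<Longrightarrow> homogeneous k (\<lambda>z t. c * p z t)"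
  using homogeneous_mult[OF homogeneous_const] by fastforce

lemma homogeneous_sum:
  assumes "finite I" "\<And>i. i \<in> I \<Longrightarrow> homogeneous k (p i)"
  shows "homogeneous k (\<lambda>z t. \<Sum>i\<in>I. p i z t)"
  using assms by (induction I) (auto intro: homogeneous_zero homogeneous.add)

lemma homogeneous_at_0: "homogeneous k p \<Longrightarrow> k > 0 \<Longrightarrow> p 0 0 = 0"
proof (induction rule: homogeneous.induct)
  case (monomial \<alpha> j k c)
  show ?case
  proof (cases "j = 0")
    case True
    with monomial obtain i where "\<alpha> i > 0"
      by (metis add.right_neutral bot_nat_0.not_eq_extremum sum.neutral)
    then have "(\<Prod>i\<in>UNIV. (0::real) ^ \<alpha> i) = 0"
      by (intro prod_zero) (auto intro!: exI[of _ i])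
    then show ?thesis by simp
  qed simp
qed simp

lemma homogeneous_degree_0: "homogeneous k p \<Longrightarrow> k = 0 \<Longrightarrow> p z t = p 0 0"
  by (induction rule: homogeneous.induct) auto

text \<open>Writing the time primitive as \<open>s * q\<close> keeps the degree of \<open>q\<close>
  equal to that of the integrand and exposes the factor that later cancels
  \<open>1 / \<Delta>\<close>.\<close>

lemma homogeneous_antiderivative:
  assumes "homogeneous k p"
  shows "\<exists>q. homogeneous k q \<and> (\<forall>z t. ((\<lambda>s. s * q z s) has_real_derivative p z t) (at t))"
  using assms
proof (induction rule: homogeneous.induct)
  case (monomial \<alpha> j k c)
  have "((\<lambda>s. s * (c / real (Suc j) * (\<Prod>i\<in>UNIV. z $ i ^ \<alpha> i) * s ^ j)) has_real_derivative
      c * (\<Prod>i\<in>UNIV. z $ i ^ \<alpha> i) * t ^ j) (at t)" for z :: "real ^ 'a" and t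
  proof -
    define K where "K = c / real (Suc j) * (\<Prod>i\<in>UNIV. z $ i ^ \<alpha> i)"
    have "((\<lambda>s. K * s ^ Suc j) has_real_derivative K * (real (Suc j) * t ^ j)) (at t)"
      using DERIV_cmult[OF DERIV_pow[of "Suc j" t], of K] by simp
    moreover have "K * (real (Suc j) * t ^ j) = c * (\<Prod>i\<in>UNIV. z $ i ^ \<alpha> i) * t ^ j"
      by (simp add: K_def field_simps)
    moreover have "(\<lambda>s. K * s ^ Suc j) = (\<lambda>s. s * (c / real (Suc j) * (\<Prod>i\<in>UNIV. z $ i ^ \<alpha> i) * s ^ j))"
      by (simp add: K_def fun_eq_iff mult_ac)
    ultimately show ?thesis by (simp only:)
  qed
  with homogeneous.monomial[OF monomial, of "c / real (Suc j)"] show ?case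
    by blast
next
  case (add k p p')
  then obtain q q' where q: "homogeneous k q" "homogeneous k q'"
    and d: "\<And>z t. ((\<lambda>s. s * q z s) has_real_derivative p z t) (at t)"
      "\<And>z t. ((\<lambda>s. s * q' z s) has_real_derivative p' z t) (at t)"
    by blast
  have "((\<lambda>s. s * (q z s + q' z s)) has_real_derivative p z t + p' z t) (at t)" for z t
    using DERIV_add[OF d] by (simp add: distrib_left)
  with homogeneous.add[OF q] show ?case by blast
qed

section \<open>Graded polynomial approximation on space-time cylinders\<close>

definition cyl :: "real \<Rightarrow> ((real ^ 'd) \<times> real) set" where
  "cyl \<rho> = cball 0 \<rho> \<times> {0..\<rho>}"

lemma cyl_iff: "(z, t) \<in> cyl \<rho> \<longleftrightarrow> norm z \<le> \<rho> \<and> 0 \<le> t \<and> t \<le> \<rho>"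
  by (simp add: cyl_def)

text \<open>Each homogeneous component is bounded at its own scale \<open>\<rho> ^ k\<close>, not
  only the remainder. Products need this: their cross terms of degree above \<open>n\<close> are
  small only because the components are. The polynomial may depend on \<open>\<rho>\<close>, the
  constant is a parameter.\<close>

definition poly_approx :: "real \<Rightarrow> nat \<Rightarrow> real \<Rightarrow> (real ^ 'd \<Rightarrow> real \<Rightarrow> real) \<Rightarrow> bool" where
  "poly_approx \<rho> n C g \<longleftrightarrow> (\<exists>p. (\<forall>k\<le>n. homogeneous k (p k)) \<and>
     (\<forall>(z, t)\<in>cyl \<rho>. (\<forall>k\<le>n. \<bar>p k z t\<bar> \<le> C * \<rho> ^ k) \<and>
        \<bar>g z t - (\<Sum>k\<le>n. p k z t)\<bar> \<le> C * \<rho> ^ Suc n))"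

lemma poly_approxI:
  assumes "\<And>k. k \<le> n \<Longrightarrow> homogeneous k (p k)"
    and "\<And>z t k. (z, t) \<in> cyl \<rho> \<Longrightarrow> k \<le> n \<Longrightarrow> \<bar>p k z t\<bar> \<le> C * \<rho> ^ k"
    and "\<And>z t. (z, t) \<in> cyl \<rho> \<Longrightarrow> \<bar>g z t - (\<Sum>k\<le>n. p k z t)\<bar> \<le> C * \<rho> ^ Suc n"
  shows "poly_approx \<rho> n C g"
  unfolding poly_approx_def using assms by (intro exI[of _ p]) auto

lemma poly_approxE:
  assumes "poly_approx \<rho> n C g"
  obtains p where "\<And>k. k \<le> n \<Longrightarrow> homogeneous k (p k)"
    and "\<And>z t k. (z, t) \<in> cyl \<rho> \<Longrightarrow> k \<le> n \<Longrightarrow> \<bar>p k z t\<bar> \<le> C * \<rho> ^ k"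
    and "\<And>z t. (z, t) \<in> cyl \<rho> \<Longrightarrow> \<bar>g z t - (\<Sum>k\<le>n. p k z t)\<bar> \<le> C * \<rho> ^ Suc n"
proof -
  from assms obtain p where "\<forall>k\<le>n. homogeneous k (p k)"
    "\<forall>(z, t)\<in>cyl \<rho>. (\<forall>k\<le>n. \<bar>p k z t\<bar> \<le> C * \<rho> ^ k) \<and> \<bar>g z t - (\<Sum>k\<le>n. p k z t)\<bar> \<le> C * \<rho> ^ Suc n"
    unfolding poly_approx_def by blast
  then show thesis by (intro that[of p]) auto
qed

lemma poly_approx_nonneg:
  assumes "poly_approx \<rho> n C (g :: real ^ 'd \<Rightarrow> _)" "\<rho> \<ge> 0"
  shows "C \<ge> 0"
proof -
  from assms(1) obtain p where
    p: "\<And>z t k. ((z :: real ^ 'd), t) \<in> cyl \<rho> \<Longrightarrow> k \<le> n \<Longrightarrow> \<bar>p k z t\<bar> \<le> C * \<rho> ^ k"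
    by (rule poly_approxE) blast
  have "((0 :: real ^ 'd), 0) \<in> cyl \<rho>" using assms(2) by (simp add: cyl_iff)
  from p[OF this, of 0] show ?thesis by simp
qed

lemma poly_approx_mono:
  assumes "poly_approx \<rho> n C g" "C \<le> C'" "\<rho> \<ge> 0"
  shows "poly_approx \<rho> n C' g"
proof -
  from assms(1) obtain p where p: "\<And>k. k \<le> n \<Longrightarrow> homogeneous k (p k)"
    "\<And>z t k. (z, t) \<in> cyl \<rho> \<Longrightarrow> k \<le> n \<Longrightarrow> \<bar>p k z t\<bar> \<le> C * \<rho> ^ k"
    "\<And>z t. (z, t) \<in> cyl \<rho> \<Longrightarrow> \<bar>g z t - (\<Sum>k\<le>n. p k z t)\<bar> \<le> C * \<rho> ^ Suc n"
    by (rule poly_approxE) blast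
  have le: "C * \<rho> ^ k \<le> C' * \<rho> ^ k" for k
    using assms(2,3) by (intro mult_right_mono) auto
  show ?thesis
    by (rule poly_approxI[of n p]) (use p le in \<open>blast intro: order_trans\<close>)+
qed

lemma poly_approx_cong:
  assumes "poly_approx \<rho> n C g" "\<And>z t. (z, t) \<in> cyl \<rho> \<Longrightarrow> g z t = g' z t"
  shows "poly_approx \<rho> n C g'"
proof -
  from assms(1) obtain p where p: "\<And>k. k \<le> n \<Longrightarrow> homogeneous k (p k)"
    "\<And>z t k. (z, t) \<in> cyl \<rho> \<Longrightarrow> k \<le> n \<Longrightarrow> \<bar>p k z t\<bar> \<le> C * \<rho> ^ k"
    "\<And>z t. (z, t) \<in> cyl \<rho> \<Longrightarrow> \<bar>g z t - (\<Sum>k\<le>n. p k z t)\<bar> \<le> C * \<rho> ^ Suc n"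
    by (rule poly_approxE) blast
  show ?thesis
    by (rule poly_approxI[of n p]) (use p assms(2) in \<open>simp_all\<close>)
qed

lemma poly_approx_const: "\<rho> \<ge> 0 \<Longrightarrow> poly_approx \<rho> n \<bar>c\<bar> (\<lambda>z t. c)"
  by (rule poly_approxI[where p = "\<lambda>k z t. if k = 0 then c else 0"])
    (auto intro: homogeneous_const homogeneous_zero)

lemma poly_approx_coord:
  assumes "n > 0" "\<rho> \<ge> 0"
  shows "poly_approx \<rho> n 1 (\<lambda>z t. z $ i)"
proof (rule poly_approxI[where p = "\<lambda>k z t. if k = 1 then z $ i else 0"])
  show "homogeneous k (\<lambda>z t. if k = 1 then z $ i else 0)" for k
    by (cases "k = 1") (use homogeneous_coord in \<open>simp_all add: homogeneous_zero\<close>)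
  show "\<bar>if k = 1 then z $ i else 0\<bar> \<le> 1 * \<rho> ^ k" if "(z, t) \<in> cyl \<rho>" for z :: "real ^ 'a" and t k
    using that component_le_norm_cart[of z i] assms by (auto simp: cyl_iff)
qed (use assms in auto)

lemma poly_approx_add:
  assumes "poly_approx \<rho> n C g" "poly_approx \<rho> n C' g'"
  shows "poly_approx \<rho> n (C + C') (\<lambda>z t. g z t + g' z t)"
proof -
  from assms(1) obtain p where p: "\<And>k. k \<le> n \<Longrightarrow> homogeneous k (p k)"
    "\<And>z t k. (z, t) \<in> cyl \<rho> \<Longrightarrow> k \<le> n \<Longrightarrow> \<bar>p k z t\<bar> \<le> C * \<rho> ^ k"
    "\<And>z t. (z, t) \<in> cyl \<rho> \<Longrightarrow> \<bar>g z t - (\<Sum>k\<le>n. p k z t)\<bar> \<le> C * \<rho> ^ Suc n"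
    by (rule poly_approxE) blast
  from assms(2) obtain p' where p': "\<And>k. k \<le> n \<Longrightarrow> homogeneous k (p' k)"
    "\<And>z t k. (z, t) \<in> cyl \<rho> \<Longrightarrow> k \<le> n \<Longrightarrow> \<bar>p' k z t\<bar> \<le> C' * \<rho> ^ k"
    "\<And>z t. (z, t) \<in> cyl \<rho> \<Longrightarrow> \<bar>g' z t - (\<Sum>k\<le>n. p' k z t)\<bar> \<le> C' * \<rho> ^ Suc n"
    by (rule poly_approxE) blast
  show ?thesis
  proof (rule poly_approxI[where p = "\<lambda>k z t. p k z t + p' k z t"])
    show "homogeneous k (\<lambda>z t. p k z t + p' k z t)" if "k \<le> n" for k
      using that p p' by (intro homogeneous.add)
    show "\<bar>p k z t + p' k z t\<bar> \<le> (C + C') * \<rho> ^ k" if "(z, t) \<in> cyl \<rho>" "k \<le> n" for z t k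
      using p(2)[OF that] p'(2)[OF that] unfolding distrib_right by linarith
    show "\<bar>g z t + g' z t - (\<Sum>k\<le>n. p k z t + p' k z t)\<bar> \<le> (C + C') * \<rho> ^ Suc n"
      if "(z, t) \<in> cyl \<rho>" for z t
      using p(3)[OF that] p'(3)[OF that] unfolding distrib_right sum.distrib by linarith
  qed
qed

lemma poly_approx_sum:
  assumes "finite I" "\<And>i. i \<in> I \<Longrightarrow> poly_approx \<rho> n (C i) (g i)" "\<rho> \<ge> 0"
  shows "poly_approx \<rho> n (\<Sum>i\<in>I. C i) (\<lambda>z t. \<Sum>i\<in>I. g i z t)"
  using assms
proof (induction I)
  case empty
  then show ?case using poly_approx_const[of \<rho> n 0] by simp
next
  case (insert i I)
  then show ?case by (auto intro!: poly_approx_add)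
qed

text \<open>With \<open>A\<close>, \<open>B\<close> the two polynomial values, the error is
  \<open>(g - A) * g' + A * (g' - B)\<close> plus the cross terms of degree above \<open>n\<close>.
  Each part yields one factor \<open>\<rho> ^ Suc n\<close>, and surplus powers are bounded through
  \<open>R\<close>. The constant adds up \<open>n + 2\<close> from the size of \<open>g'\<close>,
  \<open>n + 1\<close> from that of \<open>A\<close>, and \<open>(n + 1)^2\<close> for the number of
  index pairs.\<close>

lemma truncated_product:
  fixes a b :: "nat \<Rightarrow> real"
  assumes a: "\<And>k. k \<le> n \<Longrightarrow> \<bar>a k\<bar> \<le> C * \<rho> ^ k" and b: "\<And>k. k \<le> n \<Longrightarrow> \<bar>b k\<bar> \<le> C' * \<rho> ^ k"
    and g: "\<bar>g - (\<Sum>k\<le>n. a k)\<bar> \<le> C * \<rho> ^ Suc n" and g': "\<bar>g' - (\<Sum>k\<le>n. b k)\<bar> \<le> C' * \<rho> ^ Suc n"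
    and \<rho>: "0 \<le> \<rho>" "\<rho> \<le> R" "1 \<le> R"
  shows "\<bar>g * g' - (\<Sum>k\<le>n. \<Sum>i\<le>k. a i * b (k - i))\<bar>
    \<le> ((real n + 1) ^ 2 + 2 * real n + 3) * R ^ Suc n * C * C' * \<rho> ^ Suc n"
proof -
  have C: "C \<ge> 0" "C' \<ge> 0" using a[of 0] b[of 0] by auto
  define A where "A = (\<Sum>k\<le>n. a k)"
  define B where "B = (\<Sum>k\<le>n. b k)"
  have pow: "\<rho> ^ k \<le> R ^ Suc n" if "k \<le> Suc n" for k
    by (meson \<rho> order_trans power_increasing power_mono that)
  have A: "\<bar>A\<bar> \<le> (real n + 1) * (C * R ^ Suc n)"
  proof -
    have "\<bar>A\<bar> \<le> (\<Sum>k\<le>n. C * R ^ Suc n)"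
      unfolding A_def
    proof (intro sum_norm_le[where 'a = real, unfolded real_norm_def])
      fix k assume "k \<in> {..n}"
      then have "\<bar>a k\<bar> \<le> C * \<rho> ^ k" using a by simp
      also have "\<dots> \<le> C * R ^ Suc n"
        using \<open>k \<in> {..n}\<close> C by (intro mult_left_mono pow) auto
      finally show "\<bar>a k\<bar> \<le> C * R ^ Suc n" .
    qed
    then show ?thesis by (simp add: add_ac)
  qed
  have B: "\<bar>B\<bar> \<le> (real n + 1) * (C' * R ^ Suc n)"
  proof -
    have "\<bar>B\<bar> \<le> (\<Sum>k\<le>n. C' * R ^ Suc n)"
      unfolding B_def
    proof (intro sum_norm_le[where 'a = real, unfolded real_norm_def])
      fix k assume "k \<in> {..n}"
      then have "\<bar>b k\<bar> \<le> C' * \<rho> ^ k" using b by simp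
      also have "\<dots> \<le> C' * R ^ Suc n"
        using \<open>k \<in> {..n}\<close> C by (intro mult_left_mono pow) auto
      finally show "\<bar>b k\<bar> \<le> C' * R ^ Suc n" .
    qed
    then show ?thesis by (simp add: add_ac)
  qed
  have "C' * \<rho> ^ Suc n \<le> C' * R ^ Suc n"
    using mult_left_mono[OF pow[OF order_refl] C(2)] .
  with B g' have "\<bar>g'\<bar> \<le> (real n + 2) * (C' * R ^ Suc n)"
    unfolding B_def[symmetric] by (simp add: distrib_right)
  then have 1: "\<bar>(g - A) * g'\<bar> \<le> (C * \<rho> ^ Suc n) * ((real n + 2) * (C' * R ^ Suc n))"
    unfolding abs_mult using g[folded A_def] \<rho> C by (intro mult_mono) auto
  have 2: "\<bar>A * (g' - B)\<bar> \<le> ((real n + 1) * (C * R ^ Suc n)) * (C' * \<rho> ^ Suc n)"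
    unfolding abs_mult using g'[folded B_def] A \<rho> C by (intro mult_mono) auto
  let ?S = "{(i, j). i \<le> n \<and> j \<le> n}" and ?T = "{(i, j). i + j \<le> n}"
  have S: "?S = {..n} \<times> {..n}" by auto
  have "A * B = (\<Sum>(i, j)\<in>?S. a i * b j)"
    unfolding A_def B_def S by (simp add: sum_product sum.cartesian_product)
  moreover have "(\<Sum>k\<le>n. \<Sum>i\<le>k. a i * b (k - i)) = (\<Sum>(i, j)\<in>?T. a i * b j)"
    by (rule sum.triangle_reindex_eq[symmetric])
  moreover have "(\<Sum>(i, j)\<in>?S. a i * b j) - (\<Sum>(i, j)\<in>?T. a i * b j) = (\<Sum>(i, j)\<in>?S - ?T. a i * b j)"
    by (rule sum_diff[symmetric]) (auto simp: S)
  ultimately have "A * B - (\<Sum>k\<le>n. \<Sum>i\<le>k. a i * b (k - i)) = (\<Sum>(i, j)\<in>?S - ?T. a i * b j)"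
    by simp
  then have "\<bar>A * B - (\<Sum>k\<le>n. \<Sum>i\<le>k. a i * b (k - i))\<bar> = \<bar>\<Sum>(i, j)\<in>?S - ?T. a i * b j\<bar>"
    by (simp only:)
  also have "\<dots> \<le> (\<Sum>(i, j)\<in>?S - ?T. R ^ Suc n * C * C' * \<rho> ^ Suc n)"
  proof (intro sum_norm_le[where 'a = real, unfolded real_norm_def])
    fix ij assume "ij \<in> ?S - ?T"
    then obtain i j where ij: "ij = (i, j)" "i \<le> n" "j \<le> n" "Suc n \<le> i + j" by auto
    have "\<bar>a i * b j\<bar> \<le> (C * \<rho> ^ i) * (C' * \<rho> ^ j)"
      unfolding abs_mult using a b ij C \<rho> by (intro mult_mono) auto
    \<comment> \<open>The truncated subtraction is exact since \<open>Suc n \<le> i + j\<close>, and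
      the surplus exponent is below \<open>Suc n\<close>, so \<open>pow\<close> applies to
      it.\<close>
    also have "\<dots> = (C * C') * (\<rho> ^ (i + j - Suc n) * \<rho> ^ Suc n)"
      using ij by (simp add: power_add[symmetric] del: power_Suc)
    also have "\<dots> \<le> (C * C') * (R ^ Suc n * \<rho> ^ Suc n)"
      using ij C \<rho> by (intro mult_left_mono mult_right_mono pow) auto
    finally show "\<bar>case ij of (i, j) \<Rightarrow> a i * b j\<bar> \<le> (case ij of (i, j) \<Rightarrow> R ^ Suc n * C * C' * \<rho> ^ Suc n)"
      by (simp add: ij mult_ac)
  qed
  also have "\<dots> \<le> (real n + 1) ^ 2 * (R ^ Suc n * C * C' * \<rho> ^ Suc n)"
  proof -
    define K where "K = R ^ Suc n * C * C' * \<rho> ^ Suc n"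
    have "K \<ge> 0" using C \<rho> by (simp add: K_def)
    then have "(\<Sum>ij\<in>?S - ?T. K) \<le> (\<Sum>ij\<in>?S. K)"
      by (intro sum_mono2) (auto simp: S)
    also have "\<dots> = (real n + 1) ^ 2 * K"
      by (simp add: S power2_eq_square algebra_simps)
    finally show ?thesis by (simp add: K_def case_prod_unfold)
  qed
  finally have 3: "\<bar>A * B - (\<Sum>k\<le>n. \<Sum>i\<le>k. a i * b (k - i))\<bar>
    \<le> (real n + 1) ^ 2 * (R ^ Suc n * C * C' * \<rho> ^ Suc n)" .
  have eq: "g * g' - (\<Sum>k\<le>n. \<Sum>i\<le>k. a i * b (k - i))
    = (g - A) * g' + A * (g' - B) + (A * B - (\<Sum>k\<le>n. \<Sum>i\<le>k. a i * b (k - i)))"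
    by (simp add: algebra_simps)
  have "\<bar>g * g' - (\<Sum>k\<le>n. \<Sum>i\<le>k. a i * b (k - i))\<bar>
      \<le> (C * \<rho> ^ Suc n) * ((real n + 2) * (C' * R ^ Suc n))
      + ((real n + 1) * (C * R ^ Suc n)) * (C' * \<rho> ^ Suc n)
      + (real n + 1) ^ 2 * (R ^ Suc n * C * C' * \<rho> ^ Suc n)"
    unfolding eq using 1 2 3 by linarith
  also have "\<dots> = ((real n + 1) ^ 2 + 2 * real n + 3) * (R ^ Suc n * C * C' * \<rho> ^ Suc n)"
    by (simp add: algebra_simps del: power_Suc)
  finally show ?thesis by (simp only: mult.assoc)
qed

text \<open>The components are those of the Cauchy product, cut off above degree \<open>n\<close>.
  The constant of the remainder also dominates the \<open>k + 1\<close> summands of a component, so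
  one constant serves both requirements.\<close>

lemma poly_approx_mult:
  fixes g g' :: "real ^ 'd \<Rightarrow> real \<Rightarrow> real"
  assumes "poly_approx \<rho> n C g" "poly_approx \<rho> n C' g'" and \<rho>: "0 \<le> \<rho>" "\<rho> \<le> R" "1 \<le> R"
  shows "poly_approx \<rho> n (((real n + 1) ^ 2 + 2 * real n + 3) * R ^ Suc n * C * C') (\<lambda>z t. g z t * g' z t)"
    (is "poly_approx _ _ ?K _")
proof -
  have C: "C \<ge> 0" "C' \<ge> 0"
    using poly_approx_nonneg assms by blast+
  from assms(1) obtain p where p: "\<And>k. k \<le> n \<Longrightarrow> homogeneous k (p k)"
    "\<And>z t k. (z, t) \<in> cyl \<rho> \<Longrightarrow> k \<le> n \<Longrightarrow> \<bar>p k z t\<bar> \<le> C * \<rho> ^ k"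
    "\<And>z t. (z, t) \<in> cyl \<rho> \<Longrightarrow> \<bar>g z t - (\<Sum>k\<le>n. p k z t)\<bar> \<le> C * \<rho> ^ Suc n"
    by (rule poly_approxE) blast
  from assms(2) obtain p' where p': "\<And>k. k \<le> n \<Longrightarrow> homogeneous k (p' k)"
    "\<And>z t k. (z, t) \<in> cyl \<rho> \<Longrightarrow> k \<le> n \<Longrightarrow> \<bar>p' k z t\<bar> \<le> C' * \<rho> ^ k"
    "\<And>z t. (z, t) \<in> cyl \<rho> \<Longrightarrow> \<bar>g' z t - (\<Sum>k\<le>n. p' k z t)\<bar> \<le> C' * \<rho> ^ Suc n"
    by (rule poly_approxE) blast
  show ?thesis
  proof (rule poly_approxI[where p = "\<lambda>k z t. \<Sum>i\<le>k. p i z t * p' (k - i) z t"])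
    fix k assume k: "k \<le> n"
    have "homogeneous (i + (k - i)) (\<lambda>z t. p i z t * p' (k - i) z t)" if "i \<le> k" for i
      using that k by (intro homogeneous_mult p p') auto
    then show "homogeneous k (\<lambda>z t. \<Sum>i\<le>k. p i z t * p' (k - i) z t)"
      by (intro homogeneous_sum) auto
    fix z :: "real ^ 'd" and t assume zt: "(z, t) \<in> cyl \<rho>"
    have "\<bar>\<Sum>i\<le>k. p i z t * p' (k - i) z t\<bar> \<le> (\<Sum>i\<le>k. C * C' * \<rho> ^ k)"
    proof (intro sum_norm_le[where 'a = real, unfolded real_norm_def])
      fix i assume i: "i \<in> {..k}"
      have "\<bar>p i z t * p' (k - i) z t\<bar> \<le> (C * \<rho> ^ i) * (C' * \<rho> ^ (k - i))"
        unfolding abs_mult using i k C \<rho> zt by (intro mult_mono p p') auto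
      also have "\<dots> = C * C' * \<rho> ^ k"
        using i by (simp add: power_add[symmetric])
      finally show "\<bar>p i z t * p' (k - i) z t\<bar> \<le> C * C' * \<rho> ^ k" .
    qed
    also have "\<dots> = (real k + 1) * (C * C' * \<rho> ^ k)" by simp
    also have "\<dots> \<le> (((real n + 1) ^ 2 + 2 * real n + 3) * R ^ Suc n) * (C * C' * \<rho> ^ k)"
    proof (intro mult_right_mono)
      have "real k + 1 \<le> ((real n + 1) ^ 2 + 2 * real n + 3) * 1"
        unfolding mult_1_right
        using of_nat_mono[OF k, where 'a = real] zero_le_power2[of "real n + 1"] by linarith
      also have "\<dots> \<le> ((real n + 1) ^ 2 + 2 * real n + 3) * R ^ Suc n"
        by (intro mult_left_mono one_le_power \<rho>) simp
      finally show "real k + 1 \<le> ((real n + 1) ^ 2 + 2 * real n + 3) * R ^ Suc n" .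
    qed (use C \<rho> in simp)
    finally show "\<bar>\<Sum>i\<le>k. p i z t * p' (k - i) z t\<bar> \<le> ?K * \<rho> ^ k"
      by (simp only: mult.assoc)
  next
    fix z :: "real ^ 'd" and t assume zt: "(z, t) \<in> cyl \<rho>"
    show "\<bar>g z t * g' z t - (\<Sum>k\<le>n. \<Sum>i\<le>k. p i z t * p' (k - i) z t)\<bar> \<le> ?K * \<rho> ^ Suc n"
      using zt by (intro truncated_product p p' \<rho>)
  qed
qed

lemma poly_approx_scale:
  assumes "poly_approx \<rho> n C g" "\<bar>a\<bar> \<le> 1" "\<rho> \<ge> 0"
  shows "poly_approx \<rho> n C (\<lambda>z t. a * g z t)"
proof -
  from assms(1) obtain p where p: "\<And>k. k \<le> n \<Longrightarrow> homogeneous k (p k)"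
    "\<And>z t k. (z, t) \<in> cyl \<rho> \<Longrightarrow> k \<le> n \<Longrightarrow> \<bar>p k z t\<bar> \<le> C * \<rho> ^ k"
    "\<And>z t. (z, t) \<in> cyl \<rho> \<Longrightarrow> \<bar>g z t - (\<Sum>k\<le>n. p k z t)\<bar> \<le> C * \<rho> ^ Suc n"
    by (rule poly_approxE) blast
  have le: "\<bar>a * y\<bar> \<le> b" if "\<bar>y\<bar> \<le> b" for y b :: real
    using mult_mono[OF assms(2) that] by (simp add: abs_mult)
  show ?thesis
  proof (rule poly_approxI[where p = "\<lambda>k z t. a * p k z t"])
    show "\<bar>a * g z t - (\<Sum>k\<le>n. a * p k z t)\<bar> \<le> C * \<rho> ^ Suc n" if "(z, t) \<in> cyl \<rho>" for z t
      using le[OF p(3)[OF that]] by (simp only: right_diff_distrib sum_distrib_left)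
  qed (auto intro!: p le homogeneous_scale)
qed

text \<open>Approximation by the zero polynomial. It absorbs Taylor remainders and starts the
  induction on the order of the flow expansion.\<close>

lemma poly_approx_remainder:
  assumes "\<And>z t. (z, t) \<in> cyl \<rho> \<Longrightarrow> \<bar>g z t\<bar> \<le> C * \<rho> ^ Suc n" "C \<ge> 0" "\<rho> \<ge> 0"
  shows "poly_approx \<rho> n C g"
  by (rule poly_approxI[where p = "\<lambda>k z t. 0"]) (use assms in \<open>auto intro: homogeneous_zero\<close>)

text \<open>A Taylor term at the fixed point \<open>y\<close> is a polynomial in the components of
  the displacement \<open>u\<close>. Each of the \<open>k\<close> slots costs one product, with
  constant \<open>M n R * C\<close>, and one sum over the coordinates.\<close>

lemma dir_deriv_poly_approx:
  fixes u :: "real ^ 'd \<Rightarrow> real \<Rightarrow> real ^ 'd"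
  defines "M \<equiv> \<lambda>n R. ((real n + 1) ^ 2 + 2 * real n + 3) * R ^ Suc n"
  assumes f: "f \<in> smooth_class \<beta> L"
    and u: "\<And>i. poly_approx \<rho> n C (\<lambda>z t. u z t $ i)"
    and \<rho>: "0 \<le> \<rho>" "\<rho> \<le> R" "1 \<le> R"
    and "length vs + k \<le> \<beta>" "\<forall>v\<in>set vs. norm v = 1"
  shows "poly_approx \<rho> n ((real CARD('d) * (M n R * C)) ^ k * L (length vs + k))
           (\<lambda>z t. dir_deriv f (u z t) k vs y $ c)"
  using assms(7,8)
proof (induction k arbitrary: vs)
  case 0
  have "\<bar>deriv_at f vs y $ c\<bar> \<le> L (length vs)"
    using smooth_class_norm_le[OF f] 0 by (intro order_trans[OF component_le_norm_cart]) simp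
  from poly_approx_mono[OF poly_approx_const[OF \<rho>(1)] this \<rho>(1), of n] show ?case
    by simp
next
  case (Suc k)
  have "poly_approx \<rho> n (\<Sum>i\<in>(UNIV :: 'd set). M n R * C * ((real CARD('d) * (M n R * C)) ^ k * L (length vs + Suc k)))
     (\<lambda>z t. \<Sum>i\<in>UNIV. u z t $ i * dir_deriv f (u z t) k (axis i 1 # vs) y $ c)"
  proof (intro poly_approx_sum)
    fix i :: 'd
    have "poly_approx \<rho> n ((real CARD('d) * (M n R * C)) ^ k * L (length (axis i (1 :: real) # vs) + k))
        (\<lambda>z t. dir_deriv f (u z t) k (axis i 1 # vs) y $ c)"
      using Suc.prems by (intro Suc.IH) auto
    from poly_approx_mult[OF u this \<rho>] show "poly_approx \<rho> n
        (M n R * C * ((real CARD('d) * (M n R * C)) ^ k * L (length vs + Suc k)))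
        (\<lambda>z t. u z t $ i * dir_deriv f (u z t) k (axis i 1 # vs) y $ c)"
      by (simp add: M_def)
  qed (use \<rho> in auto)
  then show ?case
    by (simp add: mult_ac)
qed

text \<open>Taylor's formula at \<open>y\<close> with displacement \<open>u\<close>: the terms up to
  order \<open>n\<close> are approximable, and the remainder is of size
  \<open>\<rho> ^ Suc n\<close> because \<open>u\<close> is of size \<open>\<rho>\<close>. This
  smallness is a hypothesis of its own, since \<open>poly_approx\<close> alone permits a constant
  term as large as \<open>C\<close>.\<close>

lemma poly_approx_smooth_compose:
  fixes u :: "real ^ 'd \<Rightarrow> real \<Rightarrow> real ^ 'd"
  defines "M \<equiv> \<lambda>n R. ((real n + 1) ^ 2 + 2 * real n + 3) * R ^ Suc n"
  assumes f: "f \<in> smooth_class \<beta> L" and "n < \<beta>" "C \<ge> 0" "L (Suc n) \<ge> 0"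
    and u: "\<And>i. poly_approx \<rho> n C (\<lambda>z t. u z t $ i)"
    and u_le: "\<And>z t i. (z, t) \<in> cyl \<rho> \<Longrightarrow> \<bar>u z t $ i\<bar> \<le> C * \<rho>"
    and \<rho>: "0 \<le> \<rho>" "\<rho> \<le> R" "1 \<le> R"
  shows "poly_approx \<rho> n
           ((\<Sum>k\<le>n. (real CARD('d) * (M n R * C)) ^ k * L k) + (real CARD('d) * C) ^ Suc n * L (Suc n))
           (\<lambda>z t. f (y + u z t) $ c)"
proof -
  define T where "T z t = (\<Sum>k\<le>n. 1 / fact k * dir_deriv f (u z t) k [] y $ c)" for z t
  have T: "poly_approx \<rho> n (\<Sum>k\<le>n. (real CARD('d) * (M n R * C)) ^ k * L k) T"
    unfolding T_def
  proof (intro poly_approx_sum poly_approx_scale)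
    fix k assume "k \<in> {..n}"
    with \<open>n < \<beta>\<close> show "poly_approx \<rho> n ((real CARD('d) * (M n R * C)) ^ k * L k)
        (\<lambda>z t. dir_deriv f (u z t) k [] y $ c)"
      using dir_deriv_poly_approx[OF f u \<rho>, of "[]" k y c] by (simp add: M_def)
    show "\<bar>1 / fact k :: real\<bar> \<le> 1"
      using fact_ge_1[of k, where 'a = real] by (simp add: divide_le_eq)
  qed (use \<rho> in auto)
  have "poly_approx \<rho> n ((real CARD('d) * C) ^ Suc n * L (Suc n)) (\<lambda>z t. f (y + u z t) $ c - T z t)"
  proof (rule poly_approx_remainder)
    fix z :: "real ^ 'd" and t assume zt: "(z, t) \<in> cyl \<rho>"
    have "\<bar>f (y + u z t) $ c - (\<Sum>k<Suc n. dir_deriv f (u z t) k [] y $ c / fact k)\<bar>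
        \<le> (\<Sum>i\<in>UNIV. \<bar>u z t $ i\<bar>) ^ Suc n * L (Suc n)"
      using \<open>n < \<beta>\<close> by (intro taylor_dir_deriv[OF f]) auto
    also have "(\<Sum>k<Suc n. dir_deriv f (u z t) k [] y $ c / fact k) = T z t"
      by (simp add: T_def lessThan_Suc_atMost)
    also have "(\<Sum>i\<in>UNIV. \<bar>u z t $ i\<bar>) \<le> (\<Sum>i\<in>(UNIV :: 'd set). C * \<rho>)"
      by (intro sum_mono u_le[OF zt])
    then have "(\<Sum>i\<in>UNIV. \<bar>u z t $ i\<bar>) ^ Suc n * L (Suc n) \<le> (real CARD('d) * (C * \<rho>)) ^ Suc n * L (Suc n)"
      using \<open>L (Suc n) \<ge> 0\<close> by (intro mult_right_mono power_mono sum_nonneg) auto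
    also have "\<dots> = (real CARD('d) * C) ^ Suc n * L (Suc n) * \<rho> ^ Suc n"
      by (simp only: power_mult_distrib mult_ac)
    finally show "\<bar>f (y + u z t) $ c - T z t\<bar> \<le> (real CARD('d) * C) ^ Suc n * L (Suc n) * \<rho> ^ Suc n" .
  qed (use \<rho> \<open>C \<ge> 0\<close> \<open>L (Suc n) \<ge> 0\<close> in auto)
  from poly_approx_add[OF T this] show ?thesis by simp
qed

section \<open>Integration in time\<close>

lemma abs_increment_le:
  fixes F :: "real \<Rightarrow> real"
  assumes "0 \<le> t" "\<And>s. 0 \<le> s \<Longrightarrow> s \<le> t \<Longrightarrow> (F has_real_derivative F' s) (at s)"
    and "\<And>s. 0 \<le> s \<Longrightarrow> s \<le> t \<Longrightarrow> \<bar>F' s\<bar> \<le> B"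
  shows "\<bar>F t - F 0\<bar> \<le> B * t"
proof -
  have "norm (F t - F 0) \<le> B * t - B * 0"
    by (rule norm_increment_le[where F' = F' and \<phi>' = "\<lambda>_. B"])
      (use assms in \<open>auto simp: has_real_derivative_iff_has_vector_derivative[symmetric]
        intro!: derivative_eq_intros\<close>)
  then show ?thesis by simp
qed

text \<open>The mean value inequality is applied to \<open>G\<close> minus the integrated
  polynomial, so the error retains the factor \<open>t\<close> instead of a power of
  \<open>\<rho>\<close>. The last conjunct ties the constant term to the integrand at the origin,
  which will be the field at the estimation point.\<close>

lemma poly_approx_antiderivative:
  fixes G :: "real ^ 'd \<Rightarrow> real \<Rightarrow> real"
  assumes g: "poly_approx \<rho> n C g" and "\<rho> \<ge> 0"
    and G0: "\<And>z. norm z \<le> \<rho> \<Longrightarrow> G z 0 = 0"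
    and G: "\<And>z t. (z, t) \<in> cyl \<rho> \<Longrightarrow> (G z has_real_derivative g z t) (at t)"
  shows "\<exists>q. (\<forall>k\<le>n. homogeneous k (q k)) \<and>
    (\<forall>z t. (z, t) \<in> cyl \<rho> \<longrightarrow> (\<forall>k\<le>n. \<bar>t * q k z t\<bar> \<le> C * \<rho> ^ Suc k) \<and>
       \<bar>G z t - (\<Sum>k\<le>n. t * q k z t)\<bar> \<le> C * \<rho> ^ Suc n * t) \<and>
    \<bar>q 0 0 0 - g 0 0\<bar> \<le> C * \<rho> ^ Suc n"
proof -
  have "C \<ge> 0" using poly_approx_nonneg[OF g \<open>\<rho> \<ge> 0\<close>] .
  from g obtain p where p: "\<And>k. k \<le> n \<Longrightarrow> homogeneous k (p k)"
    and p_le: "\<And>z t k. (z, t) \<in> cyl \<rho> \<Longrightarrow> k \<le> n \<Longrightarrow> \<bar>p k z t\<bar> \<le> C * \<rho> ^ k"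
    and p_err: "\<And>z t. (z, t) \<in> cyl \<rho> \<Longrightarrow> \<bar>g z t - (\<Sum>k\<le>n. p k z t)\<bar> \<le> C * \<rho> ^ Suc n"
    by (rule poly_approxE) blast
  have "\<exists>q. k \<le> n \<longrightarrow> homogeneous k q \<and> (\<forall>z t. ((\<lambda>s. s * q z s) has_real_derivative p k z t) (at t))" for k
    using homogeneous_antiderivative[OF p] by blast
  then obtain q where q: "\<And>k. k \<le> n \<Longrightarrow> homogeneous k (q k)"
    and q': "\<And>k z t. k \<le> n \<Longrightarrow> ((\<lambda>s. s * q k z s) has_real_derivative p k z t) (at t)"
    by metis
  show ?thesis
  proof (intro exI[of _ q] conjI allI impI)
    fix z :: "real ^ 'd" and t :: real assume zt: "(z, t) \<in> cyl \<rho>"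
    then have cyl: "(z, s) \<in> cyl \<rho>" if "0 \<le> s" "s \<le> t" for s
      using that by (auto simp: cyl_iff)
    have t: "0 \<le> t" "t \<le> \<rho>" using zt by (auto simp: cyl_iff)
    show "\<bar>t * q k z t\<bar> \<le> C * \<rho> ^ Suc k" if "k \<le> n" for k
    proof -
      have "\<bar>t * q k z t - 0 * q k z 0\<bar> \<le> C * \<rho> ^ k * t"
        by (rule abs_increment_le[OF t(1) q'[OF that] p_le[OF cyl that]])
      also have "\<dots> \<le> C * \<rho> ^ k * \<rho>"
        using t \<open>C \<ge> 0\<close> \<open>\<rho> \<ge> 0\<close> by (intro mult_left_mono) auto
      finally show ?thesis by (simp add: mult_ac)
    qed
    have "\<bar>(G z t - (\<Sum>k\<le>n. t * q k z t)) - (G z 0 - (\<Sum>k\<le>n. 0 * q k z 0))\<bar> \<le> C * \<rho> ^ Suc n * t"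
    proof (rule abs_increment_le[OF t(1) _ p_err[OF cyl]])
      fix s assume s: "0 \<le> s" "s \<le> t"
      show "((\<lambda>s. G z s - (\<Sum>k\<le>n. s * q k z s)) has_real_derivative g z s - (\<Sum>k\<le>n. p k z s)) (at s)"
        by (intro DERIV_diff DERIV_sum G cyl s q') auto
    qed auto
    moreover have "G z 0 = 0" using zt by (intro G0) (simp add: cyl_iff)
    ultimately show "\<bar>G z t - (\<Sum>k\<le>n. t * q k z t)\<bar> \<le> C * \<rho> ^ Suc n * t" by simp
  next
    have "(\<Sum>k\<le>n. p k 0 0) = p 0 0 0"
    proof -
      have "(\<Sum>k\<le>n. p k 0 0) = (\<Sum>k\<in>{0}. p k 0 0)"
        by (rule sum.mono_neutral_right) (auto intro!: homogeneous_at_0 p)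
      then show ?thesis by simp
    qed
    \<comment> \<open>A component of degree 0 is constant in both variables, so the derivative of
      \<open>s * q 0 0 s\<close> at 0 returns it.\<close>
    moreover have "q 0 0 0 = p 0 0 0"
    proof -
      have "((\<lambda>s. s * q 0 0 0) has_real_derivative q 0 0 0) (at 0)"
        by (auto intro!: derivative_eq_intros)
      moreover have "(\<lambda>s. s * q 0 0 0) = (\<lambda>s. s * q 0 0 s)"
        using homogeneous_degree_0[OF q[of 0]] by (metis le0)
      ultimately show ?thesis
        using q'[of 0 0 0] DERIV_unique by fastforce
    qed
    moreover have "(0 :: real ^ 'd, 0 :: real) \<in> cyl \<rho>" using \<open>\<rho> \<ge> 0\<close> by (simp add: cyl_iff)
    ultimately show "\<bar>q 0 0 0 - g 0 0\<bar> \<le> C * \<rho> ^ Suc n"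
      using p_err[of 0 0] by (simp add: abs_minus_commute)
  qed (rule q)
qed

text \<open>The factor \<open>t\<close> raises the degree of each component by one, with 0 filling
  the vacant degree 0. In the error it is spent as another \<open>\<rho>\<close>.\<close>

lemma poly_approx_Suc_antiderivative:
  fixes G :: "real ^ 'd \<Rightarrow> real \<Rightarrow> real"
  assumes g: "poly_approx \<rho> n C g" and "\<rho> \<ge> 0"
    and G0: "\<And>z. norm z \<le> \<rho> \<Longrightarrow> G z 0 = 0"
    and G: "\<And>z t. (z, t) \<in> cyl \<rho> \<Longrightarrow> (G z has_real_derivative g z t) (at t)"
  shows "poly_approx \<rho> (Suc n) C G"
proof -
  have "C \<ge> 0" using poly_approx_nonneg[OF g \<open>\<rho> \<ge> 0\<close>] .
  from poly_approx_antiderivative[OF assms] obtain q where q: "\<forall>k\<le>n. homogeneous k (q k)"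
    and q_le: "\<forall>z t. (z, t) \<in> cyl \<rho> \<longrightarrow> (\<forall>k\<le>n. \<bar>t * q k z t\<bar> \<le> C * \<rho> ^ Suc k) \<and>
       \<bar>G z t - (\<Sum>k\<le>n. t * q k z t)\<bar> \<le> C * \<rho> ^ Suc n * t"
    by blast
  show ?thesis
  proof (rule poly_approxI[where p = "\<lambda>k. case k of 0 \<Rightarrow> (\<lambda>z t. 0) | Suc k \<Rightarrow> (\<lambda>z t. t * q k z t)"])
    fix k assume "k \<le> Suc n"
    then show "homogeneous k (case k of 0 \<Rightarrow> (\<lambda>z t. 0) | Suc k \<Rightarrow> (\<lambda>z t. t * q k z t))"
      using homogeneous_mult[OF homogeneous_time q[rule_format]] by (auto split: nat.splits intro: homogeneous_zero)
    fix z :: "real ^ 'd" and t assume "(z, t) \<in> cyl \<rho>"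
    with \<open>k \<le> Suc n\<close> show "\<bar>(case k of 0 \<Rightarrow> (\<lambda>z t. 0) | Suc k \<Rightarrow> (\<lambda>z t. t * q k z t)) z t\<bar> \<le> C * \<rho> ^ k"
      using q_le \<open>C \<ge> 0\<close> by (cases k) auto
  next
    fix z :: "real ^ 'd" and t assume zt: "(z, t) \<in> cyl \<rho>"
    have "C * \<rho> ^ Suc n * t \<le> C * \<rho> ^ Suc n * \<rho>"
      using zt \<open>C \<ge> 0\<close> \<open>\<rho> \<ge> 0\<close> by (intro mult_left_mono) (auto simp: cyl_iff)
    then show "\<bar>G z t - (\<Sum>k\<le>Suc n. (case k of 0 \<Rightarrow> (\<lambda>z t. 0) | Suc k \<Rightarrow> (\<lambda>z t. t * q k z t)) z t)\<bar>
        \<le> C * \<rho> ^ Suc (Suc n)"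
      using q_le[rule_format, OF zt]
      by (simp add: sum.atMost_Suc_shift mult_ac del: sum.atMost_Suc)
  qed
qed

section \<open>Expansion of the flow in initial value and time\<close>

lemma flow_solution_smooth:
  fixes f :: "real ^ 'd \<Rightarrow> real ^ 'd"
  assumes f: "f \<in> smooth_class \<beta> L" and "\<beta> \<ge> 1" "L 1 > 0"
  shows "flow f x 0 = x" "(flow f x has_vector_derivative f (flow f x t)) (at t)"
  using flow_solution[OF smooth_class_lipschitz[OF f \<open>\<beta> \<ge> 1\<close>] \<open>L 1 > 0\<close> smooth_class_bounded[OF f]]
  by auto

lemma norm_flow_increment_le:
  fixes f :: "real ^ 'd \<Rightarrow> real ^ 'd"
  assumes f: "f \<in> smooth_class \<beta> L" and "\<beta> \<ge> 1" "L 1 > 0" and "t \<ge> 0"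
  shows "norm (flow f x t - x) \<le> L 0 * t"
proof -
  have "norm (flow f x t - flow f x 0) \<le> L 0 * t - L 0 * 0"
    by (rule norm_increment_le[where \<phi>' = "\<lambda>_. L 0"])
      (use assms flow_solution_smooth[OF f] smooth_class_bounded[OF f] in
        \<open>auto intro!: derivative_eq_intros\<close>)
  then show ?thesis using flow_solution_smooth[OF f] assms by simp
qed

text \<open>Only \<open>f\<close> itself is Taylor expanded: integrating an expansion of \<open>f\<close> along the flow improves the
  expansion of the flow by one order, so differentiability of the flow in the initial value is never
  used.\<close>

lemma field_along_flow_approx:
  fixes \<beta> :: nat and L :: "nat \<Rightarrow> real"
  assumes "\<beta> \<ge> 1" and L: "\<forall>k\<le>\<beta>. L k > 0" and "R \<ge> 1" and "n < \<beta>"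
  shows "\<exists>Q. \<forall>f\<in>smooth_class \<beta> L. \<forall>y :: real ^ 'd. \<forall>\<rho> c. 0 \<le> \<rho> \<longrightarrow> \<rho> \<le> R \<longrightarrow>
    poly_approx \<rho> n Q (\<lambda>z t. f (flow f (y + z) t) $ c)"
proof -
  have L01: "L 0 > 0" "L 1 > 0" using L \<open>\<beta> \<ge> 1\<close> by auto
  \<comment> \<open>The displacement from \<open>y\<close> is expandable to order \<open>n\<close>.
    The constant comes before field, base point and radius, which makes it uniform in them.\<close>
  define U where "U n C \<longleftrightarrow> (\<forall>f\<in>smooth_class \<beta> L. \<forall>y :: real ^ 'd. \<forall>\<rho> i. 0 \<le> \<rho> \<longrightarrow> \<rho> \<le> R \<longrightarrow>
    poly_approx \<rho> n C (\<lambda>z t. (flow f (y + z) t - y) $ i))" for n C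
  have u_le: "\<bar>(flow f (y + z) t - y) $ i\<bar> \<le> (1 + L 0) * \<rho>"
    if f: "f \<in> smooth_class \<beta> L" and zt: "(z, t) \<in> cyl \<rho>" for f \<rho> t i and y z :: "real ^ 'd"
  proof -
    have t: "norm z \<le> \<rho>" "0 \<le> t" "t \<le> \<rho>" using zt by (auto simp: cyl_iff)
    have "norm (flow f (y + z) t - y) \<le> norm (flow f (y + z) t - (y + z)) + norm z"
      using norm_triangle_ineq[of "flow f (y + z) t - (y + z)" z] by simp
    also have "\<dots> \<le> L 0 * t + \<rho>"
      using t by (intro add_mono norm_flow_increment_le[OF f \<open>\<beta> \<ge> 1\<close> L01(2)])
    also have "\<dots> \<le> (1 + L 0) * \<rho>"
      using t mult_left_mono[of t \<rho> "L 0"] L01 by (simp add: distrib_right)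
    finally show ?thesis using component_le_norm_cart order_trans by blast
  qed
  \<comment> \<open>Composition with the field preserves the order; only integration gains one. The
    Taylor remainder involves the derivative of order \<open>n + 1\<close>, hence
    \<open>n < \<beta>\<close>.\<close>
  have step: "\<exists>Q. \<forall>f\<in>smooth_class \<beta> L. \<forall>y :: real ^ 'd. \<forall>\<rho> c. 0 \<le> \<rho> \<longrightarrow> \<rho> \<le> R \<longrightarrow>
      poly_approx \<rho> n Q (\<lambda>z t. f (flow f (y + z) t) $ c)"
    if "U n C" "n < \<beta>" for n C
  proof (intro exI ballI allI impI)
    fix f :: "real ^ 'd \<Rightarrow> real ^ 'd" and \<rho> c y
    assume f: "f \<in> smooth_class \<beta> L" and \<rho>: "0 \<le> \<rho>" "\<rho> \<le> R"
    \<comment> \<open>One constant for the expansion of the displacement and for its size: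
      \<open>norm z\<close> contributes 1 and the motion at speed at most \<open>L 0\<close> the
      rest.\<close>
    define C' where "C' = max C (1 + L 0)"
    have C': "C' \<ge> C" "C' \<ge> 1 + L 0" "C' \<ge> 0" using L01 by (auto simp: C'_def)
    have "poly_approx \<rho> n C' (\<lambda>z t. (flow f (y + z) t - y) $ i)" for i
      using \<open>U n C\<close> f \<rho> unfolding U_def by (intro poly_approx_mono[OF _ C'(1)]) auto
    moreover have "\<bar>(flow f (y + z) t - y) $ i\<bar> \<le> C' * \<rho>" if "(z, t) \<in> cyl \<rho>" for z t i
      using u_le[OF f that] mult_right_mono[OF C'(2) \<rho>(1)] by (rule order_trans)
    ultimately have "poly_approx \<rho> n
       ((\<Sum>k\<le>n. (real CARD('d) * (((real n + 1) ^ 2 + 2 * real n + 3) * R ^ Suc n * C')) ^ k * L k)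
         + (real CARD('d) * C') ^ Suc n * L (Suc n))
       (\<lambda>z t. f (y + (flow f (y + z) t - y)) $ c)"
      using \<open>n < \<beta>\<close> C' L \<open>R \<ge> 1\<close> \<rho> by (intro poly_approx_smooth_compose[OF f]) (auto intro: less_imp_le)
    then show "poly_approx \<rho> n
       ((\<Sum>k\<le>n. (real CARD('d) * (((real n + 1) ^ 2 + 2 * real n + 3) * R ^ Suc n * max C (1 + L 0))) ^ k * L k)
         + (real CARD('d) * max C (1 + L 0)) ^ Suc n * L (Suc n))
       (\<lambda>z t. f (flow f (y + z) t) $ c)"
      by (simp add: C'_def)
  qed
  have "\<exists>C. U n C" using \<open>n < \<beta>\<close>
  proof (induction n)
    case 0
    have "U 0 (1 + L 0)"
      unfolding U_def
    proof (intro ballI allI impI poly_approx_remainder)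
      fix f :: "real ^ 'd \<Rightarrow> real ^ 'd" and \<rho> i t and y z :: "real ^ 'd"
      assume "f \<in> smooth_class \<beta> L" "(z, t) \<in> cyl \<rho>"
      then show "\<bar>(flow f (y + z) t - y) $ i\<bar> \<le> (1 + L 0) * \<rho> ^ Suc 0"
        using u_le by simp
    qed (use L01 in auto)
    then show ?case by blast
  next
    case (Suc n)
    then obtain C where "U n C" by auto
    with step[of n C] Suc.prems
    have "\<exists>Q. \<forall>f\<in>smooth_class \<beta> L. \<forall>y :: real ^ 'd. \<forall>\<rho> c. 0 \<le> \<rho> \<longrightarrow> \<rho> \<le> R \<longrightarrow>
      poly_approx \<rho> n Q (\<lambda>z t. f (flow f (y + z) t) $ c)"
      by simp
    then obtain Q where Q: "\<forall>f\<in>smooth_class \<beta> L. \<forall>y :: real ^ 'd. \<forall>\<rho> c. 0 \<le> \<rho> \<longrightarrow> \<rho> \<le> R \<longrightarrow>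
      poly_approx \<rho> n Q (\<lambda>z t. f (flow f (y + z) t) $ c)" ..
    \<comment> \<open>The displacement is \<open>z\<close> plus the increment of the flow: 1 belongs
      to the coordinate of \<open>z\<close>, and \<open>Q\<close> to the time integral of the
      field.\<close>
    have "U (Suc n) (1 + Q)"
      unfolding U_def
    proof (intro ballI allI impI)
      fix f :: "real ^ 'd \<Rightarrow> real ^ 'd" and \<rho> i y
      assume f: "f \<in> smooth_class \<beta> L" and \<rho>: "0 \<le> \<rho>" "\<rho> \<le> R"
      have "poly_approx \<rho> (Suc n) Q (\<lambda>z t. flow f (y + z) t $ i - (y + z) $ i)"
      proof (rule poly_approx_Suc_antiderivative[OF Q[rule_format, OF f \<rho>] \<rho>(1)])
        show "((\<lambda>t. flow f (y + z) t $ i - (y + z) $ i) has_real_derivative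
            f (flow f (y + z) t) $ i) (at t)" for z t
          using has_vector_derivative_diff[OF bounded_linear.has_vector_derivative[OF bounded_linear_vec_nth
              flow_solution_smooth(2)[OF f \<open>\<beta> \<ge> 1\<close> L01(2)]] has_vector_derivative_const]
          by (simp add: has_real_derivative_iff_has_vector_derivative)
      qed (simp add: flow_solution_smooth[OF f \<open>\<beta> \<ge> 1\<close> L01(2)])
      from poly_approx_add[OF poly_approx_coord[OF zero_less_Suc \<rho>(1), of n i] this]
      show "poly_approx \<rho> (Suc n) (1 + Q) (\<lambda>z t. (flow f (y + z) t - y) $ i)"
        by (rule poly_approx_cong) simp
    qed
    then show ?case by blast
  qed
  then obtain C where "U n C" ..
  from step[OF this \<open>n < \<beta>\<close>] show ?thesis .
qed

text \<open>Order \<open>\<beta> - 1\<close> is the highest that the smoothness of the field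
  permits. The final integration keeps its factor \<open>t\<close> rather than trading it for
  another order in \<open>\<rho>\<close>.\<close>

lemma flow_expansion:
  fixes \<beta> :: nat and L :: "nat \<Rightarrow> real"
  assumes "\<beta> \<ge> 1" and L: "\<forall>k\<le>\<beta>. L k > 0" and "R \<ge> 1"
  obtains C where "C \<ge> 0"
    and "\<And>(f :: real ^ 'd \<Rightarrow> real ^ 'd) \<rho> c y. f \<in> smooth_class \<beta> L \<Longrightarrow> 0 \<le> \<rho> \<Longrightarrow> \<rho> \<le> R \<Longrightarrow>
      \<exists>q. (\<forall>k<\<beta>. homogeneous k (q k)) \<and>
          (\<forall>z t. (z, t) \<in> cyl \<rho> \<longrightarrow>
             \<bar>flow f (y + z) t $ c - (y + z) $ c - (\<Sum>k<\<beta>. t * q k z t)\<bar> \<le> C * \<rho> ^ \<beta> * t) \<and>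
          \<bar>q 0 0 0 - f y $ c\<bar> \<le> C * \<rho> ^ \<beta>"
proof -
  have L01: "L 0 > 0" "L 1 > 0" using L \<open>\<beta> \<ge> 1\<close> by auto
  define n where "n = \<beta> - 1"
  then have \<beta>: "\<beta> = Suc n" using \<open>\<beta> \<ge> 1\<close> by simp
  have "n < \<beta>" by (simp add: \<beta>)
  from field_along_flow_approx[OF assms this, where 'd = 'd]
  obtain C where C': "\<forall>f\<in>smooth_class \<beta> L. \<forall>y :: real ^ 'd. \<forall>\<rho> c. 0 \<le> \<rho> \<longrightarrow> \<rho> \<le> R \<longrightarrow>
      poly_approx \<rho> n C (\<lambda>z t. f (flow f (y + z) t) $ c)" ..
  note C = C'[rule_format]
  show thesis
  \<comment> \<open>Nonnegativity of \<open>C\<close> is read off only once a field and a radius are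
    given; the maximum makes it unconditional.\<close>
  proof (rule that[of "max 0 C"])
    fix f :: "real ^ 'd \<Rightarrow> real ^ 'd" and \<rho> c y
    assume f: "f \<in> smooth_class \<beta> L" and \<rho>: "0 \<le> \<rho>" "\<rho> \<le> R"
    have C0: "C \<ge> 0" using poly_approx_nonneg[OF C[OF f \<rho>] \<rho>(1)] .
    have d: "((\<lambda>t. flow f (y + z) t $ c - (y + z) $ c) has_real_derivative
        f (flow f (y + z) t) $ c) (at t)" for z t
      using has_vector_derivative_diff[OF bounded_linear.has_vector_derivative[OF bounded_linear_vec_nth
          flow_solution_smooth(2)[OF f \<open>\<beta> \<ge> 1\<close> L01(2)]] has_vector_derivative_const]
      by (simp add: has_real_derivative_iff_has_vector_derivative)
    have z: "flow f (y + z) 0 $ c - (y + z) $ c = 0" for z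
      by (simp add: flow_solution_smooth[OF f \<open>\<beta> \<ge> 1\<close> L01(2)])
    have "\<exists>q. (\<forall>k\<le>n. homogeneous k (q k)) \<and>
      (\<forall>z t. (z, t) \<in> cyl \<rho> \<longrightarrow> (\<forall>k\<le>n. \<bar>t * q k z t\<bar> \<le> C * \<rho> ^ Suc k) \<and>
         \<bar>(flow f (y + z) t $ c - (y + z) $ c) - (\<Sum>k\<le>n. t * q k z t)\<bar> \<le> C * \<rho> ^ Suc n * t) \<and>
      \<bar>q 0 0 0 - f (flow f (y + 0) 0) $ c\<bar> \<le> C * \<rho> ^ Suc n"
      by (rule poly_approx_antiderivative[OF C[OF f \<rho>] \<rho>(1)]) (use d z in auto)
    then show "\<exists>q. (\<forall>k<\<beta>. homogeneous k (q k)) \<and>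
          (\<forall>z t. (z, t) \<in> cyl \<rho> \<longrightarrow>
             \<bar>flow f (y + z) t $ c - (y + z) $ c - (\<Sum>k<\<beta>. t * q k z t)\<bar> \<le> max 0 C * \<rho> ^ \<beta> * t) \<and>
          \<bar>q 0 0 0 - f y $ c\<bar> \<le> max 0 C * \<rho> ^ \<beta>"
      unfolding \<beta> lessThan_Suc_atMost less_Suc_eq_le max_absorb2[OF C0]
        flow_solution_smooth[OF f \<open>\<beta> \<ge> 1\<close> L01(2)] add_0_right
      by blast
  qed simp
qed

subsection \<open>Derivative at 0 of the interpolation polynomial\<close>

definition lagrange_basis :: "nat \<Rightarrow> nat \<Rightarrow> real poly" where
  "lagrange_basis n i = (\<Prod>j\<in>{..n} - {i}. smult (1 / (real i - real j)) [:- real j, 1:])"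

lemma poly_lagrange_basis:
  assumes "i \<le> n" "k \<le> n"
  shows "poly (lagrange_basis n i) (real k) = (if k = i then 1 else 0)"
proof (cases "k = i")
  case True
  then have "poly (lagrange_basis n i) (real k) = 1"
    unfolding lagrange_basis_def poly_prod by (intro prod.neutral) (auto simp: diff_divide_distrib[symmetric])
  with True show ?thesis by simp
next
  case False
  then have "k \<in> {..n} - {i}" using assms by simp
  then show ?thesis
    using False unfolding lagrange_basis_def poly_prod by (auto intro!: prod_zero bexI[of _ k])
qed

lemma degree_lagrange_basis:
  assumes "i \<le> n"
  shows "degree (lagrange_basis n i) \<le> n"
proof -
  have "degree (lagrange_basis n i) \<le> (\<Sum>j\<in>{..n} - {i}. degree (smult (1 / (real i - real j)) [:- real j, 1:]))"
    unfolding lagrange_basis_def by (rule degree_prod_sum_le[unfolded o_def]) simp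
  also have "\<dots> \<le> (\<Sum>j\<in>{..n} - {i}. 1)"
    by (intro sum_mono order_trans[OF degree_smult_le]) simp
  also have "\<dots> = n" using assms by simp
  finally show ?thesis .
qed

text \<open>Differentiation weights for unit spacing. Spacing \<open>\<Delta>\<close> enters only as
  the factor \<open>1 / \<Delta>\<close>, so these are constants of \<open>n\<close>.\<close>

definition deriv_weight :: "nat \<Rightarrow> nat \<Rightarrow> real" where
  "deriv_weight n i = poly (pderiv (lagrange_basis n i)) 0"

lemma interpolation_poly_eqI:
  fixes \<Delta> :: real
  assumes "\<Delta> \<noteq> 0" "degree p \<le> n" "\<And>i. i \<le> n \<Longrightarrow> poly p (real i * \<Delta>) = v i"
  shows "interpolation_poly n (\<lambda>i. real i * \<Delta>) v = p"
  unfolding interpolation_poly_def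
proof (rule the_equality)
  fix q assume q: "degree q \<le> n \<and> (\<forall>i\<le>n. poly q (real i * \<Delta>) = v i)"
  have "inj_on (\<lambda>i. real i * \<Delta>) {..n}"
    using assms(1) by (auto simp: inj_on_def)
  then have "card ((\<lambda>i. real i * \<Delta>) ` {..n}) = Suc n"
    by (simp add: card_image)
  then show "q = p"
    using q assms(2,3) by (intro poly_eqI_degree[of "(\<lambda>i. real i * \<Delta>) ` {..n}"]) auto
qed (use assms in auto)

lemma interpolation_poly_lagrange:
  fixes \<Delta> :: real
  assumes "\<Delta> \<noteq> 0"
  shows "interpolation_poly n (\<lambda>i. real i * \<Delta>) v =
           (\<Sum>i\<le>n. smult (v i) (pcompose (lagrange_basis n i) [:0, 1 / \<Delta>:]))"
proof (rule interpolation_poly_eqI[OF assms])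
  show "degree (\<Sum>i\<le>n. smult (v i) (pcompose (lagrange_basis n i) [:0, 1 / \<Delta>:])) \<le> n"
  proof (rule degree_sum_le)
    fix i assume "i \<in> {..n}"
    then show "degree (smult (v i) (pcompose (lagrange_basis n i) [:0, 1 / \<Delta>:])) \<le> n"
      using degree_lagrange_basis[of i n] assms
      by (intro order_trans[OF degree_smult_le]) (simp add: degree_pcompose)
  qed simp
  fix k assume "k \<le> n"
  then show "poly (\<Sum>i\<le>n. smult (v i) (pcompose (lagrange_basis n i) [:0, 1 / \<Delta>:])) (real k * \<Delta>) = v k"
    using assms by (simp add: poly_sum poly_pcompose poly_lagrange_basis if_distrib[of "\<lambda>x. _ * x"] cong: if_cong)
qed

lemma deriv_interpolation_poly:
  fixes \<Delta> :: real
  assumes "\<Delta> \<noteq> 0"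
  shows "poly (pderiv (interpolation_poly n (\<lambda>i. real i * \<Delta>) v)) 0
           = (\<Sum>i\<le>n. deriv_weight n i / \<Delta> * v i)"
  unfolding interpolation_poly_lagrange[OF assms] deriv_weight_def
    sum_comp_morphism[of pderiv, unfolded o_def, OF pderiv_0 pderiv_add, symmetric]
  by (simp add: pderiv_smult pderiv_pcompose poly_sum poly_pcompose pderiv_pCons mult_ac)

text \<open>Interpolation at \<open>n + 1\<close> nodes reproduces monomials up to degree
  \<open>n\<close>, so the rule returns their exact derivative at 0.\<close>

lemma deriv_weight_moment:
  fixes \<Delta> :: real
  assumes "\<Delta> \<noteq> 0" "k \<le> n"
  shows "(\<Sum>i\<le>n. deriv_weight n i / \<Delta> * (real i * \<Delta>) ^ k) = (if k = 1 then 1 else 0)"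
proof -
  have "interpolation_poly n (\<lambda>i. real i * \<Delta>) (\<lambda>i. (real i * \<Delta>) ^ k) = monom 1 k"
    using assms by (intro interpolation_poly_eqI order_trans[OF degree_monom_le]) (auto simp: poly_monom)
  moreover have "poly (pderiv (monom (1::real) k)) 0 = (if k = 1 then 1 else 0)"
    by (cases k) (auto simp: pderiv_monom poly_monom power_0_left)
  ultimately show ?thesis
    using deriv_interpolation_poly[OF assms(1), of n "\<lambda>i. (real i * \<Delta>) ^ k"] by simp
qed

subsection \<open>Local polynomial weights\<close>

definition bform :: "'i set \<Rightarrow> ('i \<Rightarrow> 'i \<Rightarrow> real) \<Rightarrow> ('i \<Rightarrow> real) \<Rightarrow> ('i \<Rightarrow> real) \<Rightarrow> real" where
  "bform I A u v = (\<Sum>i\<in>I. u i * (\<Sum>j\<in>I. A i j * v j))"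

lemma bform_commute:
  assumes "\<And>i j. i \<in> I \<Longrightarrow> j \<in> I \<Longrightarrow> A i j = A j i"
  shows "bform I A u v = bform I A v u"
proof -
  have "bform I A u v = (\<Sum>i\<in>I. \<Sum>j\<in>I. v j * (A j i * u i))"
    unfolding bform_def sum_distrib_left using assms by (intro sum.cong) (auto simp: mult_ac)
  also have "\<dots> = bform I A v u"
    unfolding bform_def sum_distrib_left by (rule sum.swap)
  finally show ?thesis .
qed

lemma bform_add_scale:
  assumes "\<And>i j. i \<in> I \<Longrightarrow> j \<in> I \<Longrightarrow> A i j = A j i"
  shows "bform I A (\<lambda>i. v i + s * u i) (\<lambda>i. v i + s * u i)
           = bform I A v v + 2 * s * bform I A u v + s\<^sup>2 * bform I A u u"
proof -
  have "bform I A (\<lambda>i. v i + s * u i) (\<lambda>i. v i + s * u i)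
      = bform I A v v + s * bform I A v u + s * bform I A u v + s\<^sup>2 * bform I A u u"
    unfolding bform_def
    by (simp add: distrib_left distrib_right sum.distrib sum_distrib_left mult_ac power2_eq_square)
  then show ?thesis using bform_commute[OF assms, where u = v and v = u] by simp
qed

text \<open>First-order optimality without derivatives. The step \<open>s = - b / m\<close> with
  \<open>m = \<bar>a\<bar> + 1\<close> is short enough for the linear term to win over the quadratic
  one, whatever the sign of \<open>a\<close>.\<close>

lemma linear_term_eq_0:
  fixes a b :: real
  assumes "\<And>s. 0 \<le> 2 * s * b + s\<^sup>2 * a"
  shows "b = 0"
proof (rule ccontr)
  assume "b \<noteq> 0"
  define m where "m = \<bar>a\<bar> + 1"
  have m: "m > 0" "a < 2 * m" unfolding m_def by (auto simp: abs_if)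
  have "0 \<le> 2 * (- b / m) * b + (- b / m)\<^sup>2 * a"
    by (rule assms)
  also have "\<dots> = (b / m)\<^sup>2 * (a - 2 * m)"
    using m by (simp add: power2_eq_square field_simps)
  finally have "0 \<le> (b / m)\<^sup>2 * (a - 2 * m)" .
  moreover have "(b / m)\<^sup>2 > 0" using \<open>b \<noteq> 0\<close> m by simp
  ultimately show False
    using m by (simp add: zero_le_mult_iff)
qed

text \<open>Outside \<open>I\<close> extensional functions take the value \<open>undefined\<close>,
  a singleton and hence compact factor. This turns the set into a product over the whole index type,
  to which Tychonoff's theorem applies.\<close>

lemma compact_PiE:
  fixes B :: "'i \<Rightarrow> real set"
  assumes "\<And>i. i \<in> I \<Longrightarrow> compact (B i)"
  shows "compact (PiE I B)"
proof -
  define B' where "B' i = (if i \<in> I then B i else {undefined})" for i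
  have "f \<in> PiE I B \<longleftrightarrow> f \<in> PiE UNIV B'" for f
    by (simp add: PiE_iff extensional_def B'_def) (metis singletonD singletonI)
  then have eq: "PiE I B = PiE UNIV B'" by blast
  have "compactin (product_topology (\<lambda>_. euclidean) UNIV) (PiE UNIV B')"
    by (rule compactin_PiE[of "\<lambda>_. euclidean" UNIV B', THEN iffD2]) (use assms in \<open>auto simp: B'_def\<close>)
  then have "compact (PiE UNIV B')"
    by (simp add: euclidean_product_topology)
  with eq show ?thesis by (simp only:)
qed

lemma continuous_on_coordinate: "continuous_on S (\<lambda>v :: 'i \<Rightarrow> real. v i)"
  by (rule continuous_on_subset[OF continuous_on_product_coordinates]) simp

lemma continuous_on_bform: "continuous_on S (\<lambda>v. bform I A v v)"
  unfolding bform_def by (intro continuous_intros continuous_on_coordinate)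

lemma bform_cong:
  "(\<And>i. i \<in> I \<Longrightarrow> u i = u' i) \<Longrightarrow> (\<And>i. i \<in> I \<Longrightarrow> v i = v' i) \<Longrightarrow> bform I A u v = bform I A u' v'"
  unfolding bform_def by (auto intro!: sum.cong)

lemma bform_scale: "bform I A (\<lambda>i. c * u i) (\<lambda>i. c * v i) = c\<^sup>2 * bform I A u v"
  unfolding bform_def by (simp add: sum_distrib_left power2_eq_square mult_ac)

lemma bform_indicator:
  assumes "finite I" "k \<in> I"
  shows "bform I A (\<lambda>i. if i = k then 1 else 0) v = (\<Sum>j\<in>I. A k j * v j)"
  using assms unfolding bform_def by (simp add: if_distrib[of "\<lambda>x. x * _"] cong: if_cong)

text \<open>The minimum of the Rayleigh quotient is attained, and a minimiser is an eigenvector.\<close>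

lemma rayleigh_eigenvalue:
  assumes I: "finite I" "I \<noteq> {}" and sym: "\<And>i j. i \<in> I \<Longrightarrow> j \<in> I \<Longrightarrow> A i j = A j i"
  shows "\<exists>\<mu>. eigenvalue_on I A \<mu> \<and> (\<forall>v. \<mu> * (\<Sum>i\<in>I. (v i)\<^sup>2) \<le> bform I A v v)"
proof -
  \<comment> \<open>The unit sphere. The box contains it and provides compactness in the product
    topology.\<close>
  define S where "S = PiE I (\<lambda>_. {-1..1::real}) \<inter> {v. (\<Sum>i\<in>I. (v i)\<^sup>2) = 1}"
  have "compact S"
    unfolding S_def
    by (intro compact_Int_closed compact_PiE closed_Collect_eq continuous_intros
        continuous_on_coordinate) auto
  moreover obtain k where k: "k \<in> I" using I by blast
  have "(\<lambda>i. if i \<in> I then (if i = k then 1 else 0) else undefined) \<in> S"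
    using k I by (auto simp: S_def PiE_def extensional_def if_distrib[of "\<lambda>x. x\<^sup>2"] cong: if_cong)
  then have "S \<noteq> {}" by blast
  ultimately obtain v where v: "v \<in> S" and v_min: "\<And>w. w \<in> S \<Longrightarrow> bform I A v v \<le> bform I A w w"
    using continuous_attains_inf[OF _ _ continuous_on_bform] by metis
  define \<mu> where "\<mu> = bform I A v v"
  have v1: "(\<Sum>i\<in>I. (v i)\<^sup>2) = 1" using v by (simp add: S_def)
  have le: "\<mu> * (\<Sum>i\<in>I. (w i)\<^sup>2) \<le> bform I A w w" for w
  proof (cases "(\<Sum>i\<in>I. (w i)\<^sup>2) = 0")
    case True
    then have "\<forall>i\<in>I. w i = 0"
      using I by (simp add: sum_nonneg_eq_0_iff)
    then have "bform I A w w = bform I A (\<lambda>_. 0) (\<lambda>_. 0)"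
      by (intro bform_cong) auto
    with True show ?thesis by (simp add: bform_def)
  next
    case False
    define N where "N = (\<Sum>i\<in>I. (w i)\<^sup>2)"
    have N: "N > 0" using False by (simp add: N_def sum_nonneg order_less_le)
    define w' where "w' = restrict (\<lambda>i. 1 / sqrt N * w i) I"
    have "(\<Sum>i\<in>I. (w' i)\<^sup>2) = (\<Sum>i\<in>I. (w i)\<^sup>2 / N)"
      using N by (intro sum.cong) (auto simp: w'_def power_divide)
    also have "\<dots> = 1" using N by (simp add: N_def sum_divide_distrib[symmetric])
    finally have w'1: "(\<Sum>i\<in>I. (w' i)\<^sup>2) = 1" .
    have "\<bar>w' i\<bar> \<le> 1" if "i \<in> I" for i
    proof -
      have "(w' i)\<^sup>2 \<le> (\<Sum>i\<in>I. (w' i)\<^sup>2)"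
        using that I by (intro member_le_sum) auto
      then show ?thesis by (simp add: w'1 abs_square_le_1)
    qed
    then have "w' i \<in> {-1..1}" if "i \<in> I" for i
      using that by (simp add: abs_le_iff minus_le_iff)
    moreover have "w' \<in> extensional I" by (simp add: w'_def)
    ultimately have "w' \<in> S"
      using w'1 unfolding S_def by (simp add: PiE_iff)
    then have "\<mu> \<le> bform I A w' w'" unfolding \<mu>_def by (rule v_min)
    also have "\<dots> = bform I A (\<lambda>i. 1 / sqrt N * w i) (\<lambda>i. 1 / sqrt N * w i)"
      by (rule bform_cong) (simp_all add: w'_def)
    also have "\<dots> = bform I A w w / N"
      unfolding bform_scale using N by (simp add: power_divide)
    finally show ?thesis using N by (simp add: N_def[symmetric] field_simps)
  qed
  have eig: "(\<Sum>j\<in>I. A k j * v j) = \<mu> * v k" if k: "k \<in> I" for k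
  proof -
    \<comment> \<open>Perturbing the minimiser along coordinate \<open>k\<close>: the vanishing of
      the linear term is row \<open>k\<close> of the eigenvalue equation.\<close>
    define u where "u i = (if i = k then 1 else 0 :: real)" for i
    have u: "(\<Sum>i\<in>I. u i * v i) = v k" "(\<Sum>i\<in>I. (u i)\<^sup>2) = 1"
      using k I by (simp_all add: u_def if_distrib[of "\<lambda>x. x * _"] if_distrib[of "\<lambda>x. x\<^sup>2"] cong: if_cong)
    have "(\<Sum>i\<in>I. (v i + s * u i)\<^sup>2) = 1 + 2 * s * v k + s\<^sup>2" for s
    proof -
      have "(\<Sum>i\<in>I. (v i + s * u i)\<^sup>2)
          = (\<Sum>i\<in>I. (v i)\<^sup>2) + 2 * s * (\<Sum>i\<in>I. u i * v i) + s\<^sup>2 * (\<Sum>i\<in>I. (u i)\<^sup>2)"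
        by (simp add: power2_eq_square algebra_simps sum.distrib sum_distrib_left)
      then show ?thesis by (simp add: u v1)
    qed
    then have "0 \<le> 2 * s * (bform I A u v - \<mu> * v k) + s\<^sup>2 * (bform I A u u - \<mu>)" for s
      using le[of "\<lambda>i. v i + s * u i"] bform_add_scale[OF sym, where u = u and v = v and s = s]
      by (simp add: \<mu>_def[symmetric] algebra_simps)
    then have "bform I A u v - \<mu> * v k = 0" by (rule linear_term_eq_0)
    then show ?thesis using bform_indicator[OF I(1) k, of A v] by (simp add: u_def[abs_def])
  qed
  have "\<exists>i\<in>I. v i \<noteq> 0"
  proof (rule ccontr)
    assume "\<not> (\<exists>i\<in>I. v i \<noteq> 0)"
    then have "(\<Sum>i\<in>I. (v i)\<^sup>2) = 0" by simp
    with v1 show False by simp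
  qed
  with eig have "eigenvalue_on I A \<mu>"
    unfolding eigenvalue_on_def by (intro exI[of _ v]) auto
  then show ?thesis using le by blast
qed

text \<open>Every eigenvalue is the Rayleigh quotient of its eigenvector, hence at least the
  minimum, which is itself an eigenvalue. So the \<open>LEAST\<close> in
  \<open>min_eigenvalue\<close> is attained and bounds the form from below.\<close>

lemma min_eigenvalue_le_bform:
  assumes I: "finite I" "I \<noteq> {}" and sym: "\<And>i j. i \<in> I \<Longrightarrow> j \<in> I \<Longrightarrow> A i j = A j i"
  shows "min_eigenvalue I A * (\<Sum>i\<in>I. (v i)\<^sup>2) \<le> bform I A v v"
proof -
  from rayleigh_eigenvalue[where A = A, OF I sym]
  obtain \<mu> where \<mu>: "eigenvalue_on I A \<mu>" "\<forall>v. \<mu> * (\<Sum>i\<in>I. (v i)\<^sup>2) \<le> bform I A v v"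
    by blast
  have "min_eigenvalue I A = \<mu>"
    unfolding min_eigenvalue_def
  proof (rule Least_equality)
    fix \<nu> assume "eigenvalue_on I A \<nu>"
    then obtain v k where v: "\<forall>i\<in>I. (\<Sum>j\<in>I. A i j * v j) = \<nu> * v i" and k: "k \<in> I" "v k \<noteq> 0"
      unfolding eigenvalue_on_def by blast
    have "bform I A v v = (\<Sum>i\<in>I. v i * (\<nu> * v i))"
      unfolding bform_def using v by (intro sum.cong) auto
    also have "\<dots> = \<nu> * (\<Sum>i\<in>I. (v i)\<^sup>2)"
      by (simp add: sum_distrib_left power2_eq_square mult_ac)
    finally have "bform I A v v = \<nu> * (\<Sum>i\<in>I. (v i)\<^sup>2)" .
    moreover have "0 < (\<Sum>i\<in>I. (v i)\<^sup>2)"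
      using k I by (intro sum_pos2[of I k]) auto
    ultimately show "\<mu> \<le> \<nu>" using \<mu>(2)[rule_format, of v] by simp
  qed (rule \<mu>(1))
  then show ?thesis using \<mu>(2) by simp
qed

text \<open>The linear system is the stationarity condition of \<open>bform I A w w\<close> minus
  twice the pairing of \<open>c\<close> with \<open>w\<close>. The lower bound \<open>\<mu>\<close>
  makes this functional coercive, so a minimiser exists.\<close>

lemma positive_definite_solvable:
  assumes I: "finite I" and sym: "\<And>i j. i \<in> I \<Longrightarrow> j \<in> I \<Longrightarrow> A i j = A j i"
    and "\<mu> > 0" and pos: "\<And>v. \<mu> * (\<Sum>i\<in>I. (v i)\<^sup>2) \<le> bform I A v v"
  obtains w where "\<And>i. i \<in> I \<Longrightarrow> (\<Sum>j\<in>I. A i j * w j) = c i"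
proof -
  define F where "F w = bform I A w w - 2 * (\<Sum>i\<in>I. c i * w i)" for w
  have F0: "F (\<lambda>_. 0) = 0" by (simp add: F_def bform_def)
  have F_cong: "F w = F w'" if "\<And>i. i \<in> I \<Longrightarrow> w i = w' i" for w w'
    unfolding F_def using that bform_cong[of I w w' w w'] by simp
  define S where "S = (\<Sum>i\<in>I. (c i)\<^sup>2 / \<mu>)"
  \<comment> \<open>Completing the square bounds \<open>F\<close> below by \<open>\<mu>\<close>
    times the squared distance to \<open>c / \<mu>\<close>, minus \<open>S\<close>. As
    \<open>S < \<mu> * r^2\<close>, \<open>F\<close> is positive outside the box of half width
    \<open>r\<close>, while \<open>F\<close> vanishes at 0; minimising over the box
    suffices.\<close>
  define r where "r = sqrt (S / \<mu>) + 1"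
  have "S \<ge> 0" using \<open>\<mu> > 0\<close> by (auto simp: S_def intro!: sum_nonneg)
  then have r: "r > 0" "S < \<mu> * r\<^sup>2"
  proof -
    show "r > 0" using \<open>S \<ge> 0\<close> \<open>\<mu> > 0\<close> by (simp add: r_def add_nonneg_pos)
    have "sqrt (S / \<mu>) < r" by (simp add: r_def)
    then have "S / \<mu> < r\<^sup>2"
      using \<open>r > 0\<close> real_less_rsqrt real_sqrt_less_iff
      by (metis abs_of_pos real_sqrt_abs)
    then show "S < \<mu> * r\<^sup>2" using \<open>\<mu> > 0\<close> by (simp add: field_simps)
  qed
  have F_ge: "(\<Sum>i\<in>I. \<mu> * (w i - c i / \<mu>)\<^sup>2) - S \<le> F w" for w
  proof -
    have "(\<Sum>i\<in>I. \<mu> * (w i - c i / \<mu>)\<^sup>2) = (\<Sum>i\<in>I. \<mu> * (w i)\<^sup>2 - 2 * (c i * w i) + (c i)\<^sup>2 / \<mu>)"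
      using \<open>\<mu> > 0\<close> by (intro sum.cong) (auto simp: power2_eq_square field_simps)
    also have "\<dots> = \<mu> * (\<Sum>i\<in>I. (w i)\<^sup>2) - 2 * (\<Sum>i\<in>I. c i * w i) + S"
      by (simp add: S_def sum.distrib sum_subtractf sum_distrib_left)
    finally show ?thesis using pos[of w] by (simp add: F_def)
  qed
  define D where "D = PiE I (\<lambda>i. {c i / \<mu> - r .. c i / \<mu> + r})"
  have out: "F w > 0" if "restrict w I \<notin> D" for w
  proof -
    from that obtain k where k: "k \<in> I" "w k \<notin> {c k / \<mu> - r .. c k / \<mu> + r}"
      unfolding D_def by (auto simp: PiE_def Pi_def)
    then have "r \<le> \<bar>w k - c k / \<mu>\<bar>" by auto
    then have "r\<^sup>2 \<le> (w k - c k / \<mu>)\<^sup>2" using r by (simp add: abs_le_square_iff[symmetric])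
    then have "\<mu> * r\<^sup>2 \<le> \<mu> * (w k - c k / \<mu>)\<^sup>2" using \<open>\<mu> > 0\<close> by simp
    also have "\<dots> \<le> (\<Sum>i\<in>I. \<mu> * (w i - c i / \<mu>)\<^sup>2)"
      using k I \<open>\<mu> > 0\<close> by (intro member_le_sum) auto
    finally show ?thesis using F_ge[of w] r by simp
  qed
  have "compact D"
    unfolding D_def by (intro compact_PiE) simp
  moreover have "restrict (\<lambda>_. 0) I \<in> D" using out[of "\<lambda>_. 0"] F0 by auto
  moreover have "continuous_on D F"
    unfolding F_def by (intro continuous_intros continuous_on_bform continuous_on_coordinate)
  ultimately obtain w where w: "w \<in> D" and w_min: "\<And>v. v \<in> D \<Longrightarrow> F w \<le> F v"
    using continuous_attains_inf[of D F] by (metis empty_iff)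
  have min: "F w \<le> F v" for v
  proof (cases "restrict v I \<in> D")
    case True
    have "F (restrict v I) = F v" by (rule F_cong) simp
    with w_min[OF True] show ?thesis by simp
  next
    case False
    have "F w \<le> F (restrict (\<lambda>_. 0) I)" by (rule w_min) fact
    also have "\<dots> = 0" using F0 F_cong[of "restrict (\<lambda>_. 0) I" "\<lambda>_. 0"] by simp
    finally show ?thesis using out[OF False] by simp
  qed
  show thesis
  proof (rule that[of w])
    fix k assume k: "k \<in> I"
    define u where "u i = (if i = k then 1 else 0 :: real)" for i
    have u: "(\<Sum>i\<in>I. c i * u i) = c k"
      using k I by (simp add: u_def if_distrib[of "\<lambda>x. _ * x"] cong: if_cong)
    have "F (\<lambda>i. w i + s * u i) = F w + (2 * s * (bform I A u w - c k) + s\<^sup>2 * bform I A u u)" for s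
    proof -
      have "(\<Sum>i\<in>I. c i * (w i + s * u i)) = (\<Sum>i\<in>I. c i * w i) + s * (\<Sum>i\<in>I. c i * u i)"
        by (simp add: distrib_left sum.distrib sum_distrib_left mult_ac)
      then show ?thesis
        using bform_add_scale[where A = A and u = u and v = w and s = s, OF sym]
        by (simp add: F_def u algebra_simps)
    qed
    then have "0 \<le> 2 * s * (bform I A u w - c k) + s\<^sup>2 * bform I A u u" for s
      using min[of "\<lambda>i. w i + s * u i"] by simp
    then have "bform I A u w - c k = 0" by (rule linear_term_eq_0)
    then show "(\<Sum>j\<in>I. A k j * w j) = c k"
      using bform_indicator[OF I(1) k, of A w] by (simp add: u_def[abs_def])
  qed
qed

section \<open>The local polynomial estimator as a linear smoother\<close>

lemma finite_multi_indices: "finite (multi_indices l :: ('d::finite \<Rightarrow> nat) set)"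
proof (rule finite_subset)
  show "multi_indices l \<subseteq> PiE (UNIV :: 'd set) (\<lambda>_. {..l})"
  proof
    fix \<alpha> :: "'d \<Rightarrow> nat" assume "\<alpha> \<in> multi_indices l"
    then have "\<alpha> i \<le> l" for i
      using member_le_sum[of i UNIV \<alpha>] by (simp add: multi_indices_def)
    then show "\<alpha> \<in> PiE UNIV (\<lambda>_. {..l})" by (auto simp: PiE_iff)
  qed
qed (simp add: finite_PiE)

lemma zero_in_multi_indices: "(\<lambda>_. 0) \<in> multi_indices l"
  by (simp add: multi_indices_def)

lemma monomial_basis_0: "monomial_basis 0 \<alpha> = (if \<alpha> = (\<lambda>_. 0) then 1 else 0)"
proof (cases "\<alpha> = (\<lambda>_. 0)")
  case False
  then obtain i where "\<alpha> i \<noteq> 0" by auto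
  then have "(\<Prod>i\<in>UNIV. (0::real) ^ \<alpha> i) = 0"
    by (intro prod_zero) (auto intro!: exI[of _ i])
  with False show ?thesis by (simp add: monomial_basis_def)
qed (simp add: monomial_basis_def)

lemma abs_monomial_basis_le_1:
  assumes "norm z \<le> 1"
  shows "\<bar>monomial_basis z \<alpha>\<bar> \<le> 1"
proof -
  have "\<bar>\<Prod>i\<in>UNIV. z $ i ^ \<alpha> i\<bar> \<le> 1"
    unfolding abs_prod power_abs
    by (intro prod_le_1 conjI power_le_one order_trans[OF component_le_norm_cart assms]) auto
  moreover have "(1::real) \<le> (\<Prod>i\<in>UNIV. fact (\<alpha> i))"
    by (intro prod_ge_1 fact_ge_1)
  ultimately show ?thesis
    unfolding monomial_basis_def abs_divide by (simp add: divide_le_eq)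
qed

text \<open>The objective is quadratic, so its expansion along a direction is exact. The bracketing
  matches \<open>linear_term_eq_0\<close>.\<close>

lemma lp_objective_add:
  "lp_objective l K h m x Z y (\<lambda>\<alpha>. \<theta> \<alpha> + s * u \<alpha>) = lp_objective l K h m x Z y \<theta>
     + (2 * s * (- (\<Sum>j=1..m. (Z j - (\<Sum>\<alpha>\<in>multi_indices l. \<theta> \<alpha> * monomial_basis ((x j - y) /\<^sub>R h) \<alpha>)) *
            (\<Sum>\<alpha>\<in>multi_indices l. u \<alpha> * monomial_basis ((x j - y) /\<^sub>R h) \<alpha>) * K (norm (x j - y) / h)))
        + s\<^sup>2 * (\<Sum>j=1..m. (\<Sum>\<alpha>\<in>multi_indices l. u \<alpha> * monomial_basis ((x j - y) /\<^sub>R h) \<alpha>)\<^sup>2 *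
            K (norm (x j - y) / h)))"
proof -
  define p where "p \<theta> j = (\<Sum>\<alpha>\<in>multi_indices l. \<theta> \<alpha> * monomial_basis ((x j - y) /\<^sub>R h) \<alpha>)" for \<theta> j
  have "p (\<lambda>\<alpha>. \<theta> \<alpha> + s * u \<alpha>) j = p \<theta> j + s * p u j" for j
    by (simp add: p_def distrib_right sum.distrib sum_distrib_left mult_ac)
  then show ?thesis
    unfolding lp_objective_def p_def[symmetric]
    by (simp add: power2_eq_square algebra_simps sum.distrib sum_distrib_left sum_subtractf)
qed

lemma lp_objective_cong:
  "(\<And>\<alpha>. \<alpha> \<in> multi_indices l \<Longrightarrow> \<theta> \<alpha> = \<theta>' \<alpha>) \<Longrightarrow>
    lp_objective l K h m x Z y \<theta> = lp_objective l K h m x Z y \<theta>'"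
  unfolding lp_objective_def by simp

text \<open>The kernel may take negative values, so convexity of the least squares problem comes from the
  eigenvalue condition alone.\<close>

lemma lp_coeffs_normal_equations:
  fixes x :: "nat \<Rightarrow> real ^ 'd"
  assumes "m > 0" "h > 0"
    and \<mu>: "\<mu> > 0" "\<And>v. \<mu> * (\<Sum>\<alpha>\<in>multi_indices l. (v \<alpha>)\<^sup>2) \<le> bform (multi_indices l) (lp_matrix K h m x y) v v"
    and \<gamma>: "\<gamma> \<in> multi_indices l"
  shows "(\<Sum>\<alpha>\<in>multi_indices l. lp_matrix K h m x y \<gamma> \<alpha> * lp_coeffs l K h m x Z y \<alpha>)
    = 1 / (real m * h ^ CARD('d)) *
      (\<Sum>j=1..m. Z j * monomial_basis ((x j - y) /\<^sub>R h) \<gamma> * K (norm (x j - y) / h))"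
proof -
  let ?I = "multi_indices l :: ('d \<Rightarrow> nat) set"
  let ?obj = "lp_objective l K h m x Z y"
  define \<psi> where "\<psi> j \<alpha> = monomial_basis ((x j - y) /\<^sub>R h) \<alpha>" for j and \<alpha> :: "'d \<Rightarrow> nat"
  define k where "k j = K (norm (x j - y) / h)" for j
  define M where "M = real m * h ^ CARD('d)"
  have "M > 0" using assms by (simp add: M_def)
  define c where "c \<alpha> = 1 / M * (\<Sum>j=1..m. Z j * \<psi> j \<alpha> * k j)" for \<alpha>
  \<comment> \<open>Up to the factor -2, the gradient of the objective.\<close>
  define res where "res \<theta> \<alpha> = (\<Sum>j=1..m. (Z j - (\<Sum>\<gamma>\<in>?I. \<theta> \<gamma> * \<psi> j \<gamma>)) * \<psi> j \<alpha> * k j)" for \<theta> \<alpha>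
  have A: "lp_matrix K h m x y \<alpha> \<gamma> = 1 / M * (\<Sum>j=1..m. \<psi> j \<alpha> * \<psi> j \<gamma> * k j)" for \<alpha> \<gamma>
    by (simp add: lp_matrix_def \<psi>_def k_def M_def)
  have sym: "lp_matrix K h m x y \<alpha> \<gamma> = lp_matrix K h m x y \<gamma> \<alpha>" for \<alpha> \<gamma>
    by (simp add: A mult_ac)
  have res: "res \<theta> \<alpha> = M * (c \<alpha> - (\<Sum>\<gamma>\<in>?I. lp_matrix K h m x y \<alpha> \<gamma> * \<theta> \<gamma>))" for \<theta> \<alpha>
  proof -
    have "M * (\<Sum>\<gamma>\<in>?I. lp_matrix K h m x y \<alpha> \<gamma> * \<theta> \<gamma>) = (\<Sum>\<gamma>\<in>?I. \<Sum>j=1..m. \<theta> \<gamma> * \<psi> j \<gamma> * \<psi> j \<alpha> * k j)"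
      using \<open>M > 0\<close> by (simp add: A sum_distrib_left sum_distrib_right mult_ac)
    also have "\<dots> = (\<Sum>j=1..m. (\<Sum>\<gamma>\<in>?I. \<theta> \<gamma> * \<psi> j \<gamma>) * \<psi> j \<alpha> * k j)"
      by (subst sum.swap) (simp add: sum_distrib_right)
    finally show ?thesis
      using \<open>M > 0\<close> by (simp add: res_def c_def right_diff_distrib left_diff_distrib sum_subtractf)
  qed
  have quad: "(\<Sum>j=1..m. (\<Sum>\<alpha>\<in>?I. u \<alpha> * \<psi> j \<alpha>)\<^sup>2 * k j) = M * bform ?I (lp_matrix K h m x y) u u" for u
  proof -
    have "M * bform ?I (lp_matrix K h m x y) u u
        = (\<Sum>\<alpha>\<in>?I. \<Sum>\<gamma>\<in>?I. \<Sum>j=1..m. u \<alpha> * \<psi> j \<alpha> * (u \<gamma> * \<psi> j \<gamma>) * k j)"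
      using \<open>M > 0\<close> by (simp add: bform_def A sum_distrib_left sum_distrib_right mult_ac)
    also have "\<dots> = (\<Sum>\<alpha>\<in>?I. \<Sum>j=1..m. \<Sum>\<gamma>\<in>?I. u \<alpha> * \<psi> j \<alpha> * (u \<gamma> * \<psi> j \<gamma>) * k j)"
      by (intro sum.cong[OF refl] sum.swap)
    also have "\<dots> = (\<Sum>j=1..m. \<Sum>\<alpha>\<in>?I. \<Sum>\<gamma>\<in>?I. u \<alpha> * \<psi> j \<alpha> * (u \<gamma> * \<psi> j \<gamma>) * k j)"
      by (rule sum.swap)
    also have "\<dots> = (\<Sum>j=1..m. (\<Sum>\<alpha>\<in>?I. u \<alpha> * \<psi> j \<alpha>)\<^sup>2 * k j)"
      unfolding power2_eq_square sum_product by (simp only: sum_distrib_right)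
    finally show ?thesis by simp
  qed
  have lin: "(\<Sum>j=1..m. (Z j - (\<Sum>\<gamma>\<in>?I. \<theta> \<gamma> * \<psi> j \<gamma>)) * (\<Sum>\<alpha>\<in>?I. u \<alpha> * \<psi> j \<alpha>) * k j)
      = (\<Sum>\<alpha>\<in>?I. u \<alpha> * res \<theta> \<alpha>)" for \<theta> u
  proof -
    have "(\<Sum>\<alpha>\<in>?I. u \<alpha> * res \<theta> \<alpha>)
        = (\<Sum>\<alpha>\<in>?I. \<Sum>j=1..m. (Z j - (\<Sum>\<gamma>\<in>?I. \<theta> \<gamma> * \<psi> j \<gamma>)) * (u \<alpha> * \<psi> j \<alpha>) * k j)"
      by (simp add: res_def sum_distrib_left mult_ac)
    also have "\<dots> = (\<Sum>j=1..m. \<Sum>\<alpha>\<in>?I. (Z j - (\<Sum>\<gamma>\<in>?I. \<theta> \<gamma> * \<psi> j \<gamma>)) * (u \<alpha> * \<psi> j \<alpha>) * k j)"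
      by (rule sum.swap)
    finally show ?thesis
      by (simp add: sum_distrib_left sum_distrib_right)
  qed
  have obj: "?obj (\<lambda>\<alpha>. \<theta> \<alpha> + s * u \<alpha>) = ?obj \<theta>
      + (2 * s * (- (\<Sum>\<alpha>\<in>?I. u \<alpha> * res \<theta> \<alpha>)) + s\<^sup>2 * (M * bform ?I (lp_matrix K h m x y) u u))" for \<theta> s u
    using lp_objective_add[of l K h m x Z y \<theta> s u]
    unfolding \<psi>_def[symmetric] k_def[symmetric] lin quad .
  obtain \<theta>0 where \<theta>0: "\<And>\<alpha>. \<alpha> \<in> ?I \<Longrightarrow> (\<Sum>\<gamma>\<in>?I. lp_matrix K h m x y \<alpha> \<gamma> * \<theta>0 \<gamma>) = c \<alpha>"
    by (rule positive_definite_solvable[OF finite_multi_indices sym \<mu>, of c]) blast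
  \<comment> \<open>Existence of a minimiser has to come first, as \<open>arg_min\<close> is
    otherwise unspecified. At a solution of the normal equations only the quadratic term remains,
    and it is nonnegative. Restriction provides the extensional representative.\<close>
  have "?obj (restrict \<theta>0 ?I) \<le> ?obj \<theta>" for \<theta>
  proof -
    have "0 \<le> \<mu> * (\<Sum>\<alpha>\<in>?I. (\<theta> \<alpha> - \<theta>0 \<alpha>)\<^sup>2)"
      using \<mu>(1) by (intro mult_nonneg_nonneg sum_nonneg) auto
    also note \<mu>(2)
    finally have "0 \<le> bform ?I (lp_matrix K h m x y) (\<lambda>\<alpha>. \<theta> \<alpha> - \<theta>0 \<alpha>) (\<lambda>\<alpha>. \<theta> \<alpha> - \<theta>0 \<alpha>)" .
    moreover have "(\<Sum>\<alpha>\<in>?I. (\<theta> \<alpha> - \<theta>0 \<alpha>) * res \<theta>0 \<alpha>) = 0"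
      by (intro sum.neutral) (simp add: res \<theta>0)
    moreover have "?obj (restrict \<theta>0 ?I) = ?obj \<theta>0"
      by (rule lp_objective_cong) simp
    ultimately show ?thesis
      using obj[of \<theta>0 1 "\<lambda>\<alpha>. \<theta> \<alpha> - \<theta>0 \<alpha>"] \<open>M > 0\<close> by simp
  qed
  then have "is_arg_min ?obj (\<lambda>\<theta>. \<theta> \<in> ?I \<rightarrow>\<^sub>E UNIV) (restrict \<theta>0 ?I)"
    unfolding is_arg_min_def by (auto simp: not_less)
  then have arg: "is_arg_min ?obj (\<lambda>\<theta>. \<theta> \<in> ?I \<rightarrow>\<^sub>E UNIV) (lp_coeffs l K h m x Z y)"
    unfolding lp_coeffs_def arg_min_def
    by (rule someI[where P = "is_arg_min _ _"])
  have min: "?obj (lp_coeffs l K h m x Z y) \<le> ?obj \<theta>" for \<theta>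
  proof -
    have "restrict \<theta> ?I \<in> ?I \<rightarrow>\<^sub>E UNIV" by auto
    with arg have "?obj (lp_coeffs l K h m x Z y) \<le> ?obj (restrict \<theta> ?I)"
      unfolding is_arg_min_def by (meson not_less)
    also have "\<dots> = ?obj \<theta>" by (rule lp_objective_cong) simp
    finally show ?thesis .
  qed
  \<comment> \<open>Whichever minimiser \<open>arg_min\<close> returns is stationary in coordinate
    \<open>\<gamma>\<close>.\<close>
  define u where "u \<alpha> = (if \<alpha> = \<gamma> then 1 else 0 :: real)" for \<alpha>
  have "0 \<le> 2 * s * (- (\<Sum>\<alpha>\<in>?I. u \<alpha> * res (lp_coeffs l K h m x Z y) \<alpha>))
      + s\<^sup>2 * (M * bform ?I (lp_matrix K h m x y) u u)" for s
    using min[of "\<lambda>\<alpha>. lp_coeffs l K h m x Z y \<alpha> + s * u \<alpha>"] unfolding obj by simp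
  then have "- (\<Sum>\<alpha>\<in>?I. u \<alpha> * res (lp_coeffs l K h m x Z y) \<alpha>) = 0"
    by (rule linear_term_eq_0)
  moreover have "(\<Sum>\<alpha>\<in>?I. u \<alpha> * res (lp_coeffs l K h m x Z y) \<alpha>) = res (lp_coeffs l K h m x Z y) \<gamma>"
    using \<gamma> by (simp add: finite_multi_indices u_def if_distrib[of "\<lambda>x. x * _"] cong: if_cong)
  ultimately have "res (lp_coeffs l K h m x Z y) \<gamma> = 0" by simp
  then have "(\<Sum>\<alpha>\<in>?I. lp_matrix K h m x y \<gamma> \<alpha> * lp_coeffs l K h m x Z y \<alpha>) = c \<gamma>"
    unfolding res using \<open>M > 0\<close> by simp
  then show ?thesis
    unfolding c_def \<psi>_def k_def M_def .
qed

text \<open>Instead of inverting the matrix \<open>B\<close>, a vector \<open>w\<close> with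
  \<open>B w = \<psi>(0)\<close> is fixed. By symmetry of \<open>B\<close>, pairing
  \<open>\<psi>(0)\<close> with the coefficients equals pairing \<open>w\<close> with the right-hand
  side of the normal equations, which is linear in the data. The moments of the weights are the
  entries of \<open>B w\<close>.\<close>

lemma lp_weights_exist:
  fixes x :: "nat \<Rightarrow> real ^ 'd"
  assumes "m > 0" "h > 0" and y: "y \<in> cbox 0 1"
    and eig: "eigenvalue_condition l K C h m x" and ker: "kernel_condition C' K"
  shows "\<exists>W. (\<forall>Z. lp_estimate l K h m x Z y = (\<Sum>j=1..m. W j * Z j)) \<and>
    (\<forall>\<alpha>\<in>multi_indices l.
      (\<Sum>j=1..m. W j * (\<Prod>i\<in>UNIV. (x j - y) $ i ^ \<alpha> i)) = (if \<alpha> = (\<lambda>_. 0) then 1 else 0)) \<and>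
    (\<forall>j. norm (x j - y) > h \<longrightarrow> W j = 0) \<and>
    (\<forall>j. \<bar>W j\<bar> \<le> real (card (multi_indices l :: ('d \<Rightarrow> nat) set)) * C * C' / (real m * h ^ CARD('d)))"
proof -
  let ?I = "multi_indices l :: ('d \<Rightarrow> nat) set"
  let ?B = "lp_matrix K h m x y"
  define \<mu> where "\<mu> = min_eigenvalue ?I ?B"
  have \<mu>: "\<mu> > 0" "inverse \<mu> \<le> C" using eig y by (auto simp: eigenvalue_condition_def \<mu>_def)
  have fin: "finite ?I" by (rule finite_multi_indices)
  have sym: "?B \<alpha> \<gamma> = ?B \<gamma> \<alpha>" for \<alpha> \<gamma> by (simp add: lp_matrix_def mult_ac)
  have pos: "\<mu> * (\<Sum>\<alpha>\<in>?I. (v \<alpha>)\<^sup>2) \<le> bform ?I ?B v v" for v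
    unfolding \<mu>_def using zero_in_multi_indices by (intro min_eigenvalue_le_bform fin sym) auto
  define \<psi> where "\<psi> j \<alpha> = monomial_basis ((x j - y) /\<^sub>R h) \<alpha>" for j and \<alpha> :: "'d \<Rightarrow> nat"
  define k where "k j = K (norm (x j - y) / h)" for j
  define M where "M = real m * h ^ CARD('d)"
  have "M > 0" using assms by (simp add: M_def)
  have A: "?B \<alpha> \<gamma> = 1 / M * (\<Sum>j=1..m. \<psi> j \<alpha> * \<psi> j \<gamma> * k j)" for \<alpha> \<gamma>
    by (simp add: lp_matrix_def \<psi>_def k_def M_def)
  obtain w where w: "\<And>\<alpha>. \<alpha> \<in> ?I \<Longrightarrow> (\<Sum>\<gamma>\<in>?I. ?B \<alpha> \<gamma> * w \<gamma>) = monomial_basis 0 \<alpha>"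
    by (rule positive_definite_solvable[OF fin sym \<mu>(1) pos, of "monomial_basis 0"]) blast
  define W where "W j = 1 / M * ((\<Sum>\<gamma>\<in>?I. w \<gamma> * \<psi> j \<gamma>) * k j)" for j
  \<comment> \<open>Since \<open>\<psi>(0)\<close> is a unit coordinate vector, the form at
    \<open>w\<close> equals the entry \<open>w (\<lambda>_. 0)\<close>. Hence
    \<open>\<mu> * (w \<alpha>)^2\<close> is at most this entry, which bounds the entry itself by
    \<open>1 / \<mu>\<close> and through it all the others.\<close>
  have w_le: "\<bar>w \<gamma>\<bar> \<le> C" if "\<gamma> \<in> ?I" for \<gamma>
  proof -
    have "bform ?I ?B w w = (\<Sum>\<alpha>\<in>?I. w \<alpha> * monomial_basis 0 \<alpha>)"
      unfolding bform_def using w by (intro sum.cong) auto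
    also have "\<dots> = w (\<lambda>_. 0)"
      using fin by (simp add: zero_in_multi_indices monomial_basis_0 if_distrib[of "\<lambda>x. _ * x"] cong: if_cong)
    finally have bw: "bform ?I ?B w w = w (\<lambda>_. 0)" .
    have *: "\<mu> * (w \<alpha>)\<^sup>2 \<le> w (\<lambda>_. 0)" if "\<alpha> \<in> ?I" for \<alpha>
    proof -
      have "\<mu> * (w \<alpha>)\<^sup>2 \<le> \<mu> * (\<Sum>\<alpha>\<in>?I. (w \<alpha>)\<^sup>2)"
        using \<mu> that fin by (intro mult_left_mono member_le_sum) auto
      with pos[of w] bw show ?thesis by simp
    qed
    have w0: "w (\<lambda>_. 0) \<ge> 0" using *[OF that] \<mu>(1) by (meson mult_nonneg_nonneg less_imp_le order_trans zero_le_power2)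
    have "\<mu> * w (\<lambda>_. 0) \<le> 1"
    proof (cases "w (\<lambda>_. 0) = 0")
      case False
      with *[OF zero_in_multi_indices] w0 show ?thesis
        by (simp add: power2_eq_square mult_le_cancel_right1 flip: mult.assoc)
    qed simp
    moreover have "(\<mu> * w \<gamma>)\<^sup>2 = \<mu> * (\<mu> * (w \<gamma>)\<^sup>2)"
      by (simp add: power2_eq_square)
    moreover have "\<dots> \<le> \<mu> * w (\<lambda>_. 0)"
      using *[OF that] \<mu>(1) by (intro mult_left_mono) auto
    ultimately have "(\<mu> * w \<gamma>)\<^sup>2 \<le> 1" by linarith
    then have "\<bar>\<mu> * w \<gamma>\<bar> \<le> 1" by (simp add: abs_square_le_1)
    then have "\<bar>w \<gamma>\<bar> \<le> inverse \<mu>" using \<mu> by (simp add: abs_mult field_simps)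
    with \<mu> show ?thesis by simp
  qed
  have "C \<ge> 0" using \<mu> by (meson inverse_nonnegative_iff_nonnegative less_imp_le order_trans)
  have k_le: "\<bar>k j\<bar> \<le> C'" for j
    using ker \<open>h > 0\<close> by (simp add: kernel_condition_def k_def)
  have "C' \<ge> 0" using k_le[of 0] by simp
  have k_0: "k j = 0" if "norm (x j - y) > h" for j
  proof (rule ccontr)
    assume "k j \<noteq> 0"
    then have "norm (x j - y) / h \<in> closure {z. z \<ge> 0 \<and> K z \<noteq> 0}"
      using \<open>h > 0\<close> by (intro subsetD[OF closure_subset]) (simp add: k_def)
    with ker have "norm (x j - y) / h \<le> 1" by (auto simp: kernel_condition_def)
    with that \<open>h > 0\<close> show False by (simp add: field_simps)
  qed
  show ?thesis
  proof (intro exI[of _ W] conjI allI ballI impI)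
    fix Z
    let ?\<theta> = "lp_coeffs l K h m x Z y"
    have "lp_estimate l K h m x Z y = (\<Sum>\<alpha>\<in>?I. \<Sum>\<gamma>\<in>?I. ?B \<alpha> \<gamma> * w \<gamma> * ?\<theta> \<alpha>)"
      unfolding lp_estimate_def using w by (intro sum.cong) (auto simp: sum_distrib_right[symmetric])
    also have "\<dots> = (\<Sum>\<gamma>\<in>?I. \<Sum>\<alpha>\<in>?I. w \<gamma> * (?B \<gamma> \<alpha> * ?\<theta> \<alpha>))"
      by (subst sum.swap) (simp add: sym mult_ac)
    also have "\<dots> = (\<Sum>\<gamma>\<in>?I. w \<gamma> * (1 / M * (\<Sum>j=1..m. Z j * \<psi> j \<gamma> * k j)))"
      unfolding sum_distrib_left[symmetric]
      using lp_coeffs_normal_equations[OF assms(1,2) \<mu>(1) pos]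
      by (intro sum.cong) (auto simp: M_def \<psi>_def k_def)
    also have "\<dots> = (\<Sum>\<gamma>\<in>?I. \<Sum>j=1..m. 1 / M * (w \<gamma> * \<psi> j \<gamma> * k j) * Z j)"
      by (simp add: sum_distrib_left mult_ac)
    also have "\<dots> = (\<Sum>j=1..m. \<Sum>\<gamma>\<in>?I. 1 / M * (w \<gamma> * \<psi> j \<gamma> * k j) * Z j)"
      by (rule sum.swap)
    also have "\<dots> = (\<Sum>j=1..m. W j * Z j)"
      by (simp add: W_def sum_distrib_left sum_distrib_right)
    finally show "lp_estimate l K h m x Z y = (\<Sum>j=1..m. W j * Z j)" .
  next
    fix \<alpha> :: "'d \<Rightarrow> nat" assume \<alpha>: "\<alpha> \<in> ?I"
    define s where "s = (\<Sum>i\<in>UNIV. \<alpha> i)"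
    define F where "F = (\<Prod>i\<in>UNIV. fact (\<alpha> i) :: real)"
    have "F > 0" unfolding F_def by (intro prod_pos) auto
    \<comment> \<open>The factor between plain and normalised monomials is 1 at index 0, and the
      moments at all other indices vanish, so rescaling does not change the moments.\<close>
    have \<psi>: "(\<Prod>i\<in>UNIV. (x j - y) $ i ^ \<alpha> i) = h ^ s * F * \<psi> j \<alpha>" for j
    proof -
      have "(\<Prod>i\<in>UNIV. ((x j - y) /\<^sub>R h) $ i ^ \<alpha> i) = (\<Prod>i\<in>UNIV. (x j - y) $ i ^ \<alpha> i) / h ^ s"
        by (simp add: s_def power_sum power_mult_distrib prod.distrib prod_inversef[unfolded o_def]
          power_inverse divide_inverse mult.commute)
      then show ?thesis
        using \<open>h > 0\<close> \<open>F > 0\<close> by (simp add: \<psi>_def monomial_basis_def F_def[symmetric])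
    qed
    have "(\<Sum>j=1..m. W j * \<psi> j \<alpha>) = (\<Sum>j=1..m. \<Sum>\<gamma>\<in>?I. 1 / M * (\<psi> j \<alpha> * \<psi> j \<gamma> * k j) * w \<gamma>)"
      by (simp add: W_def sum_distrib_left sum_distrib_right mult_ac)
    also have "\<dots> = (\<Sum>\<gamma>\<in>?I. \<Sum>j=1..m. 1 / M * (\<psi> j \<alpha> * \<psi> j \<gamma> * k j) * w \<gamma>)"
      by (rule sum.swap)
    also have "\<dots> = (\<Sum>\<gamma>\<in>?I. ?B \<alpha> \<gamma> * w \<gamma>)"
      by (simp add: A sum_distrib_left sum_distrib_right)
    also have "\<dots> = monomial_basis 0 \<alpha>" by (rule w[OF \<alpha>])
    finally have eq: "(\<Sum>j=1..m. W j * \<psi> j \<alpha>) = monomial_basis 0 \<alpha>" .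
    have "(\<Sum>j=1..m. W j * (\<Prod>i\<in>UNIV. (x j - y) $ i ^ \<alpha> i)) = h ^ s * F * monomial_basis 0 \<alpha>"
      unfolding \<psi> by (simp add: sum_distrib_left mult.left_commute flip: eq)
    then show "(\<Sum>j=1..m. W j * (\<Prod>i\<in>UNIV. (x j - y) $ i ^ \<alpha> i)) = (if \<alpha> = (\<lambda>_. 0) then 1 else 0)"
      by (simp add: monomial_basis_0 s_def F_def)
  next
    show "W j = 0" if "norm (x j - y) > h" for j
      using k_0[OF that] by (simp add: W_def)
  next
    fix j
    show "\<bar>W j\<bar> \<le> real (card ?I) * C * C' / (real m * h ^ CARD('d))"
    proof (cases "norm (x j - y) > h")
      case True
      then show ?thesis
        using k_0[OF True] \<open>C \<ge> 0\<close> \<open>C' \<ge> 0\<close> \<open>h > 0\<close> by (simp add: W_def)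
    next
      case False
      have "\<bar>\<Sum>\<gamma>\<in>?I. w \<gamma> * \<psi> j \<gamma>\<bar> \<le> (\<Sum>\<gamma>\<in>?I. C * 1)"
      proof (intro sum_norm_le[where 'a = real, unfolded real_norm_def])
        fix \<gamma> assume \<gamma>: "\<gamma> \<in> ?I"
        have "norm ((x j - y) /\<^sub>R h) = norm (x j - y) / h"
          using \<open>h > 0\<close> by (simp add: divide_inverse mult.commute)
        then have "norm ((x j - y) /\<^sub>R h) \<le> 1"
          using False \<open>h > 0\<close> by simp
        from mult_mono[OF w_le[OF \<gamma>] abs_monomial_basis_le_1[OF this]]
        show "\<bar>w \<gamma> * \<psi> j \<gamma>\<bar> \<le> C * 1"
          unfolding abs_mult \<psi>_def using \<open>C \<ge> 0\<close> by simp
      qed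
      then have "\<bar>(\<Sum>\<gamma>\<in>?I. w \<gamma> * \<psi> j \<gamma>) * k j\<bar> \<le> (real (card ?I) * C) * C'"
        unfolding abs_mult using k_le \<open>C \<ge> 0\<close> by (intro mult_mono) auto
      then have "\<bar>W j\<bar> \<le> (real (card ?I) * C) * C' / M"
        using \<open>M > 0\<close> by (simp add: W_def abs_mult divide_right_mono)
      then show ?thesis by (simp add: M_def)
    qed
  qed
qed

subsection \<open>Second moment of the noise\<close>

text \<open>The offset \<open>b\<close> is included so that a single identity gives the
  bias-variance decomposition; the cross terms vanish by independence and centring.\<close>

lemma (in prob_space) second_moment_indep_sum:
  fixes X :: "'i \<Rightarrow> 'a \<Rightarrow> real"
  assumes J: "finite J" and indep: "indep_vars (\<lambda>_. borel) X J"
    and sq: "\<And>j. j \<in> J \<Longrightarrow> integrable M (\<lambda>\<omega>. (X j \<omega>)\<^sup>2)"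
    and mean: "\<And>j. j \<in> J \<Longrightarrow> expectation (X j) = 0"
  shows "integrable M (\<lambda>\<omega>. (b + (\<Sum>j\<in>J. V j * X j \<omega>))\<^sup>2)"
    and "expectation (\<lambda>\<omega>. (b + (\<Sum>j\<in>J. V j * X j \<omega>))\<^sup>2)
           = b\<^sup>2 + (\<Sum>j\<in>J. (V j)\<^sup>2 * expectation (\<lambda>\<omega>. (X j \<omega>)\<^sup>2))"
proof -
  have meas: "X j \<in> borel_measurable M" if "j \<in> J" for j
    using indep that unfolding indep_vars_def2 by simp
  have int: "integrable M (X j)" if "j \<in> J" for j
    using square_integrable_imp_integrable[OF meas sq] that by simp
  have cross: "integrable M (\<lambda>\<omega>. X i \<omega> * X j \<omega>) \<and>
      expectation (\<lambda>\<omega>. X i \<omega> * X j \<omega>) = (if i = j then expectation (\<lambda>\<omega>. (X j \<omega>)\<^sup>2) else 0)"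
    if ij: "i \<in> J" "j \<in> J" for i j
  proof (cases "i = j")
    case True
    then show ?thesis using sq ij by (simp add: power2_eq_square)
  next
    case False
    have "indep_vars (\<lambda>_. borel) X {i, j}"
      using ij by (intro indep_vars_subset[OF indep]) auto
    from indep_vars_integrable[OF _ this] indep_vars_lebesgue_integral[OF _ this]
    show ?thesis using False ij int mean by auto
  qed
  have eq: "(b + (\<Sum>j\<in>J. V j * X j \<omega>))\<^sup>2 =
      b\<^sup>2 + ((\<Sum>j\<in>J. 2 * b * V j * X j \<omega>) + (\<Sum>i\<in>J. \<Sum>j\<in>J. V i * V j * (X i \<omega> * X j \<omega>)))" for \<omega>
    by (simp add: power2_sum power2_eq_square[of "sum _ _"] sum_product sum_distrib_left mult_ac)
  show "integrable M (\<lambda>\<omega>. (b + (\<Sum>j\<in>J. V j * X j \<omega>))\<^sup>2)"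
    unfolding eq using cross int
    by (intro Bochner_Integration.integrable_add Bochner_Integration.integrable_sum integrable_mult_right) auto
  have "expectation (\<lambda>\<omega>. (b + (\<Sum>j\<in>J. V j * X j \<omega>))\<^sup>2) =
      b\<^sup>2 + ((\<Sum>j\<in>J. 2 * b * V j * expectation (X j)) +
        (\<Sum>i\<in>J. \<Sum>j\<in>J. V i * V j * expectation (\<lambda>\<omega>. X i \<omega> * X j \<omega>)))"
    unfolding eq using cross int
    by (simp add: Bochner_Integration.integral_add Bochner_Integration.integral_sum
        Bochner_Integration.integrable_sum prob_space)
  also have "(\<Sum>j\<in>J. 2 * b * V j * expectation (X j)) = 0"
    using mean by simp
  also have "(\<Sum>i\<in>J. \<Sum>j\<in>J. V i * V j * expectation (\<lambda>\<omega>. X i \<omega> * X j \<omega>))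
      = (\<Sum>i\<in>J. \<Sum>j\<in>J. if i = j then (V j)\<^sup>2 * expectation (\<lambda>\<omega>. (X j \<omega>)\<^sup>2) else 0)"
    using cross by (intro sum.cong) (auto simp: power2_eq_square[of "V _"])
  also have "\<dots> = (\<Sum>j\<in>J. (V j)\<^sup>2 * expectation (\<lambda>\<omega>. (X j \<omega>)\<^sup>2))"
    using J by simp
  finally show "expectation (\<lambda>\<omega>. (b + (\<Sum>j\<in>J. V j * X j \<omega>))\<^sup>2)
      = b\<^sup>2 + (\<Sum>j\<in>J. (V j)\<^sup>2 * expectation (\<lambda>\<omega>. (X j \<omega>)\<^sup>2))"
    by simp
qed

lemma power2_norm_vec: "(norm (v :: real ^ 'd))\<^sup>2 = (\<Sum>c\<in>UNIV. (v $ c)\<^sup>2)"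
  by (simp add: norm_vec_def L2_set_def sum_nonneg)

text \<open>The squared norm is a sum over components, so correlations between components of the
  same noise vector never enter. Independence across \<open>j\<close> is inherited by each
  component.\<close>

lemma (in prob_space) second_moment_indep_sum_vec:
  fixes X :: "'i \<Rightarrow> 'a \<Rightarrow> real ^ 'd"
  assumes J: "finite J" and indep: "indep_vars (\<lambda>_. borel) X J"
    and sq: "\<And>j. j \<in> J \<Longrightarrow> integrable M (\<lambda>\<omega>. (norm (X j \<omega>))\<^sup>2)"
    and mean: "\<And>j. j \<in> J \<Longrightarrow> expectation (X j) = 0"
  shows "integrable M (\<lambda>\<omega>. (norm (b + (\<Sum>j\<in>J. V j *\<^sub>R X j \<omega>)))\<^sup>2)"
    and "expectation (\<lambda>\<omega>. (norm (b + (\<Sum>j\<in>J. V j *\<^sub>R X j \<omega>)))\<^sup>2)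
           = (norm b)\<^sup>2 + (\<Sum>j\<in>J. (V j)\<^sup>2 * expectation (\<lambda>\<omega>. (norm (X j \<omega>))\<^sup>2))"
proof -
  have meas: "X j \<in> borel_measurable M" if "j \<in> J" for j
    using indep that unfolding indep_vars_def2 by simp
  have meas_c: "(\<lambda>\<omega>. X j \<omega> $ c) \<in> borel_measurable M" if "j \<in> J" for j c
    using borel_measurable_continuous_on[OF _ meas[OF that], of "\<lambda>v. v $ c"]
    by (simp add: linear_continuous_on bounded_linear_vec_nth)
  have int: "integrable M (X j)" if "j \<in> J" for j
  proof -
    have "integrable M (\<lambda>\<omega>. norm (X j \<omega>))"
      using square_integrable_imp_integrable[OF _ sq[OF that]] meas[OF that] by simp
    then show ?thesis using integrable_norm_iff[OF meas[OF that]] by simp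
  qed
  have indep_c: "indep_vars (\<lambda>_. borel) (\<lambda>j \<omega>. X j \<omega> $ c) J" for c
    using indep_vars_compose2[OF indep, of "\<lambda>_ v. v $ c" "\<lambda>_. borel"]
    by (simp add: borel_measurable_continuous_onI linear_continuous_on bounded_linear_vec_nth)
  have sq_c: "integrable M (\<lambda>\<omega>. (X j \<omega> $ c)\<^sup>2)" if "j \<in> J" for j c
  proof (rule Bochner_Integration.integrable_bound[OF sq[OF that]])
    show "AE \<omega> in M. norm ((X j \<omega> $ c)\<^sup>2) \<le> norm ((norm (X j \<omega>))\<^sup>2)"
      using component_le_norm_cart by (auto intro!: AE_I2 simp: abs_le_square_iff[symmetric])
  qed (use meas_c[OF that] in simp)
  have mean_c: "expectation (\<lambda>\<omega>. X j \<omega> $ c) = 0" if "j \<in> J" for j c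
    using integral_bounded_linear[OF bounded_linear_vec_nth int[OF that], of c] mean[OF that] by simp
  note s = second_moment_indep_sum[OF J indep_c sq_c mean_c]
  have eq: "(norm (b + (\<Sum>j\<in>J. V j *\<^sub>R X j \<omega>)))\<^sup>2 = (\<Sum>c\<in>UNIV. (b $ c + (\<Sum>j\<in>J. V j * X j \<omega> $ c))\<^sup>2)" for \<omega>
    by (simp add: power2_norm_vec)
  show "integrable M (\<lambda>\<omega>. (norm (b + (\<Sum>j\<in>J. V j *\<^sub>R X j \<omega>)))\<^sup>2)"
    unfolding eq by (intro Bochner_Integration.integrable_sum s)
  have "expectation (\<lambda>\<omega>. (norm (b + (\<Sum>j\<in>J. V j *\<^sub>R X j \<omega>)))\<^sup>2) =
      (\<Sum>c\<in>UNIV. (b $ c)\<^sup>2 + (\<Sum>j\<in>J. (V j)\<^sup>2 * expectation (\<lambda>\<omega>. (X j \<omega> $ c)\<^sup>2)))"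
    unfolding eq by (subst Bochner_Integration.integral_sum) (simp_all add: s)
  also have "\<dots> = (norm b)\<^sup>2 + (\<Sum>j\<in>J. (V j)\<^sup>2 * (\<Sum>c\<in>UNIV. expectation (\<lambda>\<omega>. (X j \<omega> $ c)\<^sup>2)))"
    unfolding sum.distrib power2_norm_vec sum_distrib_left by (subst sum.swap) simp
  also have "\<dots> = (norm b)\<^sup>2 + (\<Sum>j\<in>J. (V j)\<^sup>2 * expectation (\<lambda>\<omega>. (norm (X j \<omega>))\<^sup>2))"
    by (simp add: power2_norm_vec Bochner_Integration.integral_sum sq_c cong: sum.cong)
  finally show "expectation (\<lambda>\<omega>. (norm (b + (\<Sum>j\<in>J. V j *\<^sub>R X j \<omega>)))\<^sup>2)
      = (norm b)\<^sup>2 + (\<Sum>j\<in>J. (V j)\<^sup>2 * expectation (\<lambda>\<omega>. (norm (X j \<omega>))\<^sup>2))" .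
qed

subsection \<open>Bias and variance\<close>

text \<open>On a monomial the double sum factors into a time moment of order \<open>e + 1\<close>
  and a spatial moment of index \<open>\<alpha>\<close>. Total degree below \<open>\<beta>\<close>
  puts both in their exactness ranges, at most \<open>\<beta>\<close> in time and
  \<open>\<beta> - 1\<close> in space, and only the constant survives both.\<close>

lemma weights_homogeneous:
  fixes z :: "nat \<Rightarrow> real ^ 'd"
  assumes mom: "\<And>\<alpha>. \<alpha> \<in> multi_indices (\<beta> - 1) \<Longrightarrow>
      (\<Sum>j=1..m. W j * (\<Prod>i\<in>UNIV. z j $ i ^ \<alpha> i)) = (if \<alpha> = (\<lambda>_. 0) then 1 else 0)"
    and "\<Delta> > 0" and "homogeneous k q" "k < \<beta>"
  shows "(\<Sum>i=1..\<beta>. deriv_weight \<beta> i / \<Delta> * (\<Sum>j=1..m. W j * (real i * \<Delta> * q (z j) (real i * \<Delta>)))) = q 0 0"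
  using assms(3,4)
proof (induction rule: homogeneous.induct)
  case (monomial \<alpha> e k c)
  define g where "g i = deriv_weight \<beta> i / \<Delta>" for i
  define \<tau> where "\<tau> i = real i * \<Delta>" for i
  define P where "P z = (\<Prod>i\<in>UNIV. z $ i ^ \<alpha> i)" for z :: "real ^ 'd"
  have inner: "(\<Sum>j=1..m. W j * (\<tau> i * (c * P (z j) * \<tau> i ^ e))) = c * \<tau> i ^ Suc e * (\<Sum>j=1..m. W j * P (z j))" for i
    unfolding sum_distrib_left by (intro sum.cong) (auto simp: mult_ac)
  have "(\<Sum>i=1..\<beta>. g i * (\<Sum>j=1..m. W j * (\<tau> i * (c * P (z j) * \<tau> i ^ e))))
    = c * (\<Sum>i=1..\<beta>. g i * \<tau> i ^ Suc e) * (\<Sum>j=1..m. W j * P (z j))"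
    unfolding inner sum_distrib_left[of c] sum_distrib_right by (intro sum.cong) (auto simp: mult_ac)
  \<comment> \<open>The node at time 0 may be added because the exponent is positive; the moment
    formula runs over all \<open>\<beta> + 1\<close> nodes.\<close>
  also have "(\<Sum>i=1..\<beta>. g i * \<tau> i ^ Suc e) = (\<Sum>i\<le>\<beta>. g i * \<tau> i ^ Suc e)"
    by (rule sum.mono_neutral_left) (auto simp: not_le \<tau>_def)
  also have "\<dots> = (if Suc e = 1 then 1 else 0)"
    unfolding g_def \<tau>_def using \<open>\<Delta> > 0\<close> monomial by (intro deriv_weight_moment) auto
  also have "(\<Sum>j=1..m. W j * P (z j)) = (if \<alpha> = (\<lambda>_. 0) then 1 else 0)"
    unfolding P_def using monomial by (intro mom) (auto simp: multi_indices_def)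
  finally have eq: "(\<Sum>i=1..\<beta>. g i * (\<Sum>j=1..m. W j * (\<tau> i * (c * P (z j) * \<tau> i ^ e))))
    = c * (if Suc e = 1 then 1 else 0) * (if \<alpha> = (\<lambda>_. 0) then 1 else 0)" .
  have "P 0 = (if \<alpha> = (\<lambda>_. 0) then 1 else 0)"
  proof (cases "\<alpha> = (\<lambda>_. 0)")
    case False
    then obtain i where "\<alpha> i \<noteq> 0" by auto
    then have "P 0 = 0"
      unfolding P_def by (intro prod_zero) (auto intro!: exI[of _ i])
    with False show ?thesis by simp
  qed (simp add: P_def)
  with eq have "(\<Sum>i=1..\<beta>. g i * (\<Sum>j=1..m. W j * (\<tau> i * (c * P (z j) * \<tau> i ^ e)))) = c * P 0 * 0 ^ e"
    by (cases e) auto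
  then show ?case by (simp only: g_def \<tau>_def P_def)
next
  case (add k p q)
  then show ?case
    by (simp add: distrib_left sum.distrib)
qed

lemma field_estimate_linear:
  fixes Y :: "nat \<Rightarrow> nat \<Rightarrow> real ^ 'd"
  assumes "\<Delta> > 0"
    and W: "\<And>Z. lp_estimate (\<beta> - 1) K h m x Z y = (\<Sum>j=1..m. W j * Z j)"
  shows "field_estimate \<beta> K h m x \<Delta> Y y =
    (\<Sum>i=1..\<beta>. \<Sum>j=1..m. (deriv_weight \<beta> i / \<Delta> * W j) *\<^sub>R (Y j i - x j))"
proof -
  have "field_estimate \<beta> K h m x \<Delta> Y y $ c =
      (\<Sum>i=1..\<beta>. \<Sum>j=1..m. (deriv_weight \<beta> i / \<Delta> * W j) *\<^sub>R (Y j i - x j)) $ c" for c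
  proof -
    have "field_estimate \<beta> K h m x \<Delta> Y y $ c
        = (\<Sum>i\<le>\<beta>. deriv_weight \<beta> i / \<Delta> * increment_estimate \<beta> K h m x Y i y $ c)"
      using \<open>\<Delta> > 0\<close> by (simp add: field_estimate_def deriv_interpolation_poly)
    also have "\<dots> = (\<Sum>i=1..\<beta>. deriv_weight \<beta> i / \<Delta> * increment_estimate \<beta> K h m x Y i y $ c)"
      \<comment> \<open>The value at time 0 is the constant 0 rather than an estimate, so it carries
        neither bias nor noise.\<close>
      by (rule sum.mono_neutral_right) (auto simp: increment_estimate_def not_le)
    also have "\<dots> = (\<Sum>i=1..\<beta>. deriv_weight \<beta> i / \<Delta> * (\<Sum>j=1..m. W j * (Y j i - x j) $ c))"
      using W by (intro sum.cong) (simp_all add: increment_estimate_def lp_estimate_vec_def)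
    finally show ?thesis
      by (simp add: sum_distrib_left mult_ac)
  qed
  then show ?thesis by (simp add: vec_eq_iff)
qed

text \<open>The polynomial part yields \<open>q 0 0 0\<close> exactly. The remainder at time
  \<open>i * \<Delta>\<close> is proportional to that time, which cancels
  \<open>1 / \<Delta>\<close> and leaves the factor \<open>i\<close> beside the differentiation
  weights; the spatial weights contribute their absolute sum. The extra 1 accounts for
  \<open>q 0 0 0\<close> differing from the field.\<close>

lemma weights_bias:
  fixes x :: "nat \<Rightarrow> real ^ 'd"
  assumes mom: "\<And>\<alpha>. \<alpha> \<in> multi_indices (\<beta> - 1) \<Longrightarrow>
      (\<Sum>j=1..m. W j * (\<Prod>i\<in>UNIV. (x j - y) $ i ^ \<alpha> i)) = (if \<alpha> = (\<lambda>_. 0) then 1 else 0)"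
    and "\<beta> \<ge> 1" "\<Delta> > 0" "real \<beta> * \<Delta> \<le> \<rho>"
    and loc: "\<And>j. j \<in> {1..m} \<Longrightarrow> W j \<noteq> 0 \<Longrightarrow> norm (x j - y) \<le> \<rho>"
    and S: "(\<Sum>j=1..m. \<bar>W j\<bar>) \<le> S" and "C \<ge> 0"
    and q: "\<forall>k<\<beta>. homogeneous k (q k)"
    and exp: "\<forall>z t. (z, t) \<in> cyl \<rho> \<longrightarrow>
      \<bar>flow f (y + z) t $ c - (y + z) $ c - (\<Sum>k<\<beta>. t * q k z t)\<bar> \<le> C * \<rho> ^ \<beta> * t"
    and q0: "\<bar>q 0 0 0 - f y $ c\<bar> \<le> C * \<rho> ^ \<beta>"
  shows "\<bar>((\<Sum>i=1..\<beta>. \<Sum>j=1..m. (deriv_weight \<beta> i / \<Delta> * W j) *\<^sub>R (flow f (x j) (real i * \<Delta>) - x j)) - f y) $ c\<bar>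
    \<le> ((\<Sum>i=1..\<beta>. \<bar>deriv_weight \<beta> i\<bar> * real i) * S + 1) * C * \<rho> ^ \<beta>"
proof -
  have "\<rho> \<ge> 0" using assms(3,4) by (meson less_imp_le mult_nonneg_nonneg of_nat_0_le_iff order_trans)
  define r where "r i j = flow f (x j) (real i * \<Delta>) $ c - x j $ c
    - (\<Sum>k<\<beta>. real i * \<Delta> * q k (x j - y) (real i * \<Delta>))" for i j
  have r: "\<bar>W j * r i j\<bar> \<le> \<bar>W j\<bar> * (C * \<rho> ^ \<beta> * (real i * \<Delta>))" if "i \<in> {1..\<beta>}" "j \<in> {1..m}" for i j
  proof (cases "W j = 0")
    case False
    have "real i * \<Delta> \<le> real \<beta> * \<Delta>"
      using that \<open>\<Delta> > 0\<close> by (intro mult_right_mono) auto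
    then have "real i * \<Delta> \<le> \<rho>" using assms(4) by linarith
    then have "(x j - y, real i * \<Delta>) \<in> cyl \<rho>"
      using loc[OF that(2) False] assms(3) by (simp add: cyl_iff)
    from exp[rule_format, OF this] show ?thesis
      by (simp add: abs_mult r_def mult_left_mono)
  qed simp
  have main: "(\<Sum>i=1..\<beta>. deriv_weight \<beta> i / \<Delta> *
      (\<Sum>j=1..m. W j * (\<Sum>k<\<beta>. real i * \<Delta> * q k (x j - y) (real i * \<Delta>)))) = q 0 0 0"
  proof -
    have "(\<Sum>j=1..m. W j * (\<Sum>k<\<beta>. real i * \<Delta> * q k (x j - y) (real i * \<Delta>)))
        = (\<Sum>k<\<beta>. \<Sum>j=1..m. W j * (real i * \<Delta> * q k (x j - y) (real i * \<Delta>)))" for i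
      unfolding sum_distrib_left by (rule sum.swap)
    then have "(\<Sum>i=1..\<beta>. deriv_weight \<beta> i / \<Delta> *
        (\<Sum>j=1..m. W j * (\<Sum>k<\<beta>. real i * \<Delta> * q k (x j - y) (real i * \<Delta>))))
        = (\<Sum>i=1..\<beta>. \<Sum>k<\<beta>. deriv_weight \<beta> i / \<Delta> * (\<Sum>j=1..m. W j * (real i * \<Delta> * q k (x j - y) (real i * \<Delta>))))"
      by (simp only: sum_distrib_left)
    also have "\<dots> = (\<Sum>k<\<beta>. \<Sum>i=1..\<beta>. deriv_weight \<beta> i / \<Delta> * (\<Sum>j=1..m. W j * (real i * \<Delta> * q k (x j - y) (real i * \<Delta>))))"
      by (rule sum.swap)
    also have "\<dots> = (\<Sum>k<\<beta>. q k 0 0)"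
      using q by (intro sum.cong weights_homogeneous[OF mom \<open>\<Delta> > 0\<close>]) auto
    also have "\<dots> = (\<Sum>k\<in>{0}. q k 0 0)"
      using q \<open>\<beta> \<ge> 1\<close> by (intro sum.mono_neutral_right) (auto intro: homogeneous_at_0)
    finally show ?thesis by simp
  qed
  have "((\<Sum>i=1..\<beta>. \<Sum>j=1..m. (deriv_weight \<beta> i / \<Delta> * W j) *\<^sub>R (flow f (x j) (real i * \<Delta>) - x j)) - f y) $ c
      = (\<Sum>i=1..\<beta>. deriv_weight \<beta> i / \<Delta> * (\<Sum>j=1..m. W j * (flow f (x j) (real i * \<Delta>) $ c - x j $ c))) - f y $ c"
    by (simp add: sum_distrib_left mult_ac)
  also have "(\<Sum>i=1..\<beta>. deriv_weight \<beta> i / \<Delta> * (\<Sum>j=1..m. W j * (flow f (x j) (real i * \<Delta>) $ c - x j $ c)))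
      = (\<Sum>i=1..\<beta>. deriv_weight \<beta> i / \<Delta> *
      (\<Sum>j=1..m. W j * (\<Sum>k<\<beta>. real i * \<Delta> * q k (x j - y) (real i * \<Delta>)) + W j * r i j))"
    by (simp add: r_def right_diff_distrib)
  also have "\<dots> = q 0 0 0 + (\<Sum>i=1..\<beta>. deriv_weight \<beta> i / \<Delta> * (\<Sum>j=1..m. W j * r i j))"
    using main by (simp only: sum.distrib distrib_left)
  finally have eq: "((\<Sum>i=1..\<beta>. \<Sum>j=1..m. (deriv_weight \<beta> i / \<Delta> * W j) *\<^sub>R (flow f (x j) (real i * \<Delta>) - x j)) - f y) $ c
      = (q 0 0 0 - f y $ c) + (\<Sum>i=1..\<beta>. deriv_weight \<beta> i / \<Delta> * (\<Sum>j=1..m. W j * r i j))"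
    by simp
  have "\<bar>\<Sum>i=1..\<beta>. deriv_weight \<beta> i / \<Delta> * (\<Sum>j=1..m. W j * r i j)\<bar>
      \<le> (\<Sum>i=1..\<beta>. (\<bar>deriv_weight \<beta> i\<bar> * real i) * (S * (C * \<rho> ^ \<beta>)))"
  proof (intro sum_norm_le[where 'a = real, unfolded real_norm_def])
    fix i assume i: "i \<in> {1..\<beta>}"
    have "\<bar>\<Sum>j=1..m. W j * r i j\<bar> \<le> (\<Sum>j=1..m. \<bar>W j\<bar> * (C * \<rho> ^ \<beta> * (real i * \<Delta>)))"
      by (intro sum_norm_le[where 'a = real, unfolded real_norm_def] r i)
    also have "\<dots> \<le> S * (C * \<rho> ^ \<beta> * (real i * \<Delta>))"
      unfolding sum_distrib_right[symmetric]
      using S \<open>C \<ge> 0\<close> \<open>\<rho> \<ge> 0\<close> \<open>\<Delta> > 0\<close> by (intro mult_right_mono) auto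
    finally have "\<bar>deriv_weight \<beta> i / \<Delta>\<bar> * \<bar>\<Sum>j=1..m. W j * r i j\<bar>
        \<le> \<bar>deriv_weight \<beta> i / \<Delta>\<bar> * (S * (C * \<rho> ^ \<beta> * (real i * \<Delta>)))"
      by (intro mult_left_mono) auto
    also have "\<dots> = (\<bar>deriv_weight \<beta> i\<bar> * real i) * (S * (C * \<rho> ^ \<beta>))"
      using \<open>\<Delta> > 0\<close> by (simp add: abs_divide)
    finally show "\<bar>deriv_weight \<beta> i / \<Delta> * (\<Sum>j=1..m. W j * r i j)\<bar>
        \<le> (\<bar>deriv_weight \<beta> i\<bar> * real i) * (S * (C * \<rho> ^ \<beta>))"
      by (simp add: abs_mult)
  qed
  also have "\<dots> = (\<Sum>i=1..\<beta>. \<bar>deriv_weight \<beta> i\<bar> * real i) * (S * (C * \<rho> ^ \<beta>))"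
    by (rule sum_distrib_right[symmetric])
  finally show ?thesis
    unfolding eq using q0 by (simp add: algebra_simps)
qed

text \<open>At most \<open>1 + \<bar>C\<bar> * m * h^d\<close> design points carry weight. The
  isolated 1 reflects the \<open>1 / m\<close> in the cover condition and is what \<open>a\<close>
  controls. The square sum is bounded by the largest weight times the absolute sum.\<close>

lemma weights_sum_le:
  fixes x :: "nat \<Rightarrow> real ^ 'd"
  assumes "m > 0" "h > 0" "y \<in> cbox 0 1" and cover: "cover_condition C m x"
    and loc: "\<And>j. norm (x j - y) > h \<Longrightarrow> W j = 0"
    and W: "\<And>j. \<bar>W j\<bar> \<le> w / (real m * h ^ CARD('d))"
    and a: "1 / (real m * h ^ CARD('d)) \<le> a"
  shows "(\<Sum>j=1..m. \<bar>W j\<bar>) \<le> w * (a + \<bar>C\<bar>)"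
    and "(\<Sum>j=1..m. (W j)\<^sup>2) \<le> w / (real m * h ^ CARD('d)) * (w * (a + \<bar>C\<bar>))"
proof -
  define J where "J = {j\<in>{1..m}. norm (x j - y) \<le> h}"
  define u where "u = real m * h ^ CARD('d)"
  have u: "u > 0" using assms by (simp add: u_def)
  have "0 \<le> w / u" using W[of 0] by (simp add: u_def)
  then have w: "w \<ge> 0" using u by (simp add: zero_le_divide_iff)
  have "real (card J) / real m \<le> max (1 / real m) (C * h ^ CARD('d))"
    using cover assms(2,3) by (auto simp: cover_condition_def J_def)
  also have "\<dots> \<le> 1 / real m + \<bar>C\<bar> * h ^ CARD('d)"
  proof (rule max.boundedI)
    have "C * h ^ CARD('d) \<le> \<bar>C\<bar> * h ^ CARD('d)"
      using \<open>h > 0\<close> by (intro mult_right_mono) auto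
    moreover have "0 \<le> 1 / real m" by simp
    ultimately show "C * h ^ CARD('d) \<le> 1 / real m + \<bar>C\<bar> * h ^ CARD('d)" by linarith
  qed (use \<open>h > 0\<close> in simp)
  finally have card: "real (card J) \<le> 1 + \<bar>C\<bar> * u"
    using \<open>m > 0\<close> by (simp add: u_def field_simps)
  have "(\<Sum>j=1..m. \<bar>W j\<bar>) = (\<Sum>j\<in>J. \<bar>W j\<bar>)"
    by (intro sum.mono_neutral_right) (auto simp: J_def not_le intro: loc)
  also have "\<dots> \<le> (\<Sum>j\<in>J. w / u)"
    using W by (intro sum_mono) (simp add: u_def)
  also have "\<dots> \<le> (1 + \<bar>C\<bar> * u) * (w / u)"
    using card w u by (simp add: divide_right_mono mult_right_mono)
  also have "\<dots> = w * (1 / u + \<bar>C\<bar>)"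
    using u by (simp add: field_simps)
  also have "\<dots> \<le> w * (a + \<bar>C\<bar>)"
    using a w by (intro mult_left_mono) (auto simp: u_def)
  finally show sum: "(\<Sum>j=1..m. \<bar>W j\<bar>) \<le> w * (a + \<bar>C\<bar>)" .
  have "(\<Sum>j=1..m. (W j)\<^sup>2) \<le> (\<Sum>j=1..m. w / u * \<bar>W j\<bar>)"
  proof (rule sum_mono)
    fix j
    have "\<bar>W j\<bar> * \<bar>W j\<bar> \<le> w / u * \<bar>W j\<bar>"
      using W by (intro mult_right_mono) (auto simp: u_def)
    then show "(W j)\<^sup>2 \<le> w / u * \<bar>W j\<bar>" by (simp add: power2_eq_square)
  qed
  also have "\<dots> \<le> w / u * (w * (a + \<bar>C\<bar>))"
    unfolding sum_distrib_left[symmetric] using sum w u by (intro mult_left_mono) auto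
  finally show "(\<Sum>j=1..m. (W j)\<^sup>2) \<le> w / (real m * h ^ CARD('d)) * (w * (a + \<bar>C\<bar>))"
    by (simp add: u_def)
qed

text \<open>Caps the radius on which the weights live when \<open>h\<close> exceeds the diameter of
  the cube.\<close>

lemma norm_diff_unit_cube:
  fixes x y :: "real ^ 'd"
  assumes "x \<in> cbox 0 1" "y \<in> cbox 0 1"
  shows "norm (x - y) \<le> sqrt (real CARD('d))"
proof -
  have "\<bar>(x - y) $ i\<bar> \<le> 1" for i
    using assms[unfolded mem_box_cart] by (simp add: abs_le_iff) (smt (verit))
  then have "(\<Sum>i\<in>UNIV. ((x - y) $ i)\<^sup>2) \<le> (\<Sum>i\<in>(UNIV :: 'd set). 1)"
    by (intro sum_mono) (simp add: abs_square_le_1)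
  then show ?thesis
    by (simp add: norm_vec_def L2_set_def)
qed

text \<open>Non-asymptotic form of the result. The radius \<open>\<rho>\<close> adds the spatial
  reach of the weights to the last observation time, so every evaluated pair lies in
  \<open>cyl \<rho>\<close>. The expansion is assumed for this one radius, which lets the caller
  choose \<open>C\<close> uniformly beforehand.\<close>

lemma risk_bound:
  fixes f :: "real ^ 'd \<Rightarrow> real ^ 'd" and x :: "nat \<Rightarrow> real ^ 'd"
    and \<epsilon> Y :: "nat \<Rightarrow> nat \<Rightarrow> 'w \<Rightarrow> real ^ 'd"
  assumes "\<beta> \<ge> 1" "m > 0" "h > 0" and y: "y \<in> cbox 0 1"
    and model: "stubble_model \<beta> L \<sigma> m M f x \<Delta> \<epsilon> Y"
    and eig: "eigenvalue_condition (\<beta> - 1) K Ce h m x" and cover: "cover_condition Cc m x"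
    and ker: "kernel_condition Ck K"
    and a: "1 / (real m * h ^ CARD('d)) \<le> a"
    and \<rho>: "\<rho> = min h (sqrt (real CARD('d))) + real \<beta> * \<Delta>" and "C \<ge> 0"
    and expansion: "\<And>c. \<exists>q. (\<forall>k<\<beta>. homogeneous k (q k)) \<and>
          (\<forall>z t. (z, t) \<in> cyl \<rho> \<longrightarrow>
             \<bar>flow f (y + z) t $ c - (y + z) $ c - (\<Sum>k<\<beta>. t * q k z t)\<bar> \<le> C * \<rho> ^ \<beta> * t) \<and>
          \<bar>q 0 0 0 - f y $ c\<bar> \<le> C * \<rho> ^ \<beta>"
  defines "w \<equiv> real (card (multi_indices (\<beta> - 1) :: ('d \<Rightarrow> nat) set)) * Ce * Ck"
  shows "integrable M (squared_error \<beta> K h m x \<Delta> Y f y)"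
    and "integral\<^sup>L M (squared_error \<beta> K h m x \<Delta> Y f y) \<le>
      real CARD('d) * (((\<Sum>i=1..\<beta>. \<bar>deriv_weight \<beta> i\<bar> * real i) * (w * (a + \<bar>Cc\<bar>)) + 1) * C)\<^sup>2 * \<rho> ^ (2 * \<beta>)
      + \<sigma>\<^sup>2 * (\<Sum>i=1..\<beta>. (deriv_weight \<beta> i)\<^sup>2) * w * (w * (a + \<bar>Cc\<bar>)) * (1 / (real m * h ^ CARD('d)) / \<Delta>\<^sup>2)"
proof -
  have "\<Delta> > 0" and noise: "noise_model \<beta> m \<sigma> M \<epsilon>" and f: "f \<in> smooth_class \<beta> L"
    and x: "\<And>j. j \<in> {1..m} \<Longrightarrow> x j \<in> cbox 0 1"
    and Y: "\<And>j i \<omega>. j \<in> {1..m} \<Longrightarrow> i \<in> {1..\<beta>} \<Longrightarrow> \<omega> \<in> space M \<Longrightarrow>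
        Y j i \<omega> = flow f (x j) (real i * \<Delta>) + \<epsilon> j i \<omega>"
    using model unfolding stubble_model_def by blast+
  interpret prob_space M using noise by (simp add: noise_model_def)
  from lp_weights_exist[OF \<open>m > 0\<close> \<open>h > 0\<close> y eig ker]
  obtain W where W: "\<forall>Z. lp_estimate (\<beta> - 1) K h m x Z y = (\<Sum>j=1..m. W j * Z j)"
    and mom: "\<forall>\<alpha>\<in>multi_indices (\<beta> - 1).
      (\<Sum>j=1..m. W j * (\<Prod>i\<in>UNIV. (x j - y) $ i ^ \<alpha> i)) = (if \<alpha> = (\<lambda>_. 0) then 1 else 0)"
    and loc: "\<forall>j. norm (x j - y) > h \<longrightarrow> W j = 0"
    and W_le: "\<forall>j. \<bar>W j\<bar> \<le> w / (real m * h ^ CARD('d))"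
    unfolding w_def by blast
  note sums = weights_sum_le[OF \<open>m > 0\<close> \<open>h > 0\<close> y cover loc[rule_format] W_le[rule_format] a]
  define S where "S = w * (a + \<bar>Cc\<bar>)"
  define \<Lambda> where "\<Lambda> = (\<Sum>i=1..\<beta>. \<bar>deriv_weight \<beta> i\<bar> * real i)"
  \<comment> \<open>The bias: the error that the estimator makes on noise-free data.\<close>
  define b where "b = (\<Sum>i=1..\<beta>. \<Sum>j=1..m. (deriv_weight \<beta> i / \<Delta> * W j) *\<^sub>R (flow f (x j) (real i * \<Delta>) - x j)) - f y"
  have \<rho>': "real \<beta> * \<Delta> \<le> \<rho>" unfolding \<rho> using \<open>h > 0\<close> by (simp add: min_def)
  have loc': "norm (x j - y) \<le> \<rho>" if "j \<in> {1..m}" "W j \<noteq> 0" for j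
  proof -
    have "norm (x j - y) \<le> min h (sqrt (real CARD('d)))"
      using loc[rule_format, of j] that(2) norm_diff_unit_cube[OF x[OF that(1)] y] by force
    also have "\<dots> \<le> \<rho>" using \<open>\<Delta> > 0\<close> by (simp add: \<rho>)
    finally show ?thesis .
  qed
  have b_le: "\<bar>b $ c\<bar> \<le> (\<Lambda> * S + 1) * C * \<rho> ^ \<beta>" for c
  proof -
    from expansion[of c] obtain q where "\<forall>k<\<beta>. homogeneous k (q k)"
      "\<forall>z t. (z, t) \<in> cyl \<rho> \<longrightarrow>
             \<bar>flow f (y + z) t $ c - (y + z) $ c - (\<Sum>k<\<beta>. t * q k z t)\<bar> \<le> C * \<rho> ^ \<beta> * t"
      "\<bar>q 0 0 0 - f y $ c\<bar> \<le> C * \<rho> ^ \<beta>" by blast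
    from weights_bias[OF mom[rule_format] \<open>\<beta> \<ge> 1\<close> \<open>\<Delta> > 0\<close> \<rho>' loc' sums(1) \<open>C \<ge> 0\<close> this]
    show ?thesis by (simp add: b_def \<Lambda>_def S_def)
  qed
  have "(norm b)\<^sup>2 \<le> (\<Sum>c\<in>(UNIV :: 'd set). ((\<Lambda> * S + 1) * C * \<rho> ^ \<beta>)\<^sup>2)"
    unfolding power2_norm_vec
  proof (rule sum_mono)
    fix c
    show "(b $ c)\<^sup>2 \<le> ((\<Lambda> * S + 1) * C * \<rho> ^ \<beta>)\<^sup>2"
      using power_mono[OF b_le[of c], of 2] by simp
  qed
  then have b2: "(norm b)\<^sup>2 \<le> real CARD('d) * ((\<Lambda> * S + 1) * C)\<^sup>2 * \<rho> ^ (2 * \<beta>)"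
    by (simp add: power_mult_distrib power_mult[symmetric] mult.commute[of \<beta>] mult.assoc)
  \<comment> \<open>Indexing by pairs matches the joint independence in \<open>noise_model\<close>,
    so all \<open>\<beta> * m\<close> noise vectors are handled in one sum.\<close>
  define V where "V = (\<lambda>(j, i). deriv_weight \<beta> i / \<Delta> * W j)"
  define J where "J = {1..m} \<times> {1..\<beta>}"
  define X where "X = (\<lambda>(j, i). \<epsilon> j i)"
  have err: "squared_error \<beta> K h m x \<Delta> Y f y \<omega> = (norm (b + (\<Sum>p\<in>J. V p *\<^sub>R X p \<omega>)))\<^sup>2"
    if "\<omega> \<in> space M" for \<omega>
  proof -
    have "field_estimate \<beta> K h m x \<Delta> (\<lambda>j i. Y j i \<omega>) y
        = (\<Sum>i=1..\<beta>. \<Sum>j=1..m. (deriv_weight \<beta> i / \<Delta> * W j) *\<^sub>R (Y j i \<omega> - x j))"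
      by (rule field_estimate_linear[OF \<open>\<Delta> > 0\<close> W[rule_format]])
    also have "\<dots> = (\<Sum>i=1..\<beta>. \<Sum>j=1..m. (deriv_weight \<beta> i / \<Delta> * W j) *\<^sub>R (flow f (x j) (real i * \<Delta>) - x j)
        + (deriv_weight \<beta> i / \<Delta> * W j) *\<^sub>R \<epsilon> j i \<omega>)"
      using Y that by (intro sum.cong refl) (simp add: scaleR_add_right scaleR_diff_right)
    also have "\<dots> = (b + f y) + (\<Sum>i=1..\<beta>. \<Sum>j=1..m. (deriv_weight \<beta> i / \<Delta> * W j) *\<^sub>R \<epsilon> j i \<omega>)"
      by (simp add: sum.distrib b_def)
    also have "(\<Sum>i=1..\<beta>. \<Sum>j=1..m. (deriv_weight \<beta> i / \<Delta> * W j) *\<^sub>R \<epsilon> j i \<omega>) = (\<Sum>p\<in>J. V p *\<^sub>R X p \<omega>)"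
      unfolding J_def V_def X_def by (subst sum.swap) (simp add: sum.cartesian_product case_prod_unfold)
    finally show ?thesis by (simp add: squared_error_def algebra_simps)
  qed
  have fin: "finite J" by (simp add: J_def)
  have ind: "indep_vars (\<lambda>_. borel) X J"
    using noise by (simp add: noise_model_def J_def X_def)
  have sq: "integrable M (\<lambda>\<omega>. (norm (X p \<omega>))\<^sup>2)" and mean: "expectation (X p) = 0"
    and var: "expectation (\<lambda>\<omega>. (norm (X p \<omega>))\<^sup>2) \<le> \<sigma>\<^sup>2" if "p \<in> J" for p
    using noise that by (auto simp: noise_model_def J_def X_def)
  note second = second_moment_indep_sum_vec[OF fin ind sq mean, of b V]
  show "integrable M (squared_error \<beta> K h m x \<Delta> Y f y)"
    using second(1) by (subst Bochner_Integration.integrable_cong[OF refl err])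
  have "integral\<^sup>L M (squared_error \<beta> K h m x \<Delta> Y f y)
      = expectation (\<lambda>\<omega>. (norm (b + (\<Sum>p\<in>J. V p *\<^sub>R X p \<omega>)))\<^sup>2)"
    by (intro Bochner_Integration.integral_cong err) auto
  also note second(2)
  also have "(\<Sum>p\<in>J. (V p)\<^sup>2 * expectation (\<lambda>\<omega>. (norm (X p \<omega>))\<^sup>2)) \<le> (\<Sum>p\<in>J. (V p)\<^sup>2 * \<sigma>\<^sup>2)"
    using var by (intro sum_mono mult_left_mono) auto
  also have "(\<Sum>p\<in>J. (V p)\<^sup>2 * \<sigma>\<^sup>2)
      = \<sigma>\<^sup>2 * (\<Sum>i=1..\<beta>. (deriv_weight \<beta> i)\<^sup>2) / \<Delta>\<^sup>2 * (\<Sum>j=1..m. (W j)\<^sup>2)"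
  proof -
    have "(\<Sum>p\<in>J. (V p)\<^sup>2 * \<sigma>\<^sup>2) = (\<Sum>j=1..m. \<Sum>i=1..\<beta>. \<sigma>\<^sup>2 / \<Delta>\<^sup>2 * ((W j)\<^sup>2 * (deriv_weight \<beta> i)\<^sup>2))"
      unfolding J_def V_def sum.cartesian_product
      by (intro sum.cong) (auto simp: power_mult_distrib power_divide)
    also have "\<dots> = \<sigma>\<^sup>2 / \<Delta>\<^sup>2 * ((\<Sum>j=1..m. (W j)\<^sup>2) * (\<Sum>i=1..\<beta>. (deriv_weight \<beta> i)\<^sup>2))"
      unfolding sum_product by (simp only: sum_distrib_left)
    finally show ?thesis by (simp add: mult_ac)
  qed
  also have "\<dots> \<le> \<sigma>\<^sup>2 * (\<Sum>i=1..\<beta>. (deriv_weight \<beta> i)\<^sup>2) / \<Delta>\<^sup>2 * (w / (real m * h ^ CARD('d)) * S)"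
    unfolding S_def by (intro mult_left_mono sums(2) divide_nonneg_nonneg mult_nonneg_nonneg sum_nonneg) auto
  finally have "integral\<^sup>L M (squared_error \<beta> K h m x \<Delta> Y f y)
      \<le> real CARD('d) * ((\<Lambda> * S + 1) * C)\<^sup>2 * \<rho> ^ (2 * \<beta>)
        + \<sigma>\<^sup>2 * (\<Sum>i=1..\<beta>. (deriv_weight \<beta> i)\<^sup>2) / \<Delta>\<^sup>2 * (w / (real m * h ^ CARD('d)) * S)"
    using b2 by linarith
  also have "\<sigma>\<^sup>2 * (\<Sum>i=1..\<beta>. (deriv_weight \<beta> i)\<^sup>2) / \<Delta>\<^sup>2 * (w / (real m * h ^ CARD('d)) * S)
      = \<sigma>\<^sup>2 * (\<Sum>i=1..\<beta>. (deriv_weight \<beta> i)\<^sup>2) * w * S * (1 / (real m * h ^ CARD('d)) / \<Delta>\<^sup>2)"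
    by (simp add: field_simps)
  finally show "integral\<^sup>L M (squared_error \<beta> K h m x \<Delta> Y f y) \<le>
      real CARD('d) * (((\<Sum>i=1..\<beta>. \<bar>deriv_weight \<beta> i\<bar> * real i) * (w * (a + \<bar>Cc\<bar>)) + 1) * C)\<^sup>2 * \<rho> ^ (2 * \<beta>)
      + \<sigma>\<^sup>2 * (\<Sum>i=1..\<beta>. (deriv_weight \<beta> i)\<^sup>2) * w * (w * (a + \<bar>Cc\<bar>)) * (1 / (real m * h ^ CARD('d)) / \<Delta>\<^sup>2)"
    unfolding \<Lambda>_def S_def .
qed

section \<open>From asymptotic orders to eventual bounds\<close>

lemma asymp_leD:
  assumes "asymp_le a b" "\<forall>\<^sub>F n in sequentially. b n > 0"
  obtains C where "C > 0" "\<forall>\<^sub>F n in sequentially. a n \<le> C * b n"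
proof -
  obtain k where "limsup (\<lambda>n. ereal (a n / b n)) < ereal (real k)"
    using assms(1) by (auto simp: asymp_le_def less_PInf_Ex_of_nat)
  then have "\<forall>\<^sub>F n in sequentially. ereal (a n / b n) < ereal (real k)"
    by (rule Limsup_lessD)
  \<comment> \<open>The slack 1 makes the constant positive, as \<open>k\<close> can be 0 for a
    negative limit superior.\<close>
  with assms(2) have "\<forall>\<^sub>F n in sequentially. a n \<le> (real k + 1) * b n"
    by eventually_elim (simp add: field_simps)
  then show thesis by (intro that[of "real k + 1"]) auto
qed

lemma asymp_leI:
  assumes "\<forall>\<^sub>F n in sequentially. a n \<le> C * b n" "\<forall>\<^sub>F n in sequentially. b n > 0"
  shows "asymp_le a b"
proof -
  have "\<forall>\<^sub>F n in sequentially. ereal (a n / b n) \<le> ereal C"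
    using assms by eventually_elim (simp add: field_simps)
  then have "limsup (\<lambda>n. ereal (a n / b n)) \<le> ereal C"
    by (rule Limsup_bounded)
  then show ?thesis
    unfolding asymp_le_def by (rule le_less_trans) simp
qed

text \<open>The balance rests on \<open>s - d = 2 * \<beta>\<close>: the variance order
  \<open>N powr (d / s) / N\<close> then coincides with the order of
  \<open>h ^ (2 * \<beta>)\<close>. The second bound is the one that tames the \<open>1 / m\<close>
  of the cover condition.\<close>

lemma bandwidth_rates:
  fixes \<Delta> h c\<^sub>1 c\<^sub>2 c\<^sub>3 :: real and \<beta> m d :: nat
  defines "N \<equiv> \<Delta>\<^sup>2 * real (\<beta> * m)" and "s \<equiv> 2 * real \<beta> + real d"
  assumes "\<beta> \<ge> 1" "m \<ge> 1" and \<Delta>: "0 < \<Delta>" "\<Delta> \<le> c\<^sub>3" and "h > 0" "c\<^sub>2 > 0"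
    and h: "h \<le> c\<^sub>1 * N powr (- 1 / s)" "N powr (- 1 / s) \<le> c\<^sub>2 * h"
  shows "h ^ (2 * \<beta>) \<le> c\<^sub>1 ^ (2 * \<beta>) * N powr (- (2 * real \<beta>) / s)"
    and "1 / (real m * h ^ d) \<le> c\<^sub>2 ^ d * (1 + c\<^sub>3\<^sup>2 * real \<beta>)"
    and "1 / (real m * h ^ d) / \<Delta>\<^sup>2 \<le> real \<beta> * c\<^sub>2 ^ d * N powr (- (2 * real \<beta>) / s)"
proof -
  have N: "N > 0" using assms by (simp add: N_def)
  have s: "s > 0" using assms by (simp add: s_def)
  have pow: "(N powr e) ^ n = N powr (e * real n)" for e n
    using N by (simp add: powr_realpow[symmetric] powr_powr)
  show "h ^ (2 * \<beta>) \<le> c\<^sub>1 ^ (2 * \<beta>) * N powr (- (2 * real \<beta>) / s)"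
  proof -
    have "h ^ (2 * \<beta>) \<le> (c\<^sub>1 * N powr (- 1 / s)) ^ (2 * \<beta>)"
      using h(1) \<open>h > 0\<close> by (intro power_mono) auto
    then show ?thesis by (simp add: power_mult_distrib pow)
  qed
  have inv: "1 / h ^ d \<le> c\<^sub>2 ^ d * N powr (real d / s)"
  proof -
    have "1 / h \<le> c\<^sub>2 * N powr (1 / s)"
      using h(2) N \<open>h > 0\<close> by (simp add: powr_minus divide_minus_left field_simps)
    then have "(1 / h) ^ d \<le> (c\<^sub>2 * N powr (1 / s)) ^ d"
      using \<open>h > 0\<close> by (intro power_mono) auto
    then show ?thesis by (simp add: power_mult_distrib power_one_over pow)
  qed
  show "1 / (real m * h ^ d) \<le> c\<^sub>2 ^ d * (1 + c\<^sub>3\<^sup>2 * real \<beta>)"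
  proof -
    \<comment> \<open>\<open>N\<close> may be small or large; as \<open>d / s \<le> 1\<close>, the
      bound \<open>1 + N\<close> covers both cases. It grows at most linearly in \<open>m\<close>
      for bounded \<open>\<Delta>\<close>, which compensates the \<open>m\<close> in the
      denominator.\<close>
    have "N powr (real d / s) \<le> 1 + N"
    proof (cases "N \<le> 1")
      case True
      then have "N powr (real d / s) \<le> 1 powr (real d / s)"
        using N s by (intro powr_mono2) auto
      then show ?thesis using N by simp
    next
      case False
      then have "N powr (real d / s) \<le> N powr 1"
        using s by (intro powr_mono) (auto simp: s_def)
      then show ?thesis using N by simp
    qed
    also have "1 + N \<le> real m * (1 + \<Delta>\<^sup>2 * real \<beta>)"
      using \<open>m \<ge> 1\<close> by (simp add: N_def algebra_simps)
    also have "\<dots> \<le> real m * (1 + c\<^sub>3\<^sup>2 * real \<beta>)"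
      using \<Delta> by (intro mult_left_mono add_left_mono mult_right_mono power_mono) auto
    finally have "c\<^sub>2 ^ d * N powr (real d / s) \<le> c\<^sub>2 ^ d * (real m * (1 + c\<^sub>3\<^sup>2 * real \<beta>))"
      using \<open>c\<^sub>2 > 0\<close> by (intro mult_left_mono) auto
    with inv have "1 / h ^ d \<le> real m * (c\<^sub>2 ^ d * (1 + c\<^sub>3\<^sup>2 * real \<beta>))"
      by (simp add: mult_ac)
    then show ?thesis
      using \<open>m \<ge> 1\<close> \<open>h > 0\<close> by (simp add: field_simps)
  qed
  show "1 / (real m * h ^ d) / \<Delta>\<^sup>2 \<le> real \<beta> * c\<^sub>2 ^ d * N powr (- (2 * real \<beta>) / s)"
  proof -
    have "1 / (real m * h ^ d) / \<Delta>\<^sup>2 = real \<beta> / N * (1 / h ^ d)"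
      using assms(3,4) \<Delta> by (simp add: N_def field_simps)
    also have "\<dots> \<le> real \<beta> / N * (c\<^sub>2 ^ d * N powr (real d / s))"
      using inv N by (intro mult_left_mono) auto
    also have "\<dots> = real \<beta> * c\<^sub>2 ^ d * (N powr (real d / s) / N powr 1)"
      using N by simp
    also have "N powr (real d / s) / N powr 1 = N powr (real d / s - 1)"
      by (rule powr_diff[symmetric])
    also have "real d / s - 1 = - (2 * real \<beta>) / s"
      using s by (simp add: s_def field_simps)
    finally show ?thesis .
  qed
qed

lemma power_add_le:
  fixes a b :: real
  assumes "0 \<le> a" "0 \<le> b"
  shows "(a + b) ^ n \<le> 2 ^ n * (a ^ n + b ^ n)"
proof -
  have "(a + b) ^ n \<le> (2 * max a b) ^ n"
    using assms by (intro power_mono) auto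
  also have "\<dots> = 2 ^ n * (max a b) ^ n"
    by (rule power_mult_distrib)
  also have "\<dots> \<le> 2 ^ n * (a ^ n + b ^ n)"
    using assms by (intro mult_left_mono) (auto simp: max_def)
  finally show ?thesis .
qed

text \<open>The limit is taken in \<open>m\<close>, equivalent to \<open>n = \<beta> * m\<close> for
  fixed \<open>\<beta>\<close>. Field, design, probability space and evaluation point may vary with
  \<open>m\<close>, so the constants must be fixed before \<open>m\<close>. Integrability is
  asserted as well, because the Bochner integral of a non-integrable function is 0 and would satisfy
  the bound trivially.\<close>

theorem corollary3p13:
  fixes \<beta> :: nat
    and L :: "nat \<Rightarrow> real"
    and \<sigma> C\<^sub>e\<^sub>g\<^sub>v C\<^sub>c\<^sub>v\<^sub>r C\<^sub>k\<^sub>e\<^sub>r :: real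
    and K :: "real \<Rightarrow> real"
    and M :: "nat \<Rightarrow> 'w measure"
    and f :: "nat \<Rightarrow> real ^ 'd \<Rightarrow> real ^ 'd"
    and x :: "nat \<Rightarrow> nat \<Rightarrow> real ^ 'd"
    and \<Delta> h :: "nat \<Rightarrow> real"
    and \<epsilon> Y :: "nat \<Rightarrow> nat \<Rightarrow> nat \<Rightarrow> 'w \<Rightarrow> real ^ 'd"
    and x\<^sub>0 :: "nat \<Rightarrow> real ^ 'd"
  assumes "\<beta> \<ge> 1" and "\<forall>k\<le>\<beta>. L k > 0" and "\<sigma> \<ge> 0"
    and model: "\<forall>\<^sub>F m in sequentially. stubble_model \<beta> L \<sigma> m (M m) (f m) (x m) (\<Delta> m) (\<epsilon> m) (Y m)"
    and step: "asymp_le \<Delta> (\<lambda>_. 1)"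
    and bandwidth_pos: "\<forall>\<^sub>F m in sequentially. h m > 0"
    and bandwidth: "asymp_same h
          (\<lambda>m. ((\<Delta> m)\<^sup>2 * real (\<beta> * m)) powr (- 1 / (2 * real \<beta> + real CARD('d))))"
    and eigenvalue: "\<forall>\<^sub>F m in sequentially. eigenvalue_condition (\<beta> - 1) K C\<^sub>e\<^sub>g\<^sub>v (h m) m (x m)"
    and cover: "\<forall>\<^sub>F m in sequentially. cover_condition C\<^sub>c\<^sub>v\<^sub>r m (x m)"
    and kernel: "kernel_condition C\<^sub>k\<^sub>e\<^sub>r K"
    and x\<^sub>0: "\<And>m. x\<^sub>0 m \<in> cbox 0 1"
  shows "(\<forall>\<^sub>F m in sequentially.
            integrable (M m) (squared_error \<beta> K (h m) m (x m) (\<Delta> m) (Y m) (f m) (x\<^sub>0 m))) \<and>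
         asymp_le
           (\<lambda>m. integral\<^sup>L (M m) (squared_error \<beta> K (h m) m (x m) (\<Delta> m) (Y m) (f m) (x\<^sub>0 m)))
           (\<lambda>m. ((\<Delta> m)\<^sup>2 * real (\<beta> * m)) powr (- (2 * real \<beta>) / (2 * real \<beta> + real CARD('d)))
                + \<Delta> m ^ (2 * \<beta>))"
proof -
  let ?d = "CARD('d)"
  define s where "s = 2 * real \<beta> + real ?d"
  define N where "N m = (\<Delta> m)\<^sup>2 * real (\<beta> * m)" for m
  define T where "T m = N m powr (- (2 * real \<beta>) / s)" for m
  have ev_m: "\<forall>\<^sub>F m in sequentially. m \<ge> 1"
    by (rule eventually_ge_at_top)
  have ev_\<Delta>: "\<forall>\<^sub>F m in sequentially. \<Delta> m > 0"
    using model by eventually_elim (simp add: stubble_model_def)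
  have ev_N: "\<forall>\<^sub>F m in sequentially. N m > 0"
    using ev_m ev_\<Delta> by eventually_elim (use \<open>\<beta> \<ge> 1\<close> in \<open>simp add: N_def\<close>)
  then have ev_B: "\<forall>\<^sub>F m in sequentially. N m powr (- 1 / s) > 0"
    by eventually_elim simp
  obtain c\<^sub>3 where c\<^sub>3: "c\<^sub>3 > 0" and ev_c\<^sub>3: "\<forall>\<^sub>F m in sequentially. \<Delta> m \<le> c\<^sub>3 * 1"
    by (rule asymp_leD[OF step]) simp_all
  have "asymp_same h (\<lambda>m. N m powr (- 1 / s))"
    using bandwidth by (simp add: N_def s_def)
  then have bw: "asymp_le h (\<lambda>m. N m powr (- 1 / s))" "asymp_le (\<lambda>m. N m powr (- 1 / s)) h"
    by (simp_all add: asymp_same_def)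
  obtain c\<^sub>1 where ev_c\<^sub>1: "\<forall>\<^sub>F m in sequentially. h m \<le> c\<^sub>1 * N m powr (- 1 / s)"
    by (rule asymp_leD[OF bw(1) ev_B])
  obtain c\<^sub>2 where c\<^sub>2: "c\<^sub>2 > 0" and ev_c\<^sub>2: "\<forall>\<^sub>F m in sequentially. N m powr (- 1 / s) \<le> c\<^sub>2 * h m"
    by (rule asymp_leD[OF bw(2) bandwidth_pos])
  \<comment> \<open>An eventual upper bound for \<open>\<rho>\<close>, from the cap on
    \<open>h\<close> and the bound \<open>c\<^sub>3\<close> on the step; adding 1 ensures
    \<open>R \<ge> 1\<close>, as products of approximations require.\<close>
  define R where "R = sqrt (real ?d) + real \<beta> * c\<^sub>3 + 1"
  have "R \<ge> 1" using c\<^sub>3 by (simp add: R_def)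
  obtain C where "C \<ge> 0" and expansion: "\<And>(f :: real ^ 'd \<Rightarrow> real ^ 'd) \<rho> c y. f \<in> smooth_class \<beta> L \<Longrightarrow> 0 \<le> \<rho> \<Longrightarrow> \<rho> \<le> R \<Longrightarrow>
      \<exists>q. (\<forall>k<\<beta>. homogeneous k (q k)) \<and>
          (\<forall>z t. (z, t) \<in> cyl \<rho> \<longrightarrow>
             \<bar>flow f (y + z) t $ c - (y + z) $ c - (\<Sum>k<\<beta>. t * q k z t)\<bar> \<le> C * \<rho> ^ \<beta> * t) \<and>
          \<bar>q 0 0 0 - f y $ c\<bar> \<le> C * \<rho> ^ \<beta>"
    by (rule flow_expansion[OF assms(1,2) \<open>R \<ge> 1\<close>]) blast
  define a where "a = c\<^sub>2 ^ ?d * (1 + c\<^sub>3\<^sup>2 * real \<beta>)"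
  define w where "w = real (card (multi_indices (\<beta> - 1) :: ('d \<Rightarrow> nat) set)) * C\<^sub>e\<^sub>g\<^sub>v * C\<^sub>k\<^sub>e\<^sub>r"
  define P\<^sub>1 where "P\<^sub>1 = real ?d * (((\<Sum>i=1..\<beta>. \<bar>deriv_weight \<beta> i\<bar> * real i) * (w * (a + \<bar>C\<^sub>c\<^sub>v\<^sub>r\<bar>)) + 1) * C)\<^sup>2"
  define P\<^sub>2 where "P\<^sub>2 = \<sigma>\<^sup>2 * (\<Sum>i=1..\<beta>. (deriv_weight \<beta> i)\<^sup>2) * w * (w * (a + \<bar>C\<^sub>c\<^sub>v\<^sub>r\<bar>))"
  have "P\<^sub>1 \<ge> 0" by (simp add: P\<^sub>1_def)
  define Q\<^sub>1 where "Q\<^sub>1 = P\<^sub>1 * 2 ^ (2 * \<beta>) * c\<^sub>1 ^ (2 * \<beta>) + \<bar>P\<^sub>2\<bar> * (real \<beta> * c\<^sub>2 ^ ?d)"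
  define Q\<^sub>2 where "Q\<^sub>2 = P\<^sub>1 * 2 ^ (2 * \<beta>) * real \<beta> ^ (2 * \<beta>)"
  \<comment> \<open>\<open>Q\<^sub>1\<close> collects what multiplies \<open>T m\<close>, namely the
    variance and the share of \<open>h\<close> in the bias; \<open>Q\<^sub>2\<close> collects the
    share of \<open>\<Delta>\<close>. The power of 2 comes from splitting
    \<open>\<rho> ^ (2 * \<beta>)\<close> into these two shares.\<close>
  have main: "\<forall>\<^sub>F m in sequentially.
      integrable (M m) (squared_error \<beta> K (h m) m (x m) (\<Delta> m) (Y m) (f m) (x\<^sub>0 m)) \<and>
      integral\<^sup>L (M m) (squared_error \<beta> K (h m) m (x m) (\<Delta> m) (Y m) (f m) (x\<^sub>0 m))
        \<le> max Q\<^sub>1 Q\<^sub>2 * (T m + \<Delta> m ^ (2 * \<beta>))"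
    using model bandwidth_pos eigenvalue cover ev_m ev_\<Delta> ev_c\<^sub>1 ev_c\<^sub>2 ev_c\<^sub>3
  proof eventually_elim
    case (elim m)
    then have h: "h m > 0" and m: "m \<ge> 1" "m > 0" and \<Delta>: "\<Delta> m > 0" "\<Delta> m \<le> c\<^sub>3" by auto
    have f: "f m \<in> smooth_class \<beta> L" using elim(1) by (simp add: stubble_model_def)
    note rates = bandwidth_rates[OF assms(1) m(1) \<Delta> h c\<^sub>2, of c\<^sub>1 ?d, folded s_def, folded N_def,
        OF elim(7,8), folded T_def, folded a_def]
    define \<rho> where "\<rho> = min (h m) (sqrt (real ?d)) + real \<beta> * \<Delta> m"
    have "min (h m) (sqrt (real ?d)) \<ge> 0" using h by simp
    then have \<rho>: "0 \<le> \<rho>" "\<rho> \<le> h m + real \<beta> * \<Delta> m" using \<Delta> by (auto simp: \<rho>_def)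
    have "real \<beta> * \<Delta> m \<le> real \<beta> * c\<^sub>3" using \<Delta> by (intro mult_left_mono) auto
    then have "\<rho> \<le> R" by (simp add: \<rho>_def R_def)
    note risk = risk_bound[OF assms(1) m(2) h x\<^sub>0[of m] elim(1) elim(3) elim(4) kernel rates(2) \<rho>_def \<open>C \<ge> 0\<close>
        expansion[OF f \<rho>(1) \<open>\<rho> \<le> R\<close>], folded w_def, folded P\<^sub>1_def P\<^sub>2_def]
    have "\<rho> ^ (2 * \<beta>) \<le> (h m + real \<beta> * \<Delta> m) ^ (2 * \<beta>)"
      using \<rho> by (intro power_mono)
    also have "\<dots> \<le> 2 ^ (2 * \<beta>) * (h m ^ (2 * \<beta>) + (real \<beta> * \<Delta> m) ^ (2 * \<beta>))"
      using h \<Delta> by (intro power_add_le) auto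
    also have "\<dots> \<le> 2 ^ (2 * \<beta>) * (c\<^sub>1 ^ (2 * \<beta>) * T m + real \<beta> ^ (2 * \<beta>) * \<Delta> m ^ (2 * \<beta>))"
      using rates(1) by (intro mult_left_mono add_mono) (auto simp: power_mult_distrib)
    finally have "P\<^sub>1 * \<rho> ^ (2 * \<beta>)
        \<le> P\<^sub>1 * (2 ^ (2 * \<beta>) * (c\<^sub>1 ^ (2 * \<beta>) * T m + real \<beta> ^ (2 * \<beta>) * \<Delta> m ^ (2 * \<beta>)))"
      using \<open>P\<^sub>1 \<ge> 0\<close> by (rule mult_left_mono)
    moreover have "P\<^sub>2 * (1 / (real m * h m ^ ?d) / (\<Delta> m)\<^sup>2) \<le> \<bar>P\<^sub>2\<bar> * (real \<beta> * c\<^sub>2 ^ ?d * T m)"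
      using rates(3) h by (intro mult_mono) auto
    moreover have "P\<^sub>1 * (2 ^ (2 * \<beta>) * (c\<^sub>1 ^ (2 * \<beta>) * T m + real \<beta> ^ (2 * \<beta>) * \<Delta> m ^ (2 * \<beta>)))
        + \<bar>P\<^sub>2\<bar> * (real \<beta> * c\<^sub>2 ^ ?d * T m) = Q\<^sub>1 * T m + Q\<^sub>2 * \<Delta> m ^ (2 * \<beta>)"
      by (simp add: Q\<^sub>1_def Q\<^sub>2_def algebra_simps)
    moreover have "Q\<^sub>1 * T m + Q\<^sub>2 * \<Delta> m ^ (2 * \<beta>) \<le> max Q\<^sub>1 Q\<^sub>2 * (T m + \<Delta> m ^ (2 * \<beta>))"
      unfolding distrib_left using \<Delta> by (intro add_mono mult_right_mono) (auto simp: T_def)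
    ultimately show ?case using risk(2) by (intro conjI risk(1)) linarith
  qed
  have "\<forall>\<^sub>F m in sequentially. T m + \<Delta> m ^ (2 * \<beta>) > 0"
    using ev_\<Delta> by eventually_elim (simp add: T_def add_nonneg_pos)
  with main have "asymp_le
      (\<lambda>m. integral\<^sup>L (M m) (squared_error \<beta> K (h m) m (x m) (\<Delta> m) (Y m) (f m) (x\<^sub>0 m)))
      (\<lambda>m. T m + \<Delta> m ^ (2 * \<beta>))"
    by (intro asymp_leI[of _ "max Q\<^sub>1 Q\<^sub>2"]) (auto elim: eventually_mono)
  moreover have "\<forall>\<^sub>F m in sequentially.
      integrable (M m) (squared_error \<beta> K (h m) m (x m) (\<Delta> m) (Y m) (f m) (x\<^sub>0 m))"
    using main by (rule eventually_mono) simp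
  ultimately show ?thesis
    by (simp add: T_def N_def s_def)
qed

end
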